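(* Let $\Sigma\subset\mathbb{H}$ be a real-analytic embedded surface in the Heisenberg group $\mathbb{H}$, let $p$ be an isolated characteristic point of $\Sigma$, and let $u\in C^\omega$ be a real-analytic local defining function for $\Sigma$ in a neighborhood of $p$. Denote by $W=\|\nabla u\|$ the norm of the horizontal gradient of $u$. Then $\frac1W$ is locally integrable on $\Sigma$ around $p$ with respect to the Riemannian induced measure $\sigma_{\mathrm{R}}$, i.e. there is a neighborhood $U$ of $p$ in $\mathbb{H}$ such that $$\int_{\Sigma\cap U}\frac1W\,d\sigma_{\mathrm{R}}<+\infty.$$ In particular, the horizontal mean curvature $\mathcal{H}$ of $\Sigma$ is locally integrable around $p$: there is a neighborhood $U$ of $p$ in $\mathbb{H}$ such that $\int_{\Sigma\cap U}|\mathcal{H}|\,d\sigma_{\mathrm{R}}<+\infty$.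
   Context: The Heisenberg group $\mathbb{H}$ is $\mathbb{R}^3$ with the distribution $\mathcal{D}=\ker\left(dz-\frac12(x\,dy-y\,dx)\right)$ and the metric $g$ on $\mathcal{D}$ for which $X=\partial_x-\frac y2\partial_z$, $Y=\partial_y+\frac x2\partial_z$ is an orthonormal frame. It is equipped with the Lebesgue measure $\mu$. Horizontal gradient: $\nabla f=(Xf)X+(Yf)Y$, with norm $\|\nabla f\|=\left((Xf)^2+(Yf)^2\right)^{1/2}$. The divergence $\mathrm{div}_\mu$ is with respect to Lebesgue measure. A local defining function for $\Sigma$ near $p\in\Sigma$ is a function $u$ (here of class at least $C^2$) on a neighborhood $U$ of $p$ with $\Sigma\cap U=\{u=0\}$ and $du\neq0$ on $\Sigma\cap U$. Characteristic points: $p\in\Sigma$ is characteristic if $\mathcal{D}_p\subseteq T_p\Sigma$, equivalently $Xu(p)=Yu(p)=0$. The set of characteristic points is $C(\Sigma)$ (closed, zero measure in $\Sigma$); $p$ is isolated if it is an isolated point of $C(\Sigma)$. Horizontal mean curvature: for $q\in\Sigma\setminus C(\Sigma)$, $\mathcal{H}(q)=-\mathrm{div}_\mu\left(\frac{\nabla u}{\|\nabla u\|}\right)\big|_q$ with $u$ a local defining function for $\Sigma$ near $q$; up to sign it does not depend on $u$. Riemannian induced measure: choose any Riemannian metric on $\mathbb{R}^3$ extending $g$, and let $n$ be the corresponding unit normal to $\Sigma$; $\sigma_{\mathrm{R}}$ is the measure on $\Sigma$ with density $|i_n\mu|$. The choice of extension plays no role in the integrability statement. *)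

theory Defs
  imports "HOL-Analysis.Analysis"
begin

section \<open>Regularity classes on open subsets of Euclidean space\<close>

text \<open>Only meaningful for open sets: total derivatives are taken in the ambient space.\<close>

primrec Ck_on :: "nat \<Rightarrow> (real^'n) set \<Rightarrow> (real^'n \<Rightarrow> 'b::real_normed_vector) \<Rightarrow> bool" where
  "Ck_on 0 U f \<longleftrightarrow> continuous_on U f"
| "Ck_on (Suc k) U f \<longleftrightarrow>
     (\<forall>x\<in>U. f differentiable (at x)) \<and>
     (\<forall>i. Ck_on k U (\<lambda>x. frechet_derivative f (at x) (axis i 1)))"

text \<open>The multi-indices are the functions \<open>'n \<Rightarrow> nat\<close>.\<close>

definition real_analytic_on :: "(real^'n) set \<Rightarrow> (real^'n \<Rightarrow> real) \<Rightarrow> bool" where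
  "real_analytic_on U f \<longleftrightarrow>
     (\<forall>a\<in>U. \<exists>r>0. \<exists>c :: ('n \<Rightarrow> nat) \<Rightarrow> real. \<forall>x\<in>ball a r.
        ((\<lambda>\<alpha>. c \<alpha> * (\<Prod>i\<in>UNIV. (x $ i - a $ i) ^ \<alpha> i)) has_sum f x) UNIV)"


section \<open>The Heisenberg group\<close>

definition heis_X :: "real^3 \<Rightarrow> real^3" where
  "heis_X p = vector [1, 0, - (p $ 2) / 2]"

definition heis_Y :: "real^3 \<Rightarrow> real^3" where
  "heis_Y p = vector [0, 1, (p $ 1) / 2]"

definition heis_distr :: "real^3 \<Rightarrow> (real^3) set" where
  "heis_distr p = {v. v $ 3 - (p $ 1 * v $ 2 - p $ 2 * v $ 1) / 2 = 0}"

definition horizontal_gradient :: "(real^3 \<Rightarrow> real) \<Rightarrow> real^3 \<Rightarrow> real^3" where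
  "horizontal_gradient f p =
     frechet_derivative f (at p) (heis_X p) *\<^sub>R heis_X p +
     frechet_derivative f (at p) (heis_Y p) *\<^sub>R heis_Y p"

text \<open>The norm is that of the sub-Riemannian metric, not the Euclidean norm of
  \<^term>\<open>horizontal_gradient f p\<close>.\<close>

definition horizontal_gradient_norm :: "(real^3 \<Rightarrow> real) \<Rightarrow> real^3 \<Rightarrow> real" where
  "horizontal_gradient_norm f p =
     sqrt ((frechet_derivative f (at p) (heis_X p))\<^sup>2 + (frechet_derivative f (at p) (heis_Y p))\<^sup>2)"

definition divergence :: "(real^3 \<Rightarrow> real^3) \<Rightarrow> real^3 \<Rightarrow> real" where
  "divergence V p = (\<Sum>i\<in>UNIV. frechet_derivative V (at p) (axis i 1) $ i)"


section \<open>Surfaces\<close>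

definition local_defining_function ::
    "(real^3) set \<Rightarrow> real^3 \<Rightarrow> (real^3) set \<Rightarrow> (real^3 \<Rightarrow> real) \<Rightarrow> bool" where
  "local_defining_function S p U u \<longleftrightarrow>
     open U \<and> p \<in> U \<and> Ck_on 2 U u \<and> S \<inter> U = {q \<in> U. u q = 0} \<and>
     (\<forall>q \<in> S \<inter> U. frechet_derivative u (at q) \<noteq> (\<lambda>_. 0))"

definition real_analytic_surface :: "(real^3) set \<Rightarrow> bool" where
  "real_analytic_surface S \<longleftrightarrow>
     (\<forall>p\<in>S. \<exists>U u. local_defining_function S p U u \<and> real_analytic_on U u)"

text \<open>All local defining functions near \<open>p\<close> have the same kernel of the differential at \<open>p\<close>.\<close>

definition tangent_space :: "(real^3) set \<Rightarrow> real^3 \<Rightarrow> (real^3) set" where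
  "tangent_space S p =
     {v. \<forall>U u. local_defining_function S p U u \<longrightarrow> frechet_derivative u (at p) v = 0}"

definition characteristic_points :: "(real^3) set \<Rightarrow> (real^3) set" where
  "characteristic_points S = {p \<in> S. heis_distr p \<subseteq> tangent_space S p}"

text \<open>The curvature is only determined up to sign by the surface. The predicate leaves the sign
  free at each point, and leaves \<open>H\<close> arbitrary at characteristic points.\<close>

definition is_horizontal_mean_curvature :: "(real^3) set \<Rightarrow> (real^3 \<Rightarrow> real) \<Rightarrow> bool" where
  "is_horizontal_mean_curvature S H \<longleftrightarrow>
     (\<forall>q \<in> S - characteristic_points S. \<exists>U u. local_defining_function S q U u \<and>
        H q = - divergence (\<lambda>x. horizontal_gradient u x /\<^sub>R horizontal_gradient_norm u x) q)"


section \<open>Riemannian extensions and the induced measure\<close>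

definition riemannian_metric :: "(real^3 \<Rightarrow> real^3 \<Rightarrow> real^3 \<Rightarrow> real) \<Rightarrow> bool" where
  "riemannian_metric G \<longleftrightarrow>
     (\<forall>p. bilinear (G p) \<and> (\<forall>v w. G p v w = G p w v) \<and> (\<forall>v. v \<noteq> 0 \<longrightarrow> G p v v > 0)) \<and>
     (\<forall>v w k. Ck_on k UNIV (\<lambda>p. G p v w))"

definition extends_heis_metric :: "(real^3 \<Rightarrow> real^3 \<Rightarrow> real^3 \<Rightarrow> real) \<Rightarrow> bool" where
  "extends_heis_metric G \<longleftrightarrow>
     (\<forall>p. G p (heis_X p) (heis_X p) = 1 \<and> G p (heis_Y p) (heis_Y p) = 1 \<and>
          G p (heis_X p) (heis_Y p) = 0)"

definition unit_normal ::
    "(real^3 \<Rightarrow> real^3 \<Rightarrow> real^3 \<Rightarrow> real) \<Rightarrow> (real^3) set \<Rightarrow> real^3 \<Rightarrow> real^3" where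
  "unit_normal G S q = (SOME n. G q n n = 1 \<and> (\<forall>v \<in> tangent_space S q. G q n v = 0))"

text \<open>The density \<open>|i\<^sub>n \<mu>|\<close>, evaluated on a pair of tangent vectors. Here \<open>\<mu>\<close> is the Lebesgue volume
  form and not the Riemannian volume of \<open>G\<close>. The choice of sign of the normal is immaterial.\<close>

definition induced_density ::
    "(real^3 \<Rightarrow> real^3 \<Rightarrow> real^3 \<Rightarrow> real) \<Rightarrow> (real^3) set \<Rightarrow> real^3 \<Rightarrow> real^3 \<Rightarrow> real^3 \<Rightarrow> real" where
  "induced_density G S q v w = \<bar>det (vector [unit_normal G S q, v, w] :: real^3^3)\<bar>"

definition local_parametrization ::
    "(real^3) set \<Rightarrow> (real^2) set \<Rightarrow> (real^2 \<Rightarrow> real^3) \<Rightarrow> bool" where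
  "local_parametrization S V \<phi> \<longleftrightarrow>
     open V \<and> Ck_on 1 V \<phi> \<and> (\<forall>x\<in>V. inj (frechet_derivative \<phi> (at x))) \<and>
     openin (top_of_set S) (\<phi> ` V) \<and> (\<exists>\<psi>. homeomorphism V (\<phi> ` V) \<phi> \<psi>)"

text \<open>A measure with a given density on a surface is the one which in every local parametrization
  has the pulled-back density with respect to Lebesgue measure. Since the parametrized pieces cover
  an embedded surface, this determines the measure.\<close>

definition is_riemannian_induced_measure ::
    "(real^3 \<Rightarrow> real^3 \<Rightarrow> real^3 \<Rightarrow> real) \<Rightarrow> (real^3) set \<Rightarrow> (real^3) measure \<Rightarrow> bool" where
  "is_riemannian_induced_measure G S \<sigma> \<longleftrightarrow>
     space \<sigma> = S \<and> sets \<sigma> = sets (restrict_space borel S) \<and>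
     (\<forall>V \<phi> B. local_parametrization S V \<phi> \<and> B \<in> sets borel \<and> B \<subseteq> V \<longrightarrow>
        emeasure \<sigma> (\<phi> ` B) =
          (\<integral>\<^sup>+x\<in>B. ennreal (induced_density G S (\<phi> x)
             (frechet_derivative \<phi> (at x) (axis 1 1))
             (frechet_derivative \<phi> (at x) (axis 2 1))) \<partial>lborel))"

text \<open>Measurability is included because \<^const>\<open>nn_integral\<close> is only a lower integral on
  non-measurable functions.\<close>

definition finite_nn_integral_on :: "'a measure \<Rightarrow> 'a set \<Rightarrow> ('a \<Rightarrow> ennreal) \<Rightarrow> bool" where
  "finite_nn_integral_on M A f \<longleftrightarrow>
     f \<in> borel_measurable (restrict_space M A) \<and> (\<integral>\<^sup>+x\<in>A. f x \<partial>M) < \<infinity>"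

end

theory Submission
  imports Defs "HOL-Complex_Analysis.Conformal_Mappings"
begin

text \<open>
  Write \<open>a = X u\<close> and \<open>b = Y u\<close>, so \<open>W = sqrt (a\<^sup>2 + b\<^sup>2)\<close>. At the characteristic point \<open>p\<close> both vanish, hence
  \<open>X b - Y a = [X, Y] u = \<partial>\<^sub>z u\<close> is nonzero there and one of \<open>Y a\<close>, \<open>X b\<close> is nonzero, say \<open>Y a\<close>. Then
  \<open>(x, a, u)\<close> are local \<open>C\<^sup>1\<close> coordinates, and \<open>(s, t) = (x, a)\<close> parametrizes the surface. By the inverse
  function theorem for the complexified power series, \<open>b\<close> restricted to the curve \<open>a = u = 0\<close> is the
  restriction of a holomorphic function of \<open>s\<close>. It has no zero besides \<open>p\<close> because \<open>p\<close> is isolated, so it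
  is bounded below by \<open>c |s|\<^sup>k\<close>. Since \<open>b\<close> is Lipschitz, \<open>W \<ge> c (|t| + |s|\<^sup>k)\<close>, and by Young's inequality
  \<open>1/W\<close> is dominated by the integrable product \<open>C |s|\<^bsup>-1/2\<^esup> |t|\<^bsup>-1+1/(2k)\<^esup>\<close>.

  The horizontal lines of the Heisenberg group are Euclidean straight lines, so the mean curvature is, up to
  sign, \<open>D\<^sup>2u(v, v) / W\<^sup>3\<close> with \<open>v = b X - a Y\<close> of size \<open>O(W)\<close>, which is \<open>O(1/W)\<close>.
\<close>

section \<open>Complexification of real-analytic functions\<close>

text \<open>Finite order is what makes the integral converge. Near the origin, integrating
  \<open>1/(|t| + |s|^k)\<close> over \<open>t\<close> leaves a term of size
  \<open>k log(1/|s|)\<close>, which is integrable for every finite \<open>k\<close>; a flat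
  function such as \<open>exp (-1/s^2)\<close> in place of \<open>|s|^k\<close> would leave
  \<open>1/s^2\<close>. The real inverse function theorem gives the curve \<open>a = u = 0\<close>
  only as a C^1 curve, on which orders of vanishing make no sense. Over the complex numbers a C^1
  inverse with complex-linear derivative is already holomorphic. The curvature brings a second
  obstacle. Its predicate admits a different C^2 defining function \<open>u'\<close> at every point,
  and the quotient \<open>u'/u\<close> is in general only C^1, so the product rule cannot be applied
  twice to \<open>u'\<close>. The Hessians of \<open>u\<close> and \<open>u'\<close> on tangent
  vectors are compared through Taylor expansions along the common zero set instead.\<close>

text \<open>The derivative is prescribed as a sum of products in the field \<open>'a\<close>. Over
  \<open>complex\<close> this makes it complex-linear, although \<open>has_derivative\<close> alone
  is only real-linear, so one notion serves as C^1 over the reals and as holomorphic over the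
  complex numbers.\<close>

definition C1_partials ::
    "('a::real_normed_field ^ 'n) set \<Rightarrow> ('a ^ 'n \<Rightarrow> 'a) \<Rightarrow> ('n \<Rightarrow> 'a ^ 'n \<Rightarrow> 'a) \<Rightarrow> bool" where
  "C1_partials U f D \<longleftrightarrow>
     (\<forall>x\<in>U. (f has_derivative (\<lambda>h. \<Sum>i\<in>UNIV. D i x * h $ i)) (at x)) \<and>
     (\<forall>i. continuous_on U (D i))"

lemma C1_partialsI:
  assumes "\<And>x. x \<in> U \<Longrightarrow> (f has_derivative (\<lambda>h. \<Sum>i\<in>UNIV. D i x * h $ i)) (at x)"
    and "\<And>i. continuous_on U (D i)"
  shows "C1_partials U f D"
  using assms by (simp add: C1_partials_def)

lemma C1_partialsD:
  assumes "C1_partials U f D"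
  shows "x \<in> U \<Longrightarrow> (f has_derivative (\<lambda>h. \<Sum>i\<in>UNIV. D i x * h $ i)) (at x)"
    and "continuous_on U (D i)"
  using assms by (auto simp: C1_partials_def)

lemma C1_partials_subset: "C1_partials U f D \<Longrightarrow> V \<subseteq> U \<Longrightarrow> C1_partials V f D"
  unfolding C1_partials_def by (meson continuous_on_subset subsetD)

lemma C1_partials_continuous: "C1_partials U f D \<Longrightarrow> continuous_on U f"
  unfolding C1_partials_def
  by (meson continuous_at_imp_continuous_on has_derivative_continuous)

lemma C1_partials_add:
  assumes f: "C1_partials U f D" and g: "C1_partials U g E"
  shows "C1_partials U (\<lambda>x. f x + g x) (\<lambda>i x. D i x + E i x)"
proof (rule C1_partialsI)
  show "((\<lambda>x. f x + g x) has_derivative (\<lambda>h. \<Sum>i\<in>UNIV. (D i x + E i x) * h $ i)) (at x)"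
    if "x \<in> U" for x
    using has_derivative_add[OF C1_partialsD(1)[OF f that] C1_partialsD(1)[OF g that]]
    by (simp add: distrib_right sum.distrib)
qed (intro continuous_on_add C1_partialsD(2)[OF f] C1_partialsD(2)[OF g])

lemma C1_partials_mult:
  assumes f: "C1_partials U f D" and g: "C1_partials U g E"
  shows "C1_partials U (\<lambda>x. f x * g x) (\<lambda>i x. D i x * g x + f x * E i x)"
proof (rule C1_partialsI)
  fix x assume "x \<in> U"
  have "f x * (\<Sum>i\<in>UNIV. E i x * h $ i) + (\<Sum>i\<in>UNIV. D i x * h $ i) * g x
      = (\<Sum>i\<in>UNIV. (D i x * g x + f x * E i x) * h $ i)" for h
    unfolding sum_distrib_left sum_distrib_right sum.distrib[symmetric]
    by (rule sum.cong) (simp_all add: algebra_simps)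
  then show "((\<lambda>x. f x * g x) has_derivative (\<lambda>h. \<Sum>i\<in>UNIV. (D i x * g x + f x * E i x) * h $ i)) (at x)"
    using has_derivative_mult[OF C1_partialsD(1)[OF f \<open>x \<in> U\<close>] C1_partialsD(1)[OF g \<open>x \<in> U\<close>]]
    by (simp only:)
qed (intro continuous_on_add continuous_on_mult C1_partialsD(2)[OF f] C1_partialsD(2)[OF g]
      C1_partials_continuous[OF f] C1_partials_continuous[OF g])

lemma C1_partials_const: "C1_partials U (\<lambda>x. c) (\<lambda>i x. 0)"
  unfolding C1_partials_def by auto

lemma C1_partials_coord: "C1_partials U (\<lambda>x. x $ j) (\<lambda>i x. if i = j then 1 else 0)"
proof -
  have *: "(\<lambda>h. \<Sum>i\<in>UNIV. (if i = j then 1 else 0) * h $ i) = (\<lambda>h::'a^'b. h $ j)"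
    by (auto simp: if_distrib[of "\<lambda>y. y * _"] cong: if_cong)
  show ?thesis unfolding C1_partials_def *
    by (auto intro!: bounded_linear_imp_has_derivative bounded_linear_vec_nth)
qed

section \<open>Termwise differentiation of multi-index power series\<close>

text \<open>Enumerating the multi-indices by \<open>e\<close> turns the series into an ordinary one,
  to which termwise differentiation applies. With \<open>e\<close> as a parameter the formal partial
  derivatives are series of the same shape, with data \<open>dcoef\<close> and
  \<open>dexp\<close>.\<close>

definition pseries :: "(nat \<Rightarrow> complex) \<Rightarrow> (nat \<Rightarrow> 'n \<Rightarrow> nat) \<Rightarrow> complex ^ 'n::finite \<Rightarrow> complex" where
  "pseries a e w = (\<Sum>k. a k * (\<Prod>i\<in>UNIV. (w $ i) ^ e k i))"

definition dcoef :: "'n \<Rightarrow> (nat \<Rightarrow> complex) \<Rightarrow> (nat \<Rightarrow> 'n \<Rightarrow> nat) \<Rightarrow> nat \<Rightarrow> complex" where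
  "dcoef i a e k = a k * of_nat (e k i)"

text \<open>When \<open>e k i = 0\<close> the truncated subtraction is harmless, because \<open>dcoef i a e k = 0\<close>.\<close>

definition dexp :: "'n \<Rightarrow> (nat \<Rightarrow> 'n \<Rightarrow> nat) \<Rightarrow> nat \<Rightarrow> 'n \<Rightarrow> nat" where
  "dexp i e k = (e k)(i := e k i - 1)"

lemma nat_le_power2: "real n \<le> 2 ^ n"
  using of_nat_less_two_power[of n, where 'a=real] by simp

text \<open>Differentiation multiplies the \<open>k\<close>-th term by \<open>n = e k i\<close>, and
  halving the radius gains at least \<open>2^-(n-1)\<close>, whose product with \<open>n\<close> is
  at most 2. The \<open>R\<close> in \<open>2 / R\<close> makes up for the exponent lowered by
  one.\<close>

lemma summable_dcoef:
  fixes e :: "nat \<Rightarrow> 'n::finite \<Rightarrow> nat"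
  assumes R: "R > 0" and s: "summable (\<lambda>k. norm (a k) * R ^ (\<Sum>i\<in>UNIV. e k i))"
  shows "summable (\<lambda>k. norm (dcoef i a e k) * (R/2) ^ (\<Sum>j\<in>UNIV. dexp i e k j))"
proof (rule summable_comparison_test'[OF summable_mult[OF s, of "2/R"], of 0])
  fix k
  show "norm (norm (dcoef i a e k) * (R/2) ^ (\<Sum>j\<in>UNIV. dexp i e k j))
        \<le> 2 / R * (norm (a k) * R ^ (\<Sum>i\<in>UNIV. e k i))"
  proof (cases "e k i")
    case 0
    then show ?thesis using R by (simp add: dcoef_def)
  next
    case (Suc m)
    let ?r = "\<Sum>j\<in>UNIV-{i}. e k j"
    have 1: "(\<Sum>j\<in>UNIV. e k j) = Suc m + ?r"
      by (subst sum.remove[of _ i]) (auto simp: Suc)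
    have 2: "(\<Sum>j\<in>UNIV. dexp i e k j) = m + ?r"
      by (subst sum.remove[of _ i]) (auto simp: Suc dexp_def)
    have "real (Suc m) * (1/2) ^ (m + ?r) \<le> 2"
    proof -
      have "(1/2::real) ^ (m + ?r) \<le> (1/2) ^ m" by (rule power_decreasing) auto
      then have "real (Suc m) * (1/2) ^ (m + ?r) \<le> 2^(Suc m) * (1/2) ^ m"
        by (intro mult_mono nat_le_power2) auto
      then show ?thesis by (simp add: power_divide)
    qed
    then have "norm (a k) * R ^ (m + ?r) * (real (Suc m) * (1/2) ^ (m + ?r)) \<le> norm (a k) * R ^ (m + ?r) * 2"
      using R by (intro mult_left_mono) auto
    moreover have "norm (norm (dcoef i a e k) * (R/2) ^ (\<Sum>j\<in>UNIV. dexp i e k j))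
        = norm (a k) * R ^ (m + ?r) * (real (Suc m) * (1/2) ^ (m + ?r))"
      using R unfolding 2 dcoef_def Suc
      by (simp add: norm_mult power_divide abs_mult del: of_nat_Suc)
    moreover have "2 / R * (norm (a k) * R ^ (\<Sum>i\<in>UNIV. e k i)) = norm (a k) * R ^ (m + ?r) * 2"
      using R unfolding 1 by simp
    ultimately show ?thesis by simp
  qed
qed

lemma pseries_term_le:
  fixes w :: "complex ^ 'n::finite"
  assumes "norm w \<le> R"
  shows "norm (a k * (\<Prod>i\<in>UNIV. (w $ i) ^ e k i)) \<le> norm (a k) * R ^ (\<Sum>i\<in>UNIV. e k i)"
proof -
  have "norm (w $ i) \<le> R" for i
    using assms Finite_Cartesian_Product.norm_nth_le[of w i] by linarith
  then have "(\<Prod>i\<in>UNIV. norm (w $ i) ^ e k i) \<le> (\<Prod>i\<in>UNIV. R ^ e k i)"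
    by (intro prod_mono) (auto intro: power_mono)
  then show ?thesis
    by (auto simp: norm_mult prod_norm[symmetric] norm_power power_sum intro!: mult_left_mono)
qed

text \<open>Each partial series converges uniformly on the half ball by the Weierstrass test with
  the majorant from \<open>summable_dcoef\<close>, and uniform control of finitely many partials is
  uniform control of the differential.\<close>

lemma pseries_has_derivative:
  fixes e :: "nat \<Rightarrow> 'n::finite \<Rightarrow> nat"
  assumes R: "R > 0" and s: "summable (\<lambda>k. norm (a k) * R ^ (\<Sum>i\<in>UNIV. e k i))"
    and w: "w \<in> ball 0 (R/2)"
  shows "(pseries a e has_derivative (\<lambda>h. \<Sum>i\<in>UNIV. pseries (dcoef i a e) (dexp i e) w * h $ i)) (at w)"
proof -
  let ?S = "ball (0::complex^'n) (R/2)"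
  define f where "f k w = a k * (\<Prod>i\<in>UNIV. (w $ i) ^ e k i)" for k and w :: "complex^'n"
  define d where "d i k w = dcoef i a e k * (\<Prod>j\<in>UNIV. (w $ j) ^ dexp i e k j)" for i k and w :: "complex^'n"
  have der: "(f k has_derivative (\<lambda>h. \<Sum>i\<in>UNIV. d i k x * h $ i)) (at x within ?S)" for k x
  proof -
    have "((\<lambda>w. w $ i) has_derivative (\<lambda>h. h $ i)) (at x within ?S)" for i
      by (auto intro!: bounded_linear_imp_has_derivative bounded_linear_vec_nth)
    then have "(f k has_derivative (\<lambda>h. a k * (\<Sum>i\<in>UNIV. (of_nat (e k i) * h $ i * (x$i)^(e k i - 1)) *
        (\<Prod>j\<in>UNIV-{i}. (x $ j) ^ e k j)))) (at x within ?S)"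
      unfolding f_def by (intro has_derivative_mult_right has_derivative_prod has_derivative_power) auto
    moreover have "d i k x = a k * of_nat (e k i) * (x$i)^(e k i - 1) * (\<Prod>j\<in>UNIV-{i}. (x $ j) ^ e k j)" for i
    proof -
      have "(\<Prod>j\<in>UNIV. (x $ j) ^ dexp i e k j) = (x$i)^(e k i - 1) * (\<Prod>j\<in>UNIV-{i}. (x $ j) ^ e k j)"
        by (subst prod.remove[of _ i]) (auto simp: dexp_def)
      then show ?thesis by (simp add: d_def dcoef_def)
    qed
    ultimately show ?thesis by (simp add: sum_distrib_left algebra_simps)
  qed
  have unif: "uniform_limit ?S (\<lambda>n x. \<Sum>k<n. d i k x) (\<lambda>x. pseries (dcoef i a e) (dexp i e) x) sequentially" for i
    unfolding pseries_def d_def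
    by (rule Weierstrass_m_test[OF _ summable_dcoef[OF R s]], rule pseries_term_le) auto
  have sums: "(\<lambda>k. f k x) sums pseries a e x" if "x \<in> ?S" for x
    unfolding f_def pseries_def
    by (rule summable_sums, rule summable_comparison_test'[OF s, of 0], rule pseries_term_le)
       (use that R in auto)
  have "\<exists>g. \<forall>x\<in>?S. (\<lambda>k. f k x) sums (g x) \<and> 
     (g has_derivative (\<lambda>h. \<Sum>i\<in>UNIV. pseries (dcoef i a e) (dexp i e) x * h $ i)) (at x within ?S)"
  proof (rule has_derivative_series[where f'="\<lambda>k x h. \<Sum>i\<in>UNIV. d i k x * h $ i"])
    show "convex ?S" by simp
    show "(f n has_derivative (\<lambda>h. \<Sum>i\<in>UNIV. d i n x * h $ i)) (at x within ?S)" for n x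
      by (rule der)
    show "(0::complex^'n) \<in> ?S" using R by simp
    then show "(\<lambda>k. f k 0) sums pseries a e 0" by (rule sums)
    fix \<epsilon> :: real assume \<epsilon>: "\<epsilon> > 0"
    \<comment> \<open>The norm of the differential is at most the sum of the norms of the partials,
      so each of the \<open>CARD('n)\<close> partials gets an equal share of
      \<open>\<epsilon>\<close>.\<close>
    define \<delta> where "\<delta> = \<epsilon> / of_nat CARD('n)"
    have \<delta>: "\<delta> > 0" using \<epsilon> by (simp add: \<delta>_def)
    have "\<forall>\<^sub>F n in sequentially. \<forall>i\<in>UNIV. \<forall>x\<in>?S. dist (\<Sum>k<n. d i k x) (pseries (dcoef i a e) (dexp i e) x) < \<delta>"
      by (rule eventually_ball_finite) (use unif \<delta> in \<open>auto simp: uniform_limit_iff\<close>)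
    then show "\<forall>\<^sub>F n in sequentially. \<forall>x\<in>?S. \<forall>h. norm ((\<Sum>k<n. \<Sum>i\<in>UNIV. d i k x * h $ i)
        - (\<Sum>i\<in>UNIV. pseries (dcoef i a e) (dexp i e) x * h $ i)) \<le> \<epsilon> * norm h"
    proof eventually_elim
      case (elim n)
      show ?case
      proof (intro ballI allI)
        fix x h assume x: "x \<in> ?S"
        have "(\<Sum>k<n. \<Sum>i\<in>UNIV. d i k x * h $ i) - (\<Sum>i\<in>UNIV. pseries (dcoef i a e) (dexp i e) x * h $ i)
          = (\<Sum>i\<in>UNIV. ((\<Sum>k<n. d i k x) - pseries (dcoef i a e) (dexp i e) x) * h $ i)"
          by (subst sum.swap) (simp add: sum_subtractf left_diff_distrib sum_distrib_right)
        also have "norm \<dots> \<le> (\<Sum>i\<in>(UNIV::'n set). \<delta> * norm h)"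
        proof (rule sum_norm_le)
          fix i :: 'n
          have "norm ((\<Sum>k<n. d i k x) - pseries (dcoef i a e) (dexp i e) x) \<le> \<delta>"
            using elim x by (auto simp: dist_norm less_imp_le)
          then show "norm (((\<Sum>k<n. d i k x) - pseries (dcoef i a e) (dexp i e) x) * h $ i) \<le> \<delta> * norm h"
            unfolding norm_mult using \<delta> by (intro mult_mono Finite_Cartesian_Product.norm_nth_le) auto
        qed
        also have "\<dots> = \<epsilon> * norm h" by (simp add: \<delta>_def)
        finally show "norm ((\<Sum>k<n. \<Sum>i\<in>UNIV. d i k x * h $ i)
            - (\<Sum>i\<in>UNIV. pseries (dcoef i a e) (dexp i e) x * h $ i)) \<le> \<epsilon> * norm h" .
      qed
    qed
  qed
  then obtain g where g: "\<And>x. x \<in> ?S \<Longrightarrow> (\<lambda>k. f k x) sums (g x)"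
     "\<And>x. x \<in> ?S \<Longrightarrow> (g has_derivative (\<lambda>h. \<Sum>i\<in>UNIV. pseries (dcoef i a e) (dexp i e) x * h $ i)) (at x within ?S)"
    by blast
  have "g x = pseries a e x" if "x \<in> ?S" for x
    using g(1)[OF that] sums[OF that] sums_unique2 by blast
  then have "(pseries a e has_derivative (\<lambda>h. \<Sum>i\<in>UNIV. pseries (dcoef i a e) (dexp i e) w * h $ i)) (at w within ?S)"
    using g(2)[OF w] w has_derivative_transform by (metis (no_types, lifting))
  then show ?thesis using w at_within_open[OF w] by simp
qed

text \<open>Continuity of the partials is read off from their own differentiability, so the series
  is differentiated twice and the radius halved twice.\<close>

lemma pseries_C1_partials:
  fixes e :: "nat \<Rightarrow> 'n::finite \<Rightarrow> nat"
  assumes R: "R > 0" and s: "summable (\<lambda>k. norm (a k) * R ^ (\<Sum>i\<in>UNIV. e k i))"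
  shows "C1_partials (ball 0 (R/4)) (pseries a e) (\<lambda>i. pseries (dcoef i a e) (dexp i e))"
proof -
  have "(pseries (dcoef i a e) (dexp i e) has_derivative (\<lambda>h. \<Sum>j\<in>UNIV. pseries (dcoef j (dcoef i a e) (dexp i e)) (dexp j (dexp i e)) w * h $ j)) (at w)"
    if "w \<in> ball 0 (R/4)" for w i
    by (rule pseries_has_derivative[OF _ summable_dcoef[OF R s]]) (use R that in auto)
  then have "continuous_on (ball 0 (R/4)) (pseries (dcoef i a e) (dexp i e))" for i
    by (meson continuous_at_imp_continuous_on has_derivative_continuous)
  then show ?thesis unfolding C1_partials_def using pseries_has_derivative[OF R s] R by auto
qed

text \<open>Together with \<open>dexp_commute\<close> this is equality of mixed partials, term by
  term.\<close>

lemma dcoef_commute: "dcoef i (dcoef j a e) (dexp j e) = dcoef j (dcoef i a e) (dexp i e)"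
  by (rule ext) (auto simp: dcoef_def dexp_def)

lemma dexp_commute: "dexp i (dexp j e) = dexp j (dexp i e)"
  by (intro ext) (auto simp: dexp_def)

section \<open>Restriction of complex functions to real points\<close>

definition cvec :: "real ^ 'n \<Rightarrow> complex ^ 'n" where
  "cvec x = (\<chi> i. of_real (x $ i))"

lemma cvec_nth [simp]: "cvec x $ i = of_real (x $ i)"
  by (simp add: cvec_def)

lemma norm_cvec [simp]: "norm (cvec x) = norm x"
  by (simp add: norm_vec_def)

lemma bounded_linear_cvec: "bounded_linear cvec"
  by (intro bounded_linear_intro[where K=1]) (auto simp: vec_eq_iff scaleR_conv_of_real[symmetric])

text \<open>Only agreement at real points is required; differentiability of \<open>F\<close> is
  carried by \<open>C1_partials\<close>. The centre moves from \<open>p\<close> to \<open>0\<close>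
  because the power series is one in \<open>x - p\<close>.\<close>

definition complexifies ::
    "real \<Rightarrow> real ^ 'n \<Rightarrow> (real ^ 'n \<Rightarrow> real) \<Rightarrow> (complex ^ 'n \<Rightarrow> complex) \<Rightarrow> bool" where
  "complexifies r p f F \<longleftrightarrow> (\<forall>x\<in>ball p r. F (cvec (x - p)) = of_real (f x))"

lemma real_analytic_on_imp_complexification:
  fixes u :: "real ^ 'n::finite \<Rightarrow> real"
  assumes an: "real_analytic_on U u" and p: "p \<in> U"
  obtains r F D E where "r > 0" "complexifies r p u F" "C1_partials (ball 0 r) F D"
    "\<And>i. C1_partials (ball 0 r) (D i) (E i)" "\<And>i j. E i j = E j i"
proof -
  obtain r c where r: "r > 0" and hs: "\<forall>x\<in>ball p r.
        ((\<lambda>\<alpha>. c \<alpha> * (\<Prod>i\<in>UNIV. (x $ i - p $ i) ^ \<alpha> i)) has_sum u x) UNIV"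
    using bspec[OF an[unfolded real_analytic_on_def] p] by (elim exE conjE) (rule that)
  have "infinite (UNIV :: ('n \<Rightarrow> nat) set)"
    using finite_fun_UNIVD2[where 'a='n and 'b=nat] by auto
  then obtain e :: "nat \<Rightarrow> 'n \<Rightarrow> nat" where e: "bij_betw e UNIV UNIV"
    using bij_betw_from_nat_into[of "UNIV :: ('n \<Rightarrow> nat) set"] by auto
  define a where "a k = complex_of_real (c (e k))" for k
  \<comment> \<open>The diagonal point \<open>p + (R, ..., R)\<close> is at distance at most
    \<open>CARD('n) * R = r / 2\<close> from \<open>p\<close>, hence inside the ball of
    convergence.\<close>
  define R where "R = r / (2 * of_nat CARD('n))"
  have R: "R > 0" "R < r"
  proof -
    show "R > 0" using r by (simp add: R_def)
    have "1 \<le> real CARD('n)" by (simp add: Suc_leI)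
    then have "1 < 2 * real CARD('n)" by linarith
    then have "r * 1 < r * (2 * real CARD('n))" using r by (rule mult_strict_left_mono)
    then show "R < r" using r by (simp add: R_def field_simps)
  qed
  have hs': "((\<lambda>k. c (e k) * (\<Prod>i\<in>UNIV. (x $ i - p $ i) ^ e k i)) has_sum u x) UNIV" if "x \<in> ball p r" for x
    using bspec[OF hs that] has_sum_reindex_bij_betw[OF e, of "\<lambda>\<alpha>. c \<alpha> * (\<Prod>i\<in>UNIV. (x $ i - p $ i) ^ \<alpha> i)"] by simp
  have s: "summable (\<lambda>k. norm (a k) * R ^ (\<Sum>i\<in>UNIV. e k i))"
  proof -
    \<comment> \<open>At the diagonal point every monomial equals \<open>R\<close> to its total
      degree. Unconditional summability of the real series there is absolute summability, which is
      the majorant needed at complex points.\<close>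
    define x where "x = p + (\<chi> i. R)"
    have "norm (x - p) \<le> (\<Sum>i\<in>(UNIV::'n set). R)"
      using norm_le_l1_cart[of "x - p"] R by (simp add: x_def)
    also have "\<dots> < r" using r by (simp add: R_def field_simps)
    finally have "x \<in> ball p r" by (simp add: dist_norm norm_minus_commute)
    from hs'[OF this] have "(\<lambda>k. c (e k) * (\<Prod>i\<in>UNIV. (x $ i - p $ i) ^ e k i)) summable_on UNIV"
      by (rule has_sum_imp_summable)
    moreover have eq: "x $ i - p $ i = R" for i by (simp add: x_def)
    ultimately have "(\<lambda>k. c (e k) * R ^ (\<Sum>i\<in>UNIV. e k i)) summable_on UNIV"
      unfolding eq by (simp only: power_sum)
    then have "summable (\<lambda>k. norm (c (e k) * R ^ (\<Sum>i\<in>UNIV. e k i)))"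
      by (rule summable_on_iff_abs_summable_on_real[THEN iffD1, THEN summable_on_imp_summable])
    then show ?thesis using R by (simp add: a_def abs_mult)
  qed
  have F: "pseries a e (cvec (x - p)) = of_real (u x)" if "x \<in> ball p r" for x
  proof -
    have "(\<lambda>k. c (e k) * (\<Prod>i\<in>UNIV. (x $ i - p $ i) ^ e k i)) sums u x"
      using hs'[OF that] by (rule has_sum_imp_sums)
    then have "(\<lambda>k. complex_of_real (c (e k) * (\<Prod>i\<in>UNIV. (x $ i - p $ i) ^ e k i))) sums of_real (u x)"
      by (rule sums_of_real)
    then show ?thesis unfolding pseries_def a_def by (simp add: sums_iff)
  qed
  define D where "D i = pseries (dcoef i a e) (dexp i e)" for i
  define E where "E i j = pseries (dcoef j (dcoef i a e) (dexp i e)) (dexp j (dexp i e))" for i j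
  show ?thesis
  \<comment> \<open>The partials have a majorant of radius \<open>R/2\<close>, and
    \<open>pseries_C1_partials\<close> divides that by 4.\<close>
  proof (rule that[of "R/8" "pseries a e" D E])
    show "complexifies (R/8) p u (pseries a e)" using F R by (auto simp: complexifies_def)
    show "C1_partials (ball 0 (R/8)) (pseries a e) D"
      unfolding D_def by (rule C1_partials_subset[OF pseries_C1_partials[OF R(1) s]]) (use R in auto)
    show "C1_partials (ball 0 (R/8)) (D i) (E i)" for i
      using pseries_C1_partials[OF _ summable_dcoef[OF R(1) s, of i]] R(1)
      unfolding D_def E_def by simp
    show "E i j = E j i" for i j unfolding E_def by (simp add: dcoef_commute dexp_commute)
  qed (use R in auto)
qed

text \<open>Near \<open>p\<close> the real function is \<open>F\<close> composed with the real
  embedding, and derivatives along the real vectors \<open>axis i 1\<close> already determine the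
  coefficients \<open>D i\<close>.\<close>

lemma complexifies_partials:
  fixes f :: "real ^ 'n::finite \<Rightarrow> real"
  assumes c: "complexifies r p f F" and F: "C1_partials (ball 0 r) F D" and f: "C1_partials (ball p r) f d"
  shows "complexifies r p (d i) (D i)"
  unfolding complexifies_def
proof
  fix x assume x: "x \<in> ball p r"
  then have "cvec (x - p) \<in> ball 0 r" by (simp add: dist_norm norm_minus_commute)
  then have "(F has_derivative (\<lambda>h. \<Sum>i\<in>UNIV. D i (cvec (x - p)) * h $ i)) (at (cvec (x - p)))"
    using C1_partialsD(1)[OF F] by blast
  moreover have "((\<lambda>x. cvec (x - p)) has_derivative cvec) (at x)"
    by (rule bounded_linear.has_derivative[OF bounded_linear_cvec]) (auto intro!: derivative_eq_intros)
  ultimately have "((\<lambda>x. F (cvec (x - p))) has_derivative (\<lambda>h. \<Sum>i\<in>UNIV. D i (cvec (x - p)) * cvec h $ i)) (at x)"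
    using has_derivative_compose by blast
  moreover have "((\<lambda>x. complex_of_real (f x)) has_derivative (\<lambda>h. of_real (\<Sum>i\<in>UNIV. d i x * h $ i))) (at x)"
    using C1_partialsD(1)[OF f x] bounded_linear.has_derivative[OF bounded_linear_of_real] by blast
  then have "((\<lambda>x. F (cvec (x - p))) has_derivative (\<lambda>h. of_real (\<Sum>i\<in>UNIV. d i x * h $ i))) (at x)"
    by (rule has_derivative_transform_within_open[OF _ open_ball x])
       (use c in \<open>auto simp: complexifies_def\<close>)
  ultimately have "(\<lambda>h. \<Sum>i\<in>UNIV. D i (cvec (x - p)) * cvec h $ i) = (\<lambda>h. of_real (\<Sum>i\<in>UNIV. d i x * h $ i))"
    by (rule has_derivative_unique)
  from fun_cong[OF this, of "axis i 1"] show "D i (cvec (x - p)) = of_real (d i x)"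
    by (simp add: axis_def if_distrib cong: if_cong)
qed

section \<open>The inverse function theorem in coordinates\<close>

text \<open>Continuity of \<open>g'\<close> in the base point is included because parametrizations
  must be C^1. Injectivity of \<open>f' x0\<close> amounts to invertibility, since domain and range
  have the same finite dimension.\<close>

lemma inverse_function_C1:
  fixes f :: "'e::euclidean_space \<Rightarrow> 'e"
  assumes U: "open U" "x0 \<in> U"
    and der: "\<And>x. x \<in> U \<Longrightarrow> (f has_derivative f' x) (at x)"
    and cont: "\<And>h. continuous_on U (\<lambda>x. f' x h)"
    and inj: "inj (f' x0)"
  obtains U' V g g' where "open U'" "U' \<subseteq> U" "x0 \<in> U'" "open V" "f x0 \<in> V" "homeomorphism U' V f g"
    "\<And>y. y \<in> V \<Longrightarrow> (g has_derivative g' y) (at y)"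
    "\<And>y h. y \<in> V \<Longrightarrow> f' (g y) (g' y h) = h"
    "\<And>y. y \<in> V \<Longrightarrow> inj (f' (g y))"
    "\<And>h. continuous_on V (\<lambda>y. g' y h)"
proof -
  define F where "F x = Blinfun (f' x)" for x
  have F: "blinfun_apply (F x) = f' x" if "x \<in> U" for x
    unfolding F_def by (rule bounded_linear_Blinfun_apply, rule has_derivative_bounded_linear, rule der[OF that])
  have contF: "continuous_on U F"
  proof (rule continuous_on_blinfun_componentwise)
    fix i :: 'e
    show "continuous_on U (\<lambda>x. F x i)"
      using cont[of i] by (rule continuous_on_eq) (simp add: F)
  qed
  have lin0: "linear (f' x0)" using has_derivative_linear[OF der[OF U(2)]] .
  obtain k where k: "linear k" "k \<circ> f' x0 = id"
    using linear_injective_left_inverse[OF lin0 inj] by auto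
  have inv0: "Blinfun k o\<^sub>L F x0 = id_blinfun"
  proof (rule blinfun_eqI)
    fix i
    have "blinfun_apply (Blinfun k) = k"
      using k(1) by (simp add: bounded_linear_Blinfun_apply linear_conv_bounded_linear)
    then show "blinfun_apply (Blinfun k o\<^sub>L F x0) i = blinfun_apply id_blinfun i"
      using k(2) F[OF U(2)] by (simp add: fun_eq_iff)
  qed
  have derF: "(f has_derivative blinfun_apply (F x)) (at x)" if "x \<in> U" for x
    using der[OF that] F[OF that] by simp
  obtain U' V g g' where 1: "open U'" "U' \<subseteq> U" "x0 \<in> U'" "open V" "f x0 \<in> V" "homeomorphism U' V f g"
    and derg: "\<And>y. y \<in> V \<Longrightarrow> (g has_derivative (g' y)) (at y)"
    and g': "\<And>y. y \<in> V \<Longrightarrow> g' y = inv (blinfun_apply (F (g y)))"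
    and bij: "\<And>y. y \<in> V \<Longrightarrow> bij (blinfun_apply (F (g y)))"
    by (rule inverse_function_theorem[OF U(1) derF contF U(2) inv0]) (assumption, rule that)
  have gU: "g y \<in> U" if "y \<in> V" for y
    using that 1(2) homeomorphism_image2[OF 1(6)] by blast
  have right: "f' (g y) (g' y h) = h" if "y \<in> V" for y h
    using F[OF gU[OF that]] g'[OF that] bij[OF that] by (simp add: bij_is_surj surj_f_inv_f)
  have rightF: "F (g y) (g' y h) = h" if "y \<in> V" for y h
    using F[OF gU[OF that]] right[OF that] by simp
  have injg: "inj (f' (g y))" if "y \<in> V" for y
    using F[OF gU[OF that]] bij[OF that] by (simp add: bij_is_inj)
  have "continuous_on V (\<lambda>y. g' y h)" for h
  proof (rule continuous_at_imp_continuous_on, rule ballI)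
    fix y0 assume y0: "y0 \<in> V"
    have lin: "linear (f' (g y))" if "y \<in> V" for y
      using has_derivative_linear[OF der[OF gU[OF that]]] .
    obtain B where B: "B > 0" "\<And>v. B * norm v \<le> norm (f' (g y0) v)"
      using linear_inj_bounded_below_pos[OF lin[OF y0] injg[OF y0]] by blast
    have cg: "continuous (at y0) g" using derg[OF y0] has_derivative_continuous by blast
    have atF: "continuous (at (g y0)) F"
      using contF U(1) gU[OF y0] by (simp add: continuous_on_eq_continuous_at)
    have tF: "((\<lambda>y. F (g y)) \<longlongrightarrow> F (g y0)) (at y0)"
      using continuous_within_compose3[OF atF cg] by (simp add: continuous_within)
    have "\<forall>\<^sub>F y in at y0. dist (F (g y)) (F (g y0)) < B/2"
      using tendstoD[OF tF, of "B/2"] B by simp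
    moreover have evV: "\<forall>\<^sub>F y in at y0. y \<in> V"
      using eventually_at_in_open'[OF 1(4) y0] .
    \<comment> \<open>Since \<open>F (g y) (g' y h) = h\<close> for all \<open>y\<close> in
      \<open>V\<close>, applying \<open>F (g y)\<close> to \<open>g' y h - g' y0 h\<close> gives
      \<open>F (g y0) (g' y0 h) - F (g y) (g' y0 h)\<close>. Near \<open>y0\<close> the operator
      \<open>F (g y)\<close> is bounded below by \<open>B/2\<close>, so the change of the inverse is
      controlled by the change of \<open>F\<close> at the fixed vector
      \<open>g' y0 h\<close>.\<close>
    ultimately have ev: "\<forall>\<^sub>F y in at y0. norm (g' y h - g' y0 h) \<le> 2 / B * norm (F (g y) (g' y0 h) - F (g y0) (g' y0 h))"
    proof eventually_elim
      case (elim y)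
      let ?v = "g' y h - g' y0 h"
      have "norm ((F (g y) - F (g y0)) ?v) \<le> B/2 * norm ?v"
        using elim norm_blinfun[of "F (g y) - F (g y0)" ?v]
          mult_right_mono[of "norm (F (g y) - F (g y0))" "B/2" "norm ?v"] by (simp add: dist_norm)
      moreover have "B * norm ?v \<le> norm (F (g y0) ?v)" using B F gU y0 by simp
      moreover have "norm (F (g y0) ?v) \<le> norm (F (g y) ?v) + norm ((F (g y) - F (g y0)) ?v)"
        using norm_triangle_ineq4[of "F (g y) ?v" "(F (g y) - F (g y0)) ?v"] by (simp add: blinfun.diff_left)
      ultimately have "B/2 * norm ?v \<le> norm (F (g y) ?v)" by simp
      also have "F (g y) ?v = F (g y0) (g' y0 h) - F (g y) (g' y0 h)"
        using rightF y0 elim by (simp add: blinfun.diff_right)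
      finally show ?case using B by (simp add: field_simps norm_minus_commute)
    qed
    have "((\<lambda>y. F (g y) (g' y0 h)) \<longlongrightarrow> F (g y0) (g' y0 h)) (at y0)"
      by (rule blinfun.tendsto[OF tF tendsto_const])
    from tendsto_mult_left[OF tendsto_norm[OF tendsto_diff[OF this tendsto_const]]]
    have "((\<lambda>y. 2 / B * norm (F (g y) (g' y0 h) - F (g y0) (g' y0 h))) \<longlongrightarrow> 2 / B * norm (F (g y0) (g' y0 h) - F (g y0) (g' y0 h))) (at y0)" .
    then have "((\<lambda>y. 2 / B * norm (F (g y) (g' y0 h) - F (g y0) (g' y0 h))) \<longlongrightarrow> 0) (at y0)"
      by simp
    then have "((\<lambda>y. g' y h - g' y0 h) \<longlongrightarrow> 0) (at y0)"
      by (rule Lim_null_comparison[OF ev])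
    then show "isCont (\<lambda>y. g' y h) y0"
      unfolding continuous_at by (rule LIM_zero_cancel)
  qed
  from 1 derg right injg this show ?thesis by (rule that)
qed

lemma bounded_linear_axis:
  "bounded_linear (axis i :: 'a::real_normed_vector \<Rightarrow> 'a ^ 'n::finite)"
proof (rule bounded_linear_intro)
  show "axis i (x + y) = axis i x + (axis i y :: 'a^'n)" for x y
    by (vector axis_def)
  show "axis i (r *\<^sub>R x) = r *\<^sub>R (axis i x :: 'a^'n)" for x r
    by (vector axis_def)
  show "norm (axis i v :: 'a^'n) \<le> norm v * 1" for v
  proof -
    have "norm (axis i v :: 'a^'n) \<le> (\<Sum>j\<in>UNIV. norm ((axis i v :: 'a^'n) $ j))"
      unfolding norm_vec_def by (rule L2_set_le_sum) simp
    also have "\<dots> = (\<Sum>j\<in>UNIV. if j = i then norm v else 0)"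
      by (rule sum.cong) (auto simp: axis_def)
    finally show ?thesis by simp
  qed
qed

lemma has_derivative_vec_lambda:
  fixes f :: "'n::finite \<Rightarrow> 'b::real_normed_vector \<Rightarrow> 'a::real_normed_vector"
  assumes "\<And>i. (f i has_derivative f' i) (at x within S)"
  shows "((\<lambda>x. \<chi> i. f i x) has_derivative (\<lambda>h. \<chi> i. f' i h)) (at x within S)"
proof -
  have eq: "(\<Sum>i\<in>UNIV. axis i (v i)) = (\<chi> i. v i)" for v :: "'n \<Rightarrow> 'a"
    by (auto simp: vec_eq_iff axis_def)
  have "((\<lambda>x. \<Sum>i\<in>UNIV. axis i (f i x)) has_derivative (\<lambda>h. \<Sum>i\<in>UNIV. axis i (f' i h))) (at x within S)"
    using assms by (intro has_derivative_sum bounded_linear.has_derivative[OF bounded_linear_axis])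
  then show ?thesis by (simp only: eq)
qed

text \<open>Over \<open>complex\<close> this is the real theorem on the underlying real space, so
  \<open>g'\<close> comes out only real-linear. The kernel clause at every \<open>g y\<close> is
  exported so that complex linearity can be recovered from it.\<close>

lemma inverse_function_C1_partials:
  fixes F :: "'n::finite \<Rightarrow> 'a::{real_normed_field,euclidean_space} ^ 'n \<Rightarrow> 'a"
  assumes U: "open U" "x0 \<in> U"
    and C1: "\<And>i. C1_partials U (F i) (D i)"
    and inj: "\<And>h. \<forall>i. (\<Sum>j\<in>UNIV. D i j x0 * h $ j) = 0 \<Longrightarrow> h = 0"
  obtains U' V g g' where "open U'" "U' \<subseteq> U" "x0 \<in> U'" "open V" "(\<chi> i. F i x0) \<in> V"
    "homeomorphism U' V (\<lambda>x. \<chi> i. F i x) g"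
    "\<And>y. y \<in> V \<Longrightarrow> (g has_derivative g' y) (at y)"
    "\<And>y h i. y \<in> V \<Longrightarrow> (\<Sum>j\<in>UNIV. D i j (g y) * g' y h $ j) = h $ i"
    "\<And>y h. y \<in> V \<Longrightarrow> \<forall>i. (\<Sum>j\<in>UNIV. D i j (g y) * h $ j) = 0 \<Longrightarrow> h = 0"
    "\<And>h. continuous_on V (\<lambda>y. g' y h)"
proof -
  define f where "f x = (\<chi> i. F i x)" for x
  define f' where "f' x h = (\<chi> i. \<Sum>j\<in>UNIV. D i j x * h $ j)" for x h
  have der: "(f has_derivative f' x) (at x)" if "x \<in> U" for x
    unfolding f_def f'_def by (intro has_derivative_vec_lambda C1_partialsD(1)[OF C1 that])
  have cont: "continuous_on U (\<lambda>x. f' x h)" for h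
    unfolding f'_def by (intro continuous_intros C1_partialsD(2)[OF C1])
  have lin: "linear (f' x)" if "x \<in> U" for x
    using has_derivative_linear[OF der[OF that]] .
  have inj0: "inj (f' x0)" 
    unfolding linear_injective_0[OF lin[OF U(2)]]
  proof (intro allI impI)
    fix h assume "f' x0 h = 0"
    then show "h = 0" by (intro inj) (simp add: f'_def vec_eq_iff)
  qed
  obtain U' V g g' where 1: "open U'" "U' \<subseteq> U" "x0 \<in> U'" "open V" "f x0 \<in> V" "homeomorphism U' V f g"
    "\<And>y. y \<in> V \<Longrightarrow> (g has_derivative g' y) (at y)"
    and 2: "\<And>y h. y \<in> V \<Longrightarrow> f' (g y) (g' y h) = h"
    and 3: "\<And>y. y \<in> V \<Longrightarrow> inj (f' (g y))"
    and 4: "\<And>h. continuous_on V (\<lambda>y. g' y h)" by (rule inverse_function_C1[OF U der cont inj0]) (assumption, rule that)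
  have gU: "g y \<in> U" if "y \<in> V" for y
    using that 1(2) homeomorphism_image2[OF 1(6)] by blast
  show ?thesis
  proof (rule that[of U' V g g'])
    show "homeomorphism U' V (\<lambda>x. \<chi> i. F i x) g" using 1(6) by (simp add: f_def[abs_def])
    show "(\<chi> i. F i x0) \<in> V" using 1(5) by (simp add: f_def)
    show "(\<Sum>j\<in>UNIV. D i j (g y) * g' y h $ j) = h $ i" if "y \<in> V" for y h i
      using 2[OF that, of h] by (simp add: f'_def vec_eq_iff)
    show "h = 0" if "y \<in> V" "\<forall>i. (\<Sum>j\<in>UNIV. D i j (g y) * h $ j) = 0" for y h
    proof -
      have "f' (g y) h = f' (g y) 0" using that(2) by (simp add: f'_def vec_eq_iff)
      then show ?thesis using 3[OF that(1)] by (simp only: inj_eq)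
    qed
  qed (fact 1 4)+
qed

section \<open>Order of vanishing along a transversal curve\<close>

text \<open>Nonvanishing at real points other than \<open>0\<close> excludes a constant
  \<open>h\<close>, so the zero at \<open>0\<close> has finite order \<open>n\<close> and
  \<open>h w = w^n * g w\<close> with \<open>g\<close> free of zeros. The minimum of
  \<open>|g|\<close> on a smaller closed disc is the constant.\<close>

lemma holomorphic_finite_order_lower_bound:
  assumes hol: "h holomorphic_on ball 0 \<epsilon>" and \<epsilon>: "\<epsilon> > 0" and h0: "h 0 = 0"
    and nz: "\<And>s::real. 0 < \<bar>s\<bar> \<Longrightarrow> \<bar>s\<bar> < \<epsilon> \<Longrightarrow> h (of_real s) \<noteq> 0"
  obtains c \<delta> :: real and k :: nat where "c > 0" "\<delta> > 0" "\<delta> \<le> \<epsilon>" "k > 0"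
    "\<And>s::real. \<bar>s\<bar> < \<delta> \<Longrightarrow> c * \<bar>s\<bar> ^ k \<le> norm (h (of_real s))"
proof -
  have nc: "\<not> h constant_on ball 0 \<epsilon>"
  proof
    assume "h constant_on ball 0 \<epsilon>"
    then obtain y where y: "\<And>x. x \<in> ball 0 \<epsilon> \<Longrightarrow> h x = y" unfolding constant_on_def by blast
    have "h (of_real (\<epsilon>/2)) = h 0" using y[of "of_real (\<epsilon>/2)"] y[of 0] \<epsilon> by simp
    then show False using nz[of "\<epsilon>/2"] h0 \<epsilon> by simp
  qed
  obtain g r n where g: "0 < n" "0 < r" "ball (0::complex) r \<subseteq> ball 0 \<epsilon>" "g holomorphic_on ball 0 r"
     "\<And>w. w \<in> ball 0 r \<Longrightarrow> h w = (w - 0)^n * g w" "\<And>w. w \<in> ball 0 r \<Longrightarrow> g w \<noteq> 0"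
    by (rule holomorphic_factor_zero_nonconstant[OF hol open_ball connected_ball _ h0 nc])
       (use \<epsilon> in simp, rule that)
  let ?K = "cball (0::complex) (r/2)"
  have sub: "?K \<subseteq> ball 0 r" using g(2) by auto
  have "continuous_on ?K (\<lambda>w. norm (g w))"
    using holomorphic_on_imp_continuous_on[OF g(4)] continuous_on_subset[OF _ sub] by (intro continuous_on_norm) auto
  moreover have "compact ?K" "?K \<noteq> {}" using g(2) by auto
  ultimately obtain w0 where w0: "w0 \<in> ?K" "\<And>w. w \<in> ?K \<Longrightarrow> norm (g w0) \<le> norm (g w)"
    using continuous_attains_inf[of ?K "\<lambda>w. norm (g w)"] by blast
  show ?thesis
  proof (rule that[of "norm (g w0)" "min (r/2) \<epsilon>" n])
    show "norm (g w0) > 0" using g(6) w0(1) sub by auto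
    fix s :: real assume s: "\<bar>s\<bar> < min (r/2) \<epsilon>"
    then have "of_real s \<in> ?K" by simp
    then have "norm (g w0) \<le> norm (g (of_real s))" "h (of_real s) = of_real s ^ n * g (of_real s)"
      using w0 g(5)[of "of_real s"] s g(2) by auto
    then show "norm (g w0) * \<bar>s\<bar> ^ n \<le> norm (h (of_real s))"
      using mult_right_mono[of "norm (g w0)" "norm (g (of_real s))" "\<bar>s\<bar> ^ n"]
      by (simp add: norm_mult norm_power mult.commute)
  qed (use g \<epsilon> in auto)
qed

text \<open>\<open>H\<close> is \<open>F\<beta>\<close> along the preimage of the first axis under
  the map \<open>(w $ l, F\<alpha> w, Fu w)\<close>, that is, along the complex curve
  \<open>F\<alpha> = Fu = 0\<close> parametrized by its \<open>l\<close>-th coordinate.\<close>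

lemma holomorphic_along_transversal_curve:
  fixes Fu :: "complex ^ 3 \<Rightarrow> complex" and l :: 3
  assumes r: "r > 0"
    and C1: "C1_partials (ball 0 r) Fu Du" "C1_partials (ball 0 r) F\<alpha> D\<alpha>" "C1_partials (ball 0 r) F\<beta> D\<beta>"
    and z: "Fu 0 = 0" "F\<alpha> 0 = 0"
    and inj: "\<And>h. h $ l = 0 \<Longrightarrow> (\<Sum>i\<in>UNIV. D\<alpha> i 0 * h $ i) = 0 \<Longrightarrow> (\<Sum>i\<in>UNIV. Du i 0 * h $ i) = 0 \<Longrightarrow> h = 0"
  obtains \<epsilon> \<eta> H where "\<epsilon> > 0" "\<eta> > 0" "H holomorphic_on ball 0 \<epsilon>"
    "\<And>w. norm w < \<eta> \<Longrightarrow> norm (w $ l) < \<epsilon> \<Longrightarrow> F\<alpha> w = 0 \<Longrightarrow> Fu w = 0 \<Longrightarrow> F\<beta> w = H (w $ l)"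
proof -
  define F where "F i = (if i = 1 then (\<lambda>w. w $ l) else if i = 2 then F\<alpha> else Fu)" for i :: 3
  define D where "D i = (if i = 1 then (\<lambda>j w. if j = l then 1 else 0) else if i = 2 then D\<alpha> else Du)" for i :: 3
  have C1F: "C1_partials (ball 0 r) (F i) (D i)" for i
    using C1 by (auto simp: F_def D_def C1_partials_coord)
  have injD: "h = 0" if "\<forall>i. (\<Sum>j\<in>UNIV. D i j 0 * h $ j) = 0" for h
  proof (rule inj)
    show "h $ l = 0" using spec[OF that, of 1] by (simp add: D_def if_distrib[of "\<lambda>x. x * _"] cong: if_cong)
    show "(\<Sum>i\<in>UNIV. D\<alpha> i 0 * h $ i) = 0" using spec[OF that, of 2] by (simp add: D_def)
    show "(\<Sum>i\<in>UNIV. Du i 0 * h $ i) = 0" using spec[OF that, of 3] by (simp add: D_def)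
  qed
  have zb: "(0::complex^3) \<in> ball 0 r" using r by simp
  obtain U' V g g' where I: "open U'" "U' \<subseteq> ball 0 r" "0 \<in> U'" "open V" "(\<chi> i. F i 0) \<in> V"
    "homeomorphism U' V (\<lambda>x. \<chi> i. F i x) g"
    and gder: "\<And>y. y \<in> V \<Longrightarrow> (g has_derivative g' y) (at y)"
    and g'1: "\<And>y h i. y \<in> V \<Longrightarrow> (\<Sum>j\<in>UNIV. D i j (g y) * g' y h $ j) = h $ i"
    and ker: "\<And>y h. y \<in> V \<Longrightarrow> \<forall>i. (\<Sum>j\<in>UNIV. D i j (g y) * h $ j) = 0 \<Longrightarrow> h = 0"
    and "\<And>h. continuous_on V (\<lambda>y. g' y h)"
    by (rule inverse_function_C1_partials[where F=F and D=D, OF open_ball zb C1F injD]) (assumption, rule that)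
  have "(\<chi> i. F i 0) = 0" by (simp add: vec_eq_iff forall_3 F_def z)
  then obtain \<epsilon> where \<epsilon>: "\<epsilon> > 0" "ball 0 \<epsilon> \<subseteq> V" using I(4,5) open_contains_ball by metis
  obtain \<eta> where \<eta>: "\<eta> > 0" "ball 0 \<eta> \<subseteq> U'" using I(1,3) open_contains_ball by metis
  have naxis: "norm (axis 1 s :: complex^3) = norm s" for s
    by (simp add: norm_vec_def L2_set_def axis_def sum_3)
  define H where "H s = F\<beta> (g (axis 1 s))" for s
  have "H field_differentiable (at s)" if s: "s \<in> ball 0 \<epsilon>" for s
  proof -
    let ?y = "axis 1 s :: complex^3"
    have y: "?y \<in> V" using s \<epsilon> naxis[of s] by auto
    have gy: "g ?y \<in> ball 0 r" using homeomorphism_image2[OF I(6)] I(2) y by blast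
    have 1: "((\<lambda>s. g (axis 1 s)) has_derivative (\<lambda>h. g' ?y (axis 1 h))) (at s)"
      by (rule has_derivative_compose[OF bounded_linear_imp_has_derivative[OF bounded_linear_axis] gder[OF y]])
    have 2: "(H has_derivative (\<lambda>h. \<Sum>i\<in>UNIV. D\<beta> i (g ?y) * g' ?y (axis 1 h) $ i)) (at s)"
      unfolding H_def by (rule has_derivative_compose[OF 1 C1_partialsD(1)[OF C1(3) gy]])
    \<comment> \<open>Both sides have the same image under the complex-linear map with matrix
      \<open>D\<close> at \<open>g ?y\<close>, which has trivial kernel. This is what turns the
      derivative of \<open>H\<close> into multiplication by a complex number.\<close>
    have lin: "g' ?y (axis 1 h) = h *s g' ?y (axis 1 1)" for h
    proof -
      have "g' ?y (axis 1 h) - h *s g' ?y (axis 1 1) = 0"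
      proof (rule ker[OF y], rule allI)
        fix i
        have "(\<Sum>j\<in>UNIV. D i j (g ?y) * (g' ?y (axis 1 h) - h *s g' ?y (axis 1 1)) $ j)
          = (\<Sum>j\<in>UNIV. D i j (g ?y) * g' ?y (axis 1 h) $ j) - h * (\<Sum>j\<in>UNIV. D i j (g ?y) * g' ?y (axis 1 1) $ j)"
          by (simp add: sum_subtractf sum_distrib_left algebra_simps)
        also have "\<dots> = 0" unfolding g'1[OF y] by (simp add: axis_def)
        finally show "(\<Sum>j\<in>UNIV. D i j (g ?y) * (g' ?y (axis 1 h) - h *s g' ?y (axis 1 1)) $ j) = 0" .
      qed
      then show ?thesis by simp
    qed
    have "(\<lambda>h. \<Sum>i\<in>UNIV. D\<beta> i (g ?y) * g' ?y (axis 1 h) $ i) = (*) (\<Sum>i\<in>UNIV. D\<beta> i (g ?y) * g' ?y (axis 1 1) $ i)"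
      by (rule ext, subst lin) (simp add: sum_distrib_left sum_distrib_right algebra_simps)
    with 2 show ?thesis unfolding field_differentiable_def has_field_derivative_def by auto
  qed
  then have hol: "H holomorphic_on ball 0 \<epsilon>"
    by (auto simp: holomorphic_on_def intro: field_differentiable_at_within)
  show ?thesis
  proof (rule that[OF \<epsilon>(1) \<eta>(1) hol])
    fix w assume w: "norm w < \<eta>" "norm (w $ l) < \<epsilon>" "F\<alpha> w = 0" "Fu w = 0"
    have "(\<chi> i. F i w) = axis 1 (w $ l)"
      using w by (simp add: vec_eq_iff forall_3 F_def axis_def)
    moreover have "w \<in> U'" using w(1) \<eta> by auto
    ultimately have "g (axis 1 (w $ l)) = w"
      using homeomorphism_apply1[OF I(6)] by metis
    then show "F\<beta> w = H (w $ l)" by (simp add: H_def)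
  qed
qed

section \<open>A parametrization adapted to a characteristic point\<close>

text \<open>The slice \<open>u = 0\<close> in the coordinates
  \<open>(q $ l, \<alpha> q, u q)\<close> that straighten the surface.\<close>

definition plane_emb :: "real ^ 2 \<Rightarrow> real ^ 3" where
  "plane_emb x = axis 1 (x $ 1) + axis 2 (x $ 2)"

lemma plane_emb_nth [simp]:
  "plane_emb x $ 1 = x $ 1" "plane_emb x $ 2 = x $ 2" "plane_emb x $ 3 = 0"
  by (simp_all add: plane_emb_def axis_def)

lemma bounded_linear_plane_emb: "bounded_linear plane_emb"
  unfolding plane_emb_def
  by (intro bounded_linear_add bounded_linear_compose[OF bounded_linear_axis] bounded_linear_vec_nth)

lemma norm_plane_emb [simp]: "norm (plane_emb x) = norm x"
  by (simp add: norm_vec_def L2_set_def sum_3 sum_2)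

lemma plane_emb_diff: "plane_emb x - plane_emb y = plane_emb (x - y)"
  by (simp add: vec_eq_iff forall_3)

lemma dist_plane_emb [simp]: "dist (plane_emb x) (plane_emb y) = dist x y"
  by (simp add: dist_norm plane_emb_diff)

lemma bounded_above_on_compact:
  fixes f :: "'a::topological_space \<Rightarrow> real"
  assumes "compact K" "continuous_on K f"
  obtains M where "M \<ge> 0" "\<And>x. x \<in> K \<Longrightarrow> f x \<le> M"
proof -
  have "bounded (f ` K)" using assms compact_continuous_image compact_imp_bounded by blast
  then obtain M where "M > 0" "\<And>y. y \<in> f ` K \<Longrightarrow> norm y \<le> M" unfolding bounded_pos by auto
  then show ?thesis by (intro that[of M]) force+
qed

lemma norm_linear_le_sum_axis:
  fixes f :: "real ^ 'n \<Rightarrow> 'b::real_normed_vector"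
  assumes "linear f"
  shows "norm (f h) \<le> (\<Sum>j\<in>UNIV. norm (f (axis j 1))) * norm h"
proof -
  have "h = (\<Sum>j\<in>UNIV. h $ j *\<^sub>R axis j 1)"
    by (simp add: vec_eq_iff axis_def if_distrib cong: if_cong)
  then have "f h = (\<Sum>j\<in>UNIV. h $ j *\<^sub>R f (axis j 1))"
    using linear_sum[OF assms] linear_scale[OF assms] by (metis (no_types, lifting) sum.cong)
  also have "norm \<dots> \<le> (\<Sum>j\<in>UNIV. norm (f (axis j 1)) * norm h)"
    by (rule sum_norm_le) (simp add: mult.commute mult_right_mono component_le_norm_cart)
  finally show ?thesis by (simp add: sum_distrib_right)
qed

text \<open>The coefficients are real, so the real and imaginary parts of a complex kernel vector
  are real kernel vectors.\<close>

lemma complex_kernel_from_real: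
  fixes a b :: "'n::finite \<Rightarrow> real"
  assumes inj: "\<And>h::real^'n. h $ l = 0 \<Longrightarrow> (\<Sum>i\<in>UNIV. a i * h $ i) = 0 \<Longrightarrow> (\<Sum>i\<in>UNIV. b i * h $ i) = 0 \<Longrightarrow> h = 0"
    and h: "h $ l = 0" "(\<Sum>i\<in>UNIV. complex_of_real (a i) * h $ i) = 0" "(\<Sum>i\<in>UNIV. complex_of_real (b i) * h $ i) = 0"
  shows "h = 0"
proof -
  have "(\<chi> i. Re (h $ i)) = 0"
    by (rule inj) (use arg_cong[OF h(1), of Re] arg_cong[OF h(2), of Re] arg_cong[OF h(3), of Re] in \<open>simp_all add: Re_sum\<close>)
  moreover have "(\<chi> i. Im (h $ i)) = 0"
    by (rule inj) (use arg_cong[OF h(1), of Im] arg_cong[OF h(2), of Im] arg_cong[OF h(3), of Im] in \<open>simp_all add: Im_sum\<close>)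
  ultimately show ?thesis by (simp add: vec_eq_iff complex_eq_iff)
qed

text \<open>The functions \<open>\<alpha>\<close>, \<open>\<beta>\<close> and the index
  \<open>l\<close> stay abstract because \<open>X u\<close> and \<open>Y u\<close> may have to
  exchange roles. The lower bound holds on the curve \<open>\<alpha> = u = 0\<close> by the finite
  order of \<open>H\<close>, and spreads over the surface because \<open>\<beta>\<close> is
  Lipschitz in the new coordinates.\<close>

lemma adapted_parametrization:
  fixes l :: 3 and \<alpha> \<beta> u :: "real ^ 3 \<Rightarrow> real" and S :: "(real ^ 3) set"
  assumes U: "open U" "p \<in> U"
    and C1: "C1_partials U u du" "C1_partials U \<alpha> d\<alpha>" "C1_partials U \<beta> d\<beta>"
    and z: "u p = 0" "\<alpha> p = 0" "\<beta> p = 0"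
    and r: "r > 0"
    and cx: "complexifies r p u Fu" "complexifies r p \<alpha> F\<alpha>" "complexifies r p \<beta> F\<beta>"
    and C1c: "C1_partials (ball 0 r) Fu Du" "C1_partials (ball 0 r) F\<alpha> D\<alpha>" "C1_partials (ball 0 r) F\<beta> D\<beta>"
    and rU: "ball p r \<subseteq> U"
    and inj: "\<And>h. h $ l = 0 \<Longrightarrow> (\<Sum>i\<in>UNIV. d\<alpha> i p * h $ i) = 0 \<Longrightarrow> (\<Sum>i\<in>UNIV. du i p * h $ i) = 0 \<Longrightarrow> h = 0"
    and S: "S \<inter> U = {q \<in> U. u q = 0}"
    and iso: "\<And>q. q \<in> S \<Longrightarrow> q \<in> ball p r \<Longrightarrow> q \<noteq> p \<Longrightarrow> \<alpha> q \<noteq> 0 \<or> \<beta> q \<noteq> 0"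
  obtains W V \<phi> k c M \<delta> where "open W" "W \<subseteq> ball p r" "p \<in> W" "\<phi> ` V = S \<inter> W" "local_parametrization S V \<phi>"
    "\<delta> > 0" "V = ball (axis 1 (p $ l)) \<delta>" "\<phi> (axis 1 (p $ l)) = p"
    "c > 0" "(k::nat) > 0"
    "\<And>x. x \<in> V \<Longrightarrow> c * (\<bar>x $ 2\<bar> + \<bar>x $ 1 - p $ l\<bar> ^ k) \<le> \<bar>\<alpha> (\<phi> x)\<bar> + \<bar>\<beta> (\<phi> x)\<bar>"
    "\<And>x i. x \<in> V \<Longrightarrow> norm (frechet_derivative \<phi> (at x) (axis i 1)) \<le> M"
proof -
  have pb: "p \<in> ball p r" using r by simp
  have cv0: "cvec (p - p) = 0" by (simp add: vec_eq_iff)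
  have C1b: "C1_partials (ball p r) u du" "C1_partials (ball p r) \<alpha> d\<alpha>" "C1_partials (ball p r) \<beta> d\<beta>"
    using C1_partials_subset[OF _ rU] C1 by auto
  have F0: "Fu 0 = 0" "F\<alpha> 0 = 0"
    using cx z pb cv0 unfolding complexifies_def by (metis of_real_0)+
  have D0: "D\<alpha> i 0 = of_real (d\<alpha> i p)" "Du i 0 = of_real (du i p)" for i
    using complexifies_partials[OF cx(2) C1c(2) C1b(2)] complexifies_partials[OF cx(1) C1c(1) C1b(1)] pb cv0
    unfolding complexifies_def by metis+
  have injc: "h = 0" if "h $ l = 0" "(\<Sum>i\<in>UNIV. D\<alpha> i 0 * h $ i) = 0" "(\<Sum>i\<in>UNIV. Du i 0 * h $ i) = 0" for h
    using complex_kernel_from_real[OF inj that(1) that(2)[unfolded D0] that(3)[unfolded D0]] .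
  obtain \<epsilon> \<eta> H where \<epsilon>: "\<epsilon> > 0" and \<eta>: "\<eta> > 0" and H: "H holomorphic_on ball 0 \<epsilon>"
    "\<And>w. norm w < \<eta> \<Longrightarrow> norm (w $ l) < \<epsilon> \<Longrightarrow> F\<alpha> w = 0 \<Longrightarrow> Fu w = 0 \<Longrightarrow> F\<beta> w = H (w $ l)"
    by (rule holomorphic_along_transversal_curve[OF r C1c F0 injc]) (assumption, assumption, assumption, rule that)

  define F where "F i = (if i = 1 then (\<lambda>w. w $ l) else if i = 2 then \<alpha> else u)" for i :: 3
  define D where "D i = (if i = 1 then (\<lambda>j w. if j = l then 1 else 0) else if i = 2 then d\<alpha> else du)" for i :: 3
  have C1F: "C1_partials (ball p r) (F i) (D i)" for i
    using C1b by (auto simp: F_def D_def C1_partials_coord)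
  have injD: "h = 0" if "\<forall>i. (\<Sum>j\<in>UNIV. D i j p * h $ j) = 0" for h
  proof (rule inj)
    show "h $ l = 0" using spec[OF that, of 1] by (simp add: D_def if_distrib[of "\<lambda>x. x * _"] cong: if_cong)
    show "(\<Sum>i\<in>UNIV. d\<alpha> i p * h $ i) = 0" using spec[OF that, of 2] by (simp add: D_def)
    show "(\<Sum>i\<in>UNIV. du i p * h $ i) = 0" using spec[OF that, of 3] by (simp add: D_def)
  qed
  obtain U' V' g g' where I: "open U'" "U' \<subseteq> ball p r" "p \<in> U'" "open V'" "(\<chi> i. F i p) \<in> V'"
    "homeomorphism U' V' (\<lambda>x. \<chi> i. F i x) g"
    and gder: "\<And>y. y \<in> V' \<Longrightarrow> (g has_derivative g' y) (at y)"
    and g'1: "\<And>y h i. y \<in> V' \<Longrightarrow> (\<Sum>j\<in>UNIV. D i j (g y) * g' y h $ j) = h $ i"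
    and ker: "\<And>y h. y \<in> V' \<Longrightarrow> \<forall>i. (\<Sum>j\<in>UNIV. D i j (g y) * h $ j) = 0 \<Longrightarrow> h = 0"
    and g'cont: "\<And>h. continuous_on V' (\<lambda>y. g' y h)"
    by (rule inverse_function_C1_partials[where F=F and D=D, OF open_ball pb C1F injD]) (assumption, rule that)
  define x0 :: "real ^ 2" where "x0 = axis 1 (p $ l)"
  define y0 where "y0 = plane_emb x0"
  have x0: "x0 $ 1 = p $ l" "x0 $ 2 = 0" by (simp_all add: x0_def axis_def)
  have y0: "(\<chi> i. F i p) = y0"
    by (simp add: vec_eq_iff forall_3 F_def y0_def x0 z)
  have y0V: "y0 \<in> V'" using I(5) y0 by simp
  have gy0: "g y0 = p" using homeomorphism_apply1[OF I(6) I(3)] y0 by simp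
  have gU': "g y \<in> U'" if "y \<in> V'" for y
    using that homeomorphism_image2[OF I(6)] by blast
  have gb: "g y \<in> ball p r" if "y \<in> V'" for y
    using gU'[OF that] I(2) by blast
  have Fg: "F i (g y) = y $ i" if "y \<in> V'" for y i
    using homeomorphism_apply2[OF I(6) that] by (simp add: vec_eq_iff)
  have gcont: "continuous_on V' g" using homeomorphism_cont2[OF I(6)] .
  have gl: "g y $ l = y $ 1" and g\<alpha>: "\<alpha> (g y) = y $ 2" and gu: "u (g y) = y $ 3" if "y \<in> V'" for y
    using Fg[OF that, of 1] Fg[OF that, of 2] Fg[OF that, of 3] by (simp_all add: F_def)
  have "open (V' \<inter> g -` ball p \<eta>)"
    using continuous_open_preimage[OF gcont I(4) open_ball] .
  moreover have "y0 \<in> V' \<inter> g -` ball p \<eta>" using y0V gy0 \<eta> by simp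
  \<comment> \<open>The ball is closed so that compactness can bound derivatives on it, and
    \<open>g\<close> maps it within \<open>\<eta>\<close> of \<open>p\<close> so that
    \<open>H\<close> computes \<open>\<beta>\<close> on the curve.\<close>
  ultimately obtain \<delta>1 where \<delta>1: "\<delta>1 > 0" "cball y0 \<delta>1 \<subseteq> V' \<inter> g -` ball p \<eta>"
    using open_contains_cball by blast
  define \<epsilon>' where "\<epsilon>' = min \<epsilon> \<delta>1"
  have \<epsilon>': "\<epsilon>' > 0" using \<epsilon> \<delta>1 by (simp add: \<epsilon>'_def)
  have HS: "H (of_real s) = of_real (\<beta> (g (y0 + axis 1 s)))" "y0 + axis 1 s \<in> V'" if "\<bar>s\<bar> < \<epsilon>'" for s
  proof -
    let ?y = "y0 + axis 1 s" 
    have "dist y0 ?y = \<bar>s\<bar>" by (simp add: dist_norm norm_vec_def L2_set_def sum_3 axis_def)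
    then have y: "?y \<in> cball y0 \<delta>1" using that by (simp add: \<epsilon>'_def)
    then have yV: "?y \<in> V'" and y\<eta>: "g ?y \<in> ball p \<eta>" using \<delta>1 by auto
    show "?y \<in> V'" by fact
    define w where "w = cvec (g ?y - p)"
    have "norm w < \<eta>" using y\<eta> by (simp add: w_def dist_norm norm_minus_commute)
    moreover have wl: "w $ l = of_real s" using gl[OF yV] x0 by (simp add: w_def y0_def axis_def)
    moreover have "F\<alpha> w = of_real (\<alpha> (g ?y))" "Fu w = of_real (u (g ?y))" "F\<beta> w = of_real (\<beta> (g ?y))"
      using cx gb[OF yV] by (auto simp: complexifies_def w_def)
    moreover have "\<alpha> (g ?y) = 0" "u (g ?y) = 0"
      using g\<alpha>[OF yV] gu[OF yV] x0 by (simp_all add: y0_def axis_def)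
    ultimately show "H (of_real s) = of_real (\<beta> (g ?y))"
      using H(2)[of w] that by (simp add: \<epsilon>'_def)
  qed
  have H0: "H 0 = 0"
  proof -
    have "y0 + axis 1 0 = y0" by (simp add: vec_eq_iff axis_def)
    then have "g (y0 + axis 1 0) = p" using gy0 by (simp only:)
    then show ?thesis using HS(1)[of 0] \<epsilon>' z by simp
  qed
  \<comment> \<open>A point of the real curve other than \<open>p\<close> lies on \<open>S\<close>
    and has \<open>\<alpha> = 0\<close>, so the isolation of \<open>p\<close> forces
    \<open>\<beta> \<noteq> 0\<close> there.\<close>
  have Hnz: "H (of_real s) \<noteq> 0" if s: "0 < \<bar>s\<bar>" "\<bar>s\<bar> < \<epsilon>'" for s
  proof -
    let ?q = "g (y0 + axis 1 s)"
    have yV: "y0 + axis 1 s \<in> V'" using HS(2) s by blast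
    have "?q \<noteq> p" using gl[OF yV] x0 s by (auto simp: y0_def axis_def)
    moreover have q: "?q \<in> ball p r" by (rule gb[OF yV])
    moreover have "?q \<in> S"
      using gu[OF yV] q rU S by (auto simp: y0_def axis_def)
    moreover have "\<alpha> ?q = 0" using g\<alpha>[OF yV] x0 by (simp add: y0_def axis_def)
    ultimately have "\<beta> ?q \<noteq> 0" using iso by blast
    then show ?thesis using HS(1)[OF s(2)] by simp
  qed
  have "H holomorphic_on ball 0 \<epsilon>'"
    by (rule holomorphic_on_subset[OF H(1)]) (auto simp: \<epsilon>'_def)
  from holomorphic_finite_order_lower_bound[OF this \<epsilon>' H0 Hnz]
  obtain c1 \<delta> k where c1: "c1 > 0" and \<delta>: "\<delta> > 0" "\<delta> \<le> \<epsilon>'" and k: "(k::nat) > 0"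
    and low: "\<And>s::real. \<bar>s\<bar> < \<delta> \<Longrightarrow> c1 * \<bar>s\<bar> ^ k \<le> norm (H (of_real s))" by blast

  let ?K = "cball y0 \<delta>1"
  have KV: "?K \<subseteq> V'" using \<delta>1 by auto
  have "continuous_on V' (\<lambda>y. d\<beta> i (g y))" for i
    by (rule continuous_on_compose2[OF C1_partialsD(2)[OF C1b(3)] gcont]) (use gb in auto)
  then have "continuous_on ?K (\<lambda>y. \<Sum>i\<in>UNIV. \<bar>d\<beta> i (g y)\<bar>)"
    by (intro continuous_on_sum continuous_on_rabs) (rule continuous_on_subset[OF _ KV])
  then obtain K where K: "K \<ge> 0" "\<And>y. y \<in> ?K \<Longrightarrow> (\<Sum>i\<in>UNIV. \<bar>d\<beta> i (g y)\<bar>) \<le> K"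
    by (rule bounded_above_on_compact[OF compact_cball]) (rule that)
  have "continuous_on ?K (\<lambda>y. \<Sum>j\<in>UNIV. norm (g' y (axis j 1)))"
    by (intro continuous_on_sum continuous_on_norm continuous_on_subset[OF g'cont KV])
  then obtain M where M: "M \<ge> 0" "\<And>y. y \<in> ?K \<Longrightarrow> (\<Sum>j\<in>UNIV. norm (g' y (axis j 1))) \<le> M"
    by (rule bounded_above_on_compact[OF compact_cball]) (rule that)
  have g'bd: "norm (g' y h) \<le> M * norm h" if "y \<in> ?K" for y h
  proof -
    have "norm (g' y h) \<le> (\<Sum>j\<in>UNIV. norm (g' y (axis j 1))) * norm h"
      by (rule norm_linear_le_sum_axis, rule has_derivative_linear, rule gder) (use that KV in auto)
    also have "\<dots> \<le> M * norm h" using M(2)[OF that] by (simp add: mult_right_mono)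
    finally show ?thesis .
  qed
  \<comment> \<open>Mean value inequality on a convex ball: \<open>K\<close> bounds the gradient of
    \<open>\<beta>\<close> and \<open>M\<close> the derivative of \<open>g\<close>.\<close>
  have lip: "\<bar>\<beta> (g x) - \<beta> (g y)\<bar> \<le> K * M * norm (x - y)" if "x \<in> ?K" "y \<in> ?K" for x y
  proof -
    have "norm (\<beta> (g x) - \<beta> (g y)) \<le> (K * M) * norm (x - y)"
    proof (rule differentiable_bound[OF convex_cball _ _ that])
      fix z assume zK: "z \<in> ?K"
      then have zV: "z \<in> V'" using KV by auto
      show "((\<lambda>y. \<beta> (g y)) has_derivative (\<lambda>h. \<Sum>i\<in>UNIV. d\<beta> i (g z) * g' z h $ i)) (at z within ?K)"
        by (rule has_derivative_at_withinI, rule has_derivative_compose[OF gder[OF zV] C1_partialsD(1)[OF C1b(3) gb[OF zV]]])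
      show "onorm (\<lambda>h. \<Sum>i\<in>UNIV. d\<beta> i (g z) * g' z h $ i) \<le> K * M"
      proof (rule onorm_le)
        fix h
        have "norm (\<Sum>i\<in>UNIV. d\<beta> i (g z) * g' z h $ i) \<le> (\<Sum>i\<in>UNIV. \<bar>d\<beta> i (g z)\<bar> * norm (g' z h))"
          by (rule sum_norm_le) (simp add: abs_mult mult_left_mono component_le_norm_cart)
        also have "\<dots> = (\<Sum>i\<in>UNIV. \<bar>d\<beta> i (g z)\<bar>) * norm (g' z h)" by (simp add: sum_distrib_right)
        also have "\<dots> \<le> K * (M * norm h)" by (intro mult_mono K(2) g'bd zK K(1)) auto
        finally show "norm (\<Sum>i\<in>UNIV. d\<beta> i (g z) * g' z h $ i) \<le> K * M * norm h" by (simp add: mult.assoc)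
      qed
    qed
    then show ?thesis by simp
  qed

  define V where "V = ball x0 \<delta>"
  define \<phi> where "\<phi> x = g (plane_emb x)" for x
  \<comment> \<open>Pulling back a three-dimensional ball, and not just its slice, makes
    \<open>W\<close> open in the ambient space, while \<open>S \<inter> W\<close> is exactly the
    image of the slice.\<close>
  define W where "W = U' \<inter> (\<lambda>x. \<chi> i. F i x) -` ball y0 \<delta>"
  have \<delta>\<delta>: "\<delta> \<le> \<delta>1" using \<delta> by (simp add: \<epsilon>'_def)
  have embK: "plane_emb x \<in> ?K" and embV: "plane_emb x \<in> V'" if "x \<in> V" for x
  proof -
    show "plane_emb x \<in> ?K" using that \<delta>\<delta> by (simp add: V_def y0_def)
    then show "plane_emb x \<in> V'" using KV by auto
  qed
  have Wop: "open W"
    unfolding W_def by (rule continuous_open_preimage[OF homeomorphism_cont1[OF I(6)] I(1) open_ball])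
  have pW: "p \<in> W" using I(3) y0 \<delta> by (simp add: W_def)
  have Wr: "W \<subseteq> ball p r" using I(2) by (auto simp: W_def)
  have img: "\<phi> ` V = S \<inter> W"
  proof (intro subset_antisym subsetI)
    fix q assume "q \<in> \<phi> ` V"
    then obtain x where x: "x \<in> V" "q = g (plane_emb x)" by (auto simp: \<phi>_def)
    have "(\<chi> i. F i q) = plane_emb x" unfolding x(2) using Fg[OF embV[OF x(1)]] by (simp add: vec_eq_iff)
    then have "q \<in> W" using gU'[OF embV[OF x(1)]] x by (auto simp: W_def V_def y0_def)
    moreover have "q \<in> S" using gu[OF embV[OF x(1)]] gb[OF embV[OF x(1)]] x(2) rU S by auto
    ultimately show "q \<in> S \<inter> W" by blast
  next
    fix q assume q: "q \<in> S \<inter> W"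
    define x :: "real^2" where "x = (\<chi> i. if i = 1 then q $ l else \<alpha> q)"
    have "u q = 0" using q Wr rU S by blast
    then have eq: "(\<chi> i. F i q) = plane_emb x"
      by (simp add: vec_eq_iff forall_3 F_def x_def)
    then have "x \<in> V" using q by (simp add: W_def V_def y0_def)
    moreover have "\<phi> x = q" using homeomorphism_apply1[OF I(6), of q] q eq by (simp add: \<phi>_def W_def)
    ultimately show "q \<in> \<phi> ` V" by blast
  qed
  have \<phi>der: "(\<phi> has_derivative (\<lambda>h. g' (plane_emb x) (plane_emb h))) (at x)" if "x \<in> V" for x
    unfolding \<phi>_def
    by (rule has_derivative_compose[OF bounded_linear_imp_has_derivative[OF bounded_linear_plane_emb] gder[OF embV[OF that]]])
  have fre: "frechet_derivative \<phi> (at x) = (\<lambda>h. g' (plane_emb x) (plane_emb h))" if "x \<in> V" for x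
    using frechet_derivative_at[OF \<phi>der[OF that]] by simp
  have contemb: "continuous_on V plane_emb"
    by (rule linear_continuous_on[OF bounded_linear_plane_emb])
  have lp: "local_parametrization S V \<phi>"
    unfolding local_parametrization_def
  proof (intro conjI ballI)
    show "open V" by (simp add: V_def)
    show "inj (frechet_derivative \<phi> (at x))" if "x \<in> V" for x
    proof (rule injI)
      fix h h' :: "real^2" assume "frechet_derivative \<phi> (at x) h = frechet_derivative \<phi> (at x) h'"
      then have "g' (plane_emb x) (plane_emb h) = g' (plane_emb x) (plane_emb h')" by (simp add: fre[OF that])
      then have "plane_emb h $ i = plane_emb h' $ i" for i
        using g'1[OF embV[OF that], of i "plane_emb h"] g'1[OF embV[OF that], of i "plane_emb h'"] by simp
      from this[of 1] this[of 2] show "h = h'" by (simp add: vec_eq_iff forall_2)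
    qed
    show "openin (top_of_set S) (\<phi> ` V)" using img Wop by (simp add: openin_open_Int)
    have "continuous_on V (\<lambda>x. frechet_derivative \<phi> (at x) (axis i 1))" for i
    proof (rule continuous_on_eq)
      show "continuous_on V (\<lambda>x. g' (plane_emb x) (plane_emb (axis i 1)))"
        by (rule continuous_on_compose2[OF g'cont contemb]) (use embV in auto)
    qed (simp add: fre)
    then show "Ck_on 1 V \<phi>"
      using \<phi>der by (auto simp: differentiable_def)
    have "homeomorphism V (\<phi> ` V) \<phi> (\<lambda>q. \<chi> i. if i = 1 then q $ l else \<alpha> q)"
    proof (rule homeomorphismI)
      show "continuous_on V \<phi>" unfolding \<phi>_def
        by (rule continuous_on_compose2[OF gcont contemb]) (use embV in auto)
      have "continuous_on (\<phi> ` V) \<alpha>"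
        by (rule continuous_on_subset[OF C1_partials_continuous[OF C1b(2)]]) (use img Wr in auto)
      then have "continuous_on (\<phi> ` V) (\<lambda>q. if i = 1 then q $ l else \<alpha> q)" for i :: 2
        by (cases "i = 1") (auto intro!: continuous_intros)
      then show "continuous_on (\<phi> ` V) (\<lambda>q. (\<chi> i. if i = 1 then q $ l else \<alpha> q) :: real^2)"
        by (intro continuous_on_vec_lambda)
      have inv: "(\<chi> i. if i = 1 then \<phi> x $ l else \<alpha> (\<phi> x)) = x" if "x \<in> V" for x
        using gl[OF embV[OF that]] g\<alpha>[OF embV[OF that]] by (simp add: \<phi>_def vec_eq_iff forall_2)
      then show "(\<chi> i. if i = 1 then \<phi> x $ l else \<alpha> (\<phi> x)) = x" if "x \<in> V" for x using that by blast
      show "(\<lambda>q. \<chi> i. if i = 1 then q $ l else \<alpha> q) ` \<phi> ` V \<subseteq> V" using inv by auto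
      show "\<phi> (\<chi> i. if i = 1 then q $ l else \<alpha> q) = q" if "q \<in> \<phi> ` V" for q
        using that inv by auto
    qed simp
    then show "\<exists>\<psi>. homeomorphism V (\<phi> ` V) \<phi> \<psi>" by blast
  qed
  have emb_axis: "norm (plane_emb (axis i 1)) = 1" for i by (simp add: norm_axis_1)
  show ?thesis
  proof (rule that[OF Wop Wr pW img lp \<delta>(1)])
    show "V = ball (axis 1 (p $ l)) \<delta>" by (simp add: V_def x0_def)
    show "\<phi> (axis 1 (p $ l)) = p" using gy0 by (simp add: \<phi>_def y0_def x0_def)
    \<comment> \<open>With \<open>t = x $ 2\<close>, the estimates
      \<open>c1 |s|^k \<le> |\<beta>| + K M |t|\<close> and \<open>|t| = |\<alpha>|\<close> give
      \<open>min c1 1 * (|t| + |s|^k) \<le> (K M + 1) (|\<alpha>| + |\<beta>|)\<close>; the constant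
      is the quotient.\<close>
    show "min c1 1 / (K * M + 1) > 0" using c1 K M by (simp add: add_nonneg_pos)
    show "k > 0" by fact
    show "norm (frechet_derivative \<phi> (at x) (axis i 1)) \<le> M" if "x \<in> V" for x i
      using g'bd[OF embK[OF that], of "plane_emb (axis i 1)"] fre[OF that] emb_axis[of i] by simp
    fix x assume x: "x \<in> V"
    define s where "s = x $ 1 - p $ l"
    have s: "\<bar>s\<bar> < \<delta>"
      using x component_le_norm_cart[of "x - x0" 1] by (simp add: V_def s_def x0 dist_norm norm_minus_commute)
    \<comment> \<open>The point of the curve with the same first coordinate, at distance
      \<open>|x $ 2|\<close> from the given one.\<close>
    let ?y = "y0 + axis 1 s"
    have "dist y0 ?y = \<bar>s\<bar>" by (simp add: dist_norm norm_vec_def L2_set_def sum_3 axis_def)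
    then have yK: "?y \<in> ?K" using s \<delta>\<delta> by simp
    have "plane_emb x - ?y = axis 2 (x $ 2)"
      by (simp add: vec_eq_iff forall_3 y0_def x0 s_def axis_def)
    then have nrm: "norm (plane_emb x - ?y) = \<bar>x $ 2\<bar>"
      by (simp add: norm_vec_def L2_set_def sum_3 axis_def)
    have "c1 * \<bar>s\<bar> ^ k \<le> \<bar>\<beta> (g ?y)\<bar>"
      using low[OF s] HS(1)[of s] s \<delta>(2) by simp
    also have "\<dots> \<le> \<bar>\<beta> (\<phi> x)\<bar> + K * M * \<bar>x $ 2\<bar>"
      using lip[OF embK[OF x] yK] nrm by (simp add: \<phi>_def)
    finally have 1: "c1 * \<bar>s\<bar> ^ k \<le> \<bar>\<beta> (\<phi> x)\<bar> + K * M * \<bar>x $ 2\<bar>" .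
    have a: "\<alpha> (\<phi> x) = x $ 2" using g\<alpha>[OF embV[OF x]] by (simp add: \<phi>_def)
    have KM: "K * M \<ge> 0" using K M by simp
    have "min c1 1 * (\<bar>x $ 2\<bar> + \<bar>s\<bar> ^ k) \<le> \<bar>x $ 2\<bar> + c1 * \<bar>s\<bar> ^ k"
      using mult_right_mono[of "min c1 1" 1 "\<bar>x $ 2\<bar>"] mult_right_mono[of "min c1 1" c1 "\<bar>s\<bar> ^ k"]
      by (simp add: distrib_left)
    also have "\<dots> \<le> (K * M + 1) * (\<bar>\<alpha> (\<phi> x)\<bar> + \<bar>\<beta> (\<phi> x)\<bar>)"
      using 1 a mult_nonneg_nonneg[OF KM, of "\<bar>\<beta> (\<phi> x)\<bar>"] by (simp add: algebra_simps)
    finally show "min c1 1 / (K * M + 1) * (\<bar>x $ 2\<bar> + \<bar>x $ 1 - p $ l\<bar> ^ k) \<le> \<bar>\<alpha> (\<phi> x)\<bar> + \<bar>\<beta> (\<phi> x)\<bar>"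
      using KM by (simp add: s_def field_simps)
  qed
qed

section \<open>Integrable majorants and the induced measure\<close>

lemma nn_integral_abs_powr_finite:
  assumes a: "0 < a" "a < 1" and \<delta>: "\<delta> > 0"
  shows "(\<integral>\<^sup>+t. indicator {-\<delta>..\<delta>} t * inverse (ennreal (\<bar>t\<bar> powr a)) \<partial>lborel) < \<infinity>"
proof -
  define g where "g t = (if t \<in> {0..\<delta>} then t powr (-a) else 0)" for t :: real
  have [measurable]: "g \<in> borel_measurable borel" unfolding g_def by measurable
  have "((\<lambda>x. x powr (-a)) has_integral (\<delta> powr (-a+1) / (-a+1))) {0..\<delta>}"
    by (rule has_integral_powr_from_0) (use a \<delta> in auto)
  then have gI: "(g has_integral (\<delta> powr (-a+1) / (-a+1))) UNIV"
    unfolding g_def by (simp only: has_integral_restrict_UNIV)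
  have I: "(\<integral>\<^sup>+t. ennreal (g t) \<partial>lborel) = ennreal (\<delta> powr (-a+1) / (-a+1))"
    by (rule nn_integral_has_integral_lborel[OF _ _ gI]) (simp_all add: g_def)
  have I': "(\<integral>\<^sup>+t. ennreal (g (-t)) \<partial>lborel) = (\<integral>\<^sup>+t. ennreal (g t) \<partial>lborel)"
    using nn_integral_real_affine[of "\<lambda>t. ennreal (g t)" "-1" 0] by simp
  have "(\<integral>\<^sup>+t. indicator {-\<delta>..\<delta>} t * inverse (ennreal (\<bar>t\<bar> powr a)) \<partial>lborel)
      \<le> (\<integral>\<^sup>+t. ennreal (g t) + ennreal (g (-t)) \<partial>lborel)"
  proof (rule nn_integral_mono_AE)
    \<comment> \<open>At \<open>t = 0\<close> the left side is infinite, whereas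
      \<open>0 powr (-a)\<close> is \<open>0\<close> by convention, so the bound holds only off a
      null set.\<close>
    show "AE t in lborel. indicator {-\<delta>..\<delta>} t * inverse (ennreal (\<bar>t\<bar> powr a)) \<le> ennreal (g t) + ennreal (g (-t))"
      using AE_lborel_singleton[of "0::real"]
    proof eventually_elim
      case (elim t)
      have "inverse (ennreal (\<bar>t\<bar> powr a)) = ennreal (\<bar>t\<bar> powr (-a))"
        using elim by (simp add: inverse_ennreal powr_minus)
      then show ?case using elim by (auto simp: g_def indicator_def split: if_splits)
    qed
  qed
  also have "\<dots> = (\<integral>\<^sup>+t. ennreal (g t) \<partial>lborel) + (\<integral>\<^sup>+t. ennreal (g (-t)) \<partial>lborel)"
    by (rule nn_integral_add) auto
  also have "\<dots> < \<infinity>" unfolding I' I by simp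
  finally show ?thesis .
qed

lemma nn_integral_prod_plane:
  fixes f g :: "real \<Rightarrow> ennreal"
  assumes [measurable]: "f \<in> borel_measurable borel" "g \<in> borel_measurable borel"
  shows "(\<integral>\<^sup>+x. f ((x::real^2) $ 1) * g (x $ 2) \<partial>lborel) = (\<integral>\<^sup>+t. f t \<partial>lborel) * (\<integral>\<^sup>+t. g t \<partial>lborel)"
proof -
  define F where "F b = (if b = (axis 1 1 :: real^2) then f else g)" for b
  have B: "(Basis :: (real^2) set) = {axis 1 1, axis 2 1}"
    unfolding Basis_vec_def UNIV_2 by auto
  have ne: "axis 1 1 \<noteq> (axis 2 1 :: real^2)" by (simp add: axis_eq_axis)
  have "(\<integral>\<^sup>+x. (\<Prod>b\<in>Basis. F b (x \<bullet> b)) \<partial>lborel) = (\<Prod>b\<in>Basis. (\<integral>\<^sup>+x. F b x \<partial>lborel))"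
    by (rule nn_integral_lborel_prod) (auto simp: F_def)
  then show ?thesis using ne ne[symmetric] by (simp add: B F_def inner_axis)
qed

text \<open>The factors are powers of \<open>t\<close> and \<open>s^k\<close> with exponents
  \<open>1 - 1/(2k)\<close> and \<open>1/(2k)\<close>, which sum to 1, so the larger base
  \<open>M\<close> bounds the product. The split leaves both \<open>t\<close> and \<open>s\<close>
  with exponents strictly between 0 and 1, hence with reciprocals integrable near 0.\<close>

lemma young_powr:
  fixes s t :: real and k :: nat
  assumes "s \<ge> 0" "t \<ge> 0" "k > 0"
  shows "t powr (1 - 1 / (2 * real k)) * s powr (1/2) \<le> t + s ^ k"
proof (cases "t = 0 \<or> s = 0")
  case True
  then show ?thesis using assms by auto
next
  case False
  then have st: "s > 0" "t > 0" using assms by auto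
  define M where "M = max t (s ^ k)"
  have "t powr (1 - 1 / (2 * real k)) \<le> M powr (1 - 1 / (2 * real k))"
    by (rule powr_mono2) (use st assms in \<open>auto simp: M_def divide_simps\<close>)
  moreover have "s powr (1/2) = (s ^ k) powr (1 / (2 * real k))"
    using st assms by (simp add: powr_realpow[symmetric] powr_powr)
  then have "s powr (1/2) \<le> M powr (1 / (2 * real k))"
    by (simp, intro powr_mono2) (use st assms in \<open>auto simp: M_def\<close>)
  ultimately have "t powr (1 - 1 / (2 * real k)) * s powr (1/2) \<le> M powr (1 - 1 / (2 * real k)) * M powr (1 / (2 * real k))"
    by (intro mult_mono) auto
  also have "\<dots> = M" using st by (simp add: powr_add[symmetric] M_def)
  also have "\<dots> \<le> t + s ^ k" using st by (simp add: M_def)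
  finally show ?thesis .
qed

text \<open>In \<open>ennreal\<close> the reciprocal of \<open>0\<close> is infinite. The bound
  therefore survives \<open>a = 0\<close> or \<open>b = 0\<close>, where \<open>w\<close> may vanish
  too: the right side is then \<open>top\<close>.\<close>

lemma inverse_ennreal_le_product:
  fixes a b c w :: real
  assumes "a \<ge> 0" "b \<ge> 0" "c > 0" "c * (a * b) \<le> w"
  shows "1 / ennreal w \<le> ennreal (1 / c) * (inverse (ennreal a) * inverse (ennreal b))"
proof (cases "a = 0 \<or> b = 0")
  case True
  have "inverse (ennreal x) \<noteq> 0" for x by simp
  then have "inverse (ennreal a) * inverse (ennreal b) = top"
    using True by (auto simp: ennreal_mult_top ennreal_top_mult)
  then show ?thesis using assms by (simp add: ennreal_mult_top)
next
  case False
  then have "a > 0" "b > 0" using assms by auto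
  moreover from this have w: "0 < c * (a * b)" using assms by simp
  then have "w > 0" using assms by linarith
  moreover have "1 / w \<le> 1 / (c * (a * b))" using w assms by (intro divide_left_mono) auto
  ultimately show ?thesis using assms
    by (simp add: inverse_ennreal divide_ennreal_def ennreal_mult[symmetric] inverse_eq_divide ennreal_leI)
qed

text \<open>On the ball, \<open>K\<close> is infinite along the two coordinate lines through the
  centre, so it dominates \<open>1/w\<close> at every point and not just almost everywhere. This
  avoids arguing about null sets of the surface measure.\<close>

lemma planar_majorant:
  fixes s0 c \<delta> :: real and k :: nat
  assumes k: "k > 0" and c: "c > 0" and \<delta>: "\<delta> > 0"
  obtains K :: "real^2 \<Rightarrow> ennreal" where "K \<in> borel_measurable borel" "(\<integral>\<^sup>+x. K x \<partial>lborel) < \<infinity>"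
    "\<And>x w. x \<in> ball (axis 1 s0) \<delta> \<Longrightarrow> c * (\<bar>x $ 2\<bar> + \<bar>x $ 1 - s0\<bar> ^ k) \<le> w \<Longrightarrow> 1 / ennreal w \<le> K x"
proof -
  define e where "e = 1 - 1 / (2 * real k)"
  have e: "0 < e" "e < 1" using k by (auto simp: e_def field_simps)
  define f where "f t = indicator {-\<delta>..\<delta>} t * inverse (ennreal (\<bar>t\<bar> powr (1/2)))" for t :: real
  define g where "g t = indicator {-\<delta>..\<delta>} t * inverse (ennreal (\<bar>t\<bar> powr e))" for t :: real
  have [measurable]: "f \<in> borel_measurable borel" "g \<in> borel_measurable borel"
    unfolding f_def g_def by measurable
  have fi: "(\<integral>\<^sup>+t. f t \<partial>lborel) < \<infinity>" and gi: "(\<integral>\<^sup>+t. g t \<partial>lborel) < \<infinity>"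
    unfolding f_def g_def by (rule nn_integral_abs_powr_finite; use e \<delta> in simp)+
  have f': "(\<integral>\<^sup>+t. f (t - s0) \<partial>lborel) = (\<integral>\<^sup>+t. f t \<partial>lborel)"
    using nn_integral_real_affine[of f 1 "-s0"] by simp
  define K where "K x = ennreal (1 / c) * (f (x $ 1 - s0) * g (x $ 2))" for x :: "real^2"
  have cn: "(\<lambda>x::real^2. x $ i) \<in> borel_measurable borel" for i
    by (intro borel_measurable_continuous_onI continuous_intros)
  show ?thesis
  proof (rule that[of K])
    note cn[measurable]
    show "K \<in> borel_measurable borel" unfolding K_def by measurable
    have "(\<integral>\<^sup>+x. K x \<partial>lborel) = ennreal (1 / c) * (\<integral>\<^sup>+x. f ((x::real^2) $ 1 - s0) * g (x $ 2) \<partial>lborel)"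
      unfolding K_def by (rule nn_integral_cmult) measurable
    also have "\<dots> = ennreal (1 / c) * ((\<integral>\<^sup>+t. f t \<partial>lborel) * (\<integral>\<^sup>+t. g t \<partial>lborel))"
      by (subst nn_integral_prod_plane[of "\<lambda>t. f (t - s0)" g]) (simp_all add: f')
    also have "\<dots> < \<infinity>" using fi gi by (simp add: ennreal_mult_less_top)
    finally show "(\<integral>\<^sup>+x. K x \<partial>lborel) < \<infinity>" .
    fix x :: "real^2" and w assume x: "x \<in> ball (axis 1 s0) \<delta>" and w: "c * (\<bar>x $ 2\<bar> + \<bar>x $ 1 - s0\<bar> ^ k) \<le> w"
    have "\<bar>x $ 1 - s0\<bar> \<le> \<delta>" "\<bar>x $ 2\<bar> \<le> \<delta>"
      using component_le_norm_cart[of "x - axis 1 s0" 1] component_le_norm_cart[of "x - axis 1 s0" 2] x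
      by (auto simp: dist_norm norm_minus_commute axis_def)
    then have K: "K x = ennreal (1 / c) * (inverse (ennreal (\<bar>x $ 1 - s0\<bar> powr (1/2))) * inverse (ennreal (\<bar>x $ 2\<bar> powr e)))"
      by (auto simp: K_def f_def g_def abs_le_iff)
    have "\<bar>x $ 2\<bar> powr e * \<bar>x $ 1 - s0\<bar> powr (1/2) \<le> \<bar>x $ 2\<bar> + \<bar>x $ 1 - s0\<bar> ^ k"
      unfolding e_def by (rule young_powr) (use k in auto)
    then have "c * (\<bar>x $ 1 - s0\<bar> powr (1/2) * \<bar>x $ 2\<bar> powr e) \<le> w"
      using c w by (smt (verit, best) mult.commute mult_left_mono)
    then show "1 / ennreal w \<le> K x"
      unfolding K by (intro inverse_ennreal_le_product) (use c in auto)
  qed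
qed

text \<open>The induced measure is known only through its values on images of Borel sets. It is
  therefore pushed to the plane by the inverse chart \<open>\<psi>\<close>, compared with
  \<open>C\<close> times Lebesgue measure set by set, and only then integrated against
  \<open>K\<close>.\<close>

lemma nn_integral_induced_measure_le:
  fixes K :: "real^2 \<Rightarrow> ennreal"
  assumes ind: "is_riemannian_induced_measure G S \<sigma>" and lp: "local_parametrization S V \<phi>"
    and dens: "\<And>x. x \<in> V \<Longrightarrow> induced_density G S (\<phi> x)
             (frechet_derivative \<phi> (at x) (axis 1 1)) (frechet_derivative \<phi> (at x) (axis 2 1)) \<le> C"
    and K: "K \<in> borel_measurable borel" and h: "\<And>x. x \<in> V \<Longrightarrow> h (\<phi> x) \<le> K x"
  shows "(\<integral>\<^sup>+q\<in>\<phi> ` V. h q \<partial>\<sigma>) \<le> ennreal C * (\<integral>\<^sup>+x. K x \<partial>lborel)"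
proof -
  define A where "A = \<phi> ` V"
  obtain \<psi> where \<psi>: "homeomorphism V A \<phi> \<psi>" and V: "open V" and op: "openin (top_of_set S) A"
    using lp unfolding local_parametrization_def A_def by auto
  have \<psi>\<phi>: "\<psi> (\<phi> x) = x" if "x \<in> V" for x using homeomorphism_apply1[OF \<psi> that] .
  have sp: "space \<sigma> = S" and se: "sets \<sigma> = sets (restrict_space borel S)"
    using ind unfolding is_riemannian_induced_measure_def by auto
  obtain T where T: "open T" "A = S \<inter> T" using op by (auto simp: openin_open)
  have A: "A \<in> sets \<sigma>" unfolding se T(2) sets_restrict_space using T(1) by auto
  define M where "M = restrict_space \<sigma> A"
  have spM: "space M = A" using T by (auto simp: M_def space_restrict_space sp)
  have "sets M = sets (restrict_space (restrict_space borel S) A)"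
    unfolding M_def by (rule sets_restrict_space_cong[OF se])
  also have "\<dots> = sets (restrict_space borel A)"
    using T(2) by (simp add: sets_restrict_restrict_space Int_absorb1)
  finally have seM: "sets M = sets (restrict_space borel A)" .
  have meas: "\<psi> \<in> borel_measurable M"
    using borel_measurable_continuous_on_restrict[OF homeomorphism_cont2[OF \<psi>]] measurable_cong_sets[OF seM refl] by blast
  define \<nu> where "\<nu> = distr M borel \<psi>"
  have le: "emeasure \<nu> B \<le> emeasure (density lborel (\<lambda>_. ennreal C)) B" if B: "B \<in> sets borel" for B
  proof -
    have pre: "\<psi> -` B \<inter> A = \<phi> ` (B \<inter> V)"
      using \<psi>\<phi> by (auto simp: A_def)
    have BV: "B \<inter> V \<in> sets borel" using B V by auto
    have "emeasure \<nu> B = emeasure M (\<psi> -` B \<inter> A)"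
      unfolding \<nu>_def using emeasure_distr[OF meas, of B] B spM by simp
    also have "\<dots> = emeasure \<sigma> (\<phi> ` (B \<inter> V))"
      unfolding pre M_def by (rule emeasure_restrict_space) (use A sp in \<open>auto simp: A_def sets.Int_space_eq2\<close>)
    also have "\<dots> = (\<integral>\<^sup>+x\<in>B \<inter> V. ennreal (induced_density G S (\<phi> x)
             (frechet_derivative \<phi> (at x) (axis 1 1))
             (frechet_derivative \<phi> (at x) (axis 2 1))) \<partial>lborel)"
      using ind lp BV unfolding is_riemannian_induced_measure_def by auto
    also have "\<dots> \<le> (\<integral>\<^sup>+x. ennreal C * indicator B x \<partial>lborel)"
      by (rule nn_integral_mono) (auto simp: indicator_def intro!: ennreal_leI dens)
    also have "\<dots> = emeasure (density lborel (\<lambda>_. ennreal C)) B"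
      using B by (simp add: emeasure_density)
    finally show ?thesis .
  qed
  have "\<nu> \<le> density lborel (\<lambda>_. ennreal C)"
    by (subst le_measure) (auto simp: \<nu>_def intro!: le[unfolded \<nu>_def])
  then have 1: "nn_integral \<nu> K \<le> nn_integral (density lborel (\<lambda>_. ennreal C)) K"
    by (intro nn_integral_mono_measure) (simp_all add: \<nu>_def)
  have "(\<integral>\<^sup>+q\<in>A. h q \<partial>\<sigma>) \<le> (\<integral>\<^sup>+q. K (\<psi> q) * indicator A q \<partial>\<sigma>)"
    by (rule nn_integral_mono) (auto simp: indicator_def A_def \<psi>\<phi> h)
  also have "\<dots> = (\<integral>\<^sup>+q. K (\<psi> q) \<partial>M)"
    unfolding M_def by (rule nn_integral_restrict_space[symmetric]) (use A in \<open>simp add: sets.Int_space_eq2\<close>)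
  also have "\<dots> = nn_integral \<nu> K"
    unfolding \<nu>_def by (rule nn_integral_distr[symmetric, OF meas]) (use K in simp)
  also note 1
  also have "nn_integral (density lborel (\<lambda>_. ennreal C)) K = ennreal C * (\<integral>\<^sup>+x. K x \<partial>lborel)"
    using K by (simp add: nn_integral_density nn_integral_cmult)
  finally show ?thesis by (simp add: A_def)
qed

section \<open>Defining functions to second order\<close>

text \<open>By the intermediate value theorem in \<open>\<theta>\<close>, the zero set of \<open>u\<close> meets the points
  \<open>q + t v + t\<^sup>n \<theta> e\<close> at some \<open>\<theta>\<close> near \<open>-a\<close>, and \<open>u'\<close> vanishes there. No implicit function is needed.\<close>

lemma zero_set_expansion:
  fixes u u' :: "'a::real_normed_vector \<Rightarrow> real"
  assumes N: "open N" "q \<in> N" and n: "n > 0" and cont: "continuous_on N u"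
    and zero: "\<And>x. x \<in> N \<Longrightarrow> u x = 0 \<Longrightarrow> u' x = 0"
    and u: "\<And>R \<epsilon>. R > 0 \<Longrightarrow> \<epsilon> > 0 \<Longrightarrow> \<forall>\<^sub>F t in at_right (0::real). \<forall>\<theta>. \<bar>\<theta>\<bar> \<le> R \<longrightarrow>
          \<bar>u (q + t *\<^sub>R v + (t ^ n * \<theta>) *\<^sub>R e) - t ^ n * (a + \<theta>)\<bar> \<le> \<epsilon> * t ^ n"
    and u': "\<And>R \<epsilon>. R > 0 \<Longrightarrow> \<epsilon> > 0 \<Longrightarrow> \<forall>\<^sub>F t in at_right (0::real). \<forall>\<theta>. \<bar>\<theta>\<bar> \<le> R \<longrightarrow>
          \<bar>u' (q + t *\<^sub>R v + (t ^ n * \<theta>) *\<^sub>R e) - t ^ n * (a' + m * \<theta>)\<bar> \<le> \<epsilon> * t ^ n"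
  shows "a' = m * a"
proof -
  have bound: "\<bar>a' - m * a\<bar> \<le> (1 + \<bar>m\<bar>) * \<eta>" if \<eta>: "0 < \<eta>" "\<eta> < 1" for \<eta>
  proof -
    \<comment> \<open>This range of \<open>\<theta>\<close> contains the window from
      \<open>-a - \<eta>\<close> to \<open>-a + \<eta>\<close>, because
      \<open>\<eta> < 1\<close>.\<close>
    define R where "R = \<bar>a\<bar> + 1"
    have R: "R > 0" by (simp add: R_def)
    define g where "g t \<theta> = q + t *\<^sub>R v + (t ^ n * \<theta>) *\<^sub>R e" for t \<theta>
    obtain \<rho> where \<rho>: "\<rho> > 0" "ball q \<rho> \<subseteq> N" using N open_contains_ball by metis
    have "((\<lambda>t. t * norm v + t ^ n * R * norm e) \<longlongrightarrow> 0 * norm v + 0 ^ n * R * norm e) (at_right (0::real))"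
      by (intro tendsto_intros)
    from order_tendstoD(2)[OF this, of \<rho>]
    have E1: "\<forall>\<^sub>F t in at_right (0::real). t * norm v + t ^ n * R * norm e < \<rho>"
      using n \<rho>(1) by (simp add: zero_power)
    have E2: "\<forall>\<^sub>F t in at_right (0::real). t > 0" by (simp add: eventually_at_right_less)
    have \<eta>2: "\<eta>/2 > 0" using \<eta> by simp
    obtain t where t: "t > 0" "t * norm v + t ^ n * R * norm e < \<rho>"
      and ut0: "\<forall>\<theta>. \<bar>\<theta>\<bar> \<le> R \<longrightarrow> \<bar>u (g t \<theta>) - t ^ n * (a + \<theta>)\<bar> \<le> \<eta>/2 * t ^ n"
      and u't0: "\<forall>\<theta>. \<bar>\<theta>\<bar> \<le> R \<longrightarrow> \<bar>u' (g t \<theta>) - t ^ n * (a' + m * \<theta>)\<bar> \<le> \<eta> * t ^ n"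
      using eventually_happens'[OF trivial_limit_at_right_real
          eventually_conj[OF E2 eventually_conj[OF E1 eventually_conj[OF u[OF R \<eta>2] u'[OF R \<eta>(1)]]]]]
      unfolding g_def[symmetric] by (elim exE conjE) (rule that)
    note ut = ut0[rule_format] and u't = u't0[rule_format]
    have tn: "t ^ n > 0" using t by simp
    have gN: "g t \<theta> \<in> N" if "\<bar>\<theta>\<bar> \<le> R" for \<theta>
    proof -
      have "norm (t *\<^sub>R v + (t ^ n * \<theta>) *\<^sub>R e) \<le> t * norm v + t ^ n * R * norm e"
      proof -
        have "t ^ n * \<bar>\<theta>\<bar> * norm e \<le> t ^ n * R * norm e"
          using tn that by (intro mult_right_mono mult_left_mono) auto
        moreover have "norm (t *\<^sub>R v + (t ^ n * \<theta>) *\<^sub>R e) \<le> t * norm v + t ^ n * \<bar>\<theta>\<bar> * norm e"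
          using norm_triangle_ineq[of "t *\<^sub>R v" "(t ^ n * \<theta>) *\<^sub>R e"] t by (simp add: abs_mult)
        ultimately show ?thesis by linarith
      qed
      moreover have "dist q (g t \<theta>) = norm (t *\<^sub>R v + (t ^ n * \<theta>) *\<^sub>R e)"
        unfolding g_def dist_commute[of q] by (simp add: dist_norm add.assoc)
      ultimately have "g t \<theta> \<in> ball q \<rho>" using t by simp
      then show ?thesis using \<rho> by auto
    qed
    have i: "\<bar>\<theta>\<bar> \<le> R" if "-a - \<eta> \<le> \<theta>" "\<theta> \<le> -a + \<eta>" for \<theta>
      using that \<eta> by (auto simp: R_def abs_if)
    \<comment> \<open>At the ends of the window the main term is \<open>-\<eta> t^n\<close> and
      \<open>\<eta> t^n\<close>; it beats the error \<open>\<eta>/2 * t^n\<close>, which is why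
      \<open>u\<close> is expanded with half the tolerance.\<close>
    have lo: "u (g t (-a - \<eta>)) \<le> 0"
      using abs_le_D1[OF ut[OF i[of "-a - \<eta>"]]] \<eta>(1) mult_pos_pos[OF \<eta>(1) tn] by (simp add: algebra_simps)
    have hi: "0 \<le> u (g t (-a + \<eta>))"
      using abs_le_D2[OF ut[OF i[of "-a + \<eta>"]]] \<eta>(1) mult_pos_pos[OF \<eta>(1) tn] by (simp add: algebra_simps)
    have "continuous_on {-a - \<eta>..-a + \<eta>} (\<lambda>\<theta>. u (g t \<theta>))"
      by (rule continuous_on_compose2[OF cont])
         (use gN i in \<open>auto simp: g_def intro!: continuous_intros\<close>)
    from IVT'[of "\<lambda>\<theta>. u (g t \<theta>)", OF lo hi _ this] \<eta>
    obtain \<theta> where \<theta>: "-a - \<eta> \<le> \<theta>" "\<theta> \<le> -a + \<eta>" "u (g t \<theta>) = 0" by auto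
    have "u' (g t \<theta>) = 0" using zero[OF gN[OF i[OF \<theta>(1,2)]] \<theta>(3)] .
    then have "t ^ n * \<bar>a' + m * \<theta>\<bar> \<le> t ^ n * \<eta>"
      using u't[OF i[OF \<theta>(1,2)]] tn by (simp add: abs_mult mult.commute)
    then have "\<bar>a' + m * \<theta>\<bar> \<le> \<eta>" using tn by simp
    moreover have "\<bar>m * (\<theta> + a)\<bar> \<le> \<bar>m\<bar> * \<eta>"
      unfolding abs_mult using \<theta> by (intro mult_left_mono) (auto simp: abs_le_iff)
    ultimately show ?thesis by (simp add: algebra_simps abs_le_iff)
  qed
  show ?thesis
  proof (rule ccontr)
    assume ne: "a' \<noteq> m * a"
    define d where "d = \<bar>a' - m * a\<bar>"
    have d: "d > 0" using ne by (simp add: d_def)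
    \<comment> \<open>With this choice \<open>bound\<close> gives \<open>d \<le> d / 2\<close>; the
      cap \<open>1/2\<close> keeps \<open>\<eta> < 1\<close>.\<close>
    define \<eta> where "\<eta> = min (1/2) (d / (2 * (1 + \<bar>m\<bar>)))"
    have "0 < \<eta>" "\<eta> < 1" using d by (auto simp: \<eta>_def)
    from bound[OF this] have "d \<le> (1 + \<bar>m\<bar>) * \<eta>" by (simp add: d_def)
    also have "\<dots> \<le> (1 + \<bar>m\<bar>) * (d / (2 * (1 + \<bar>m\<bar>)))" by (intro mult_left_mono) (auto simp: \<eta>_def)
    also have "\<dots> = d / 2" by (simp add: field_simps)
    finally show False using d by simp
  qed
qed

text \<open>The form \<open>t ^ 1\<close> fits \<open>zero_set_expansion\<close> at
  \<open>n = 1\<close>. The displacement has norm at most \<open>t * C\<close> for every admissible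
  \<open>\<theta>\<close>, which makes the estimate uniform in \<open>\<theta>\<close>.\<close>

lemma first_order_expansion:
  fixes u :: "'a::real_normed_vector \<Rightarrow> real"
  assumes du: "(u has_derivative du) (at q)" and q: "u q = 0" and R: "R > 0" "\<epsilon> > 0"
  shows "\<forall>\<^sub>F t in at_right (0::real). \<forall>\<theta>. \<bar>\<theta>\<bar> \<le> R \<longrightarrow>
          \<bar>u (q + t *\<^sub>R v + (t ^ 1 * \<theta>) *\<^sub>R e) - t ^ 1 * (du v + du e * \<theta>)\<bar> \<le> \<epsilon> * t ^ 1"
proof -
  define C where "C = norm v + R * norm e + 1"
  have C: "C > 0" using R by (simp add: C_def add_nonneg_pos)
  have lin: "linear du" using du has_derivative_linear by blast
  obtain d where d: "d > 0" "\<And>y. norm (y - q) < d \<Longrightarrow> norm (u y - u q - du (y - q)) \<le> \<epsilon> / C * norm (y - q)"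
    using du R C unfolding has_derivative_at_alt by (metis divide_pos_pos)
  have "\<forall>\<^sub>F t in at_right (0::real). t < d / C"
    using d C by (intro eventually_at_right_field[THEN iffD2] exI[of _ "d / C"]) auto
  moreover have "\<forall>\<^sub>F t in at_right (0::real). t > 0" by (simp add: eventually_at_right_less)
  ultimately show ?thesis
  proof eventually_elim
    case (elim t)
    show ?case
    proof (intro allI impI)
      fix \<theta> assume \<theta>: "\<bar>\<theta>\<bar> \<le> R"
      let ?h = "t *\<^sub>R v + (t * \<theta>) *\<^sub>R e"
      have "norm ?h \<le> t * norm v + t * \<bar>\<theta>\<bar> * norm e"
        using norm_triangle_ineq[of "t *\<^sub>R v" "(t * \<theta>) *\<^sub>R e"] elim by (simp add: abs_mult)
      also have "\<dots> \<le> t * norm v + t * R * norm e" using elim \<theta> by (simp add: mult_right_mono)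
      also have "\<dots> \<le> t * C" using elim by (simp add: C_def algebra_simps)
      finally have h: "norm ?h \<le> t * C" .
      then have "norm ?h < d" using elim C by (simp add: field_simps)
      then have "norm (u (q + ?h) - u q - du ?h) \<le> \<epsilon> / C * norm ?h" using d(2)[of "q + ?h"] by simp
      also have "\<dots> \<le> \<epsilon> / C * (t * C)" using h R C by (intro mult_left_mono) auto
      also have "\<dots> = \<epsilon> * t" using C by simp
      finally show "\<bar>u (q + t *\<^sub>R v + (t ^ 1 * \<theta>) *\<^sub>R e) - t ^ 1 * (du v + du e * \<theta>)\<bar> \<le> \<epsilon> * t ^ 1"
        using q by (simp add: linear_add[OF lin] linear_scale[OF lin] algebra_simps)
    qed
  qed
qed

text \<open>The mean value inequality is applied on \<open>[0, 1]\<close> to the remainder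
  \<open>\<rho>\<close>, whose derivative is the first-order remainder of the gradient at
  \<open>q\<close>, paired with \<open>h\<close>; differentiability of the \<open>D i\<close> at
  \<open>q\<close> makes it at most \<open>\<epsilon> |h|^2\<close>.\<close>

lemma taylor_peano_second_order:
  fixes u :: "real ^ 'n::finite \<Rightarrow> real"
  assumes U: "open U" "q \<in> U" and u: "C1_partials U u D" and D: "\<And>i. C1_partials U (D i) (E i)" and \<epsilon>: "\<epsilon> > 0"
  obtains \<delta> where "\<delta> > 0" "\<And>h. norm h < \<delta> \<Longrightarrow>
     \<bar>u (q + h) - u q - (\<Sum>i\<in>UNIV. D i q * h $ i) - (\<Sum>i\<in>UNIV. \<Sum>j\<in>UNIV. E i j q * h $ i * h $ j) / 2\<bar> \<le> \<epsilon> * (norm h)\<^sup>2"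
proof -
  define \<epsilon>' where "\<epsilon>' = \<epsilon> / CARD('n)"
  have \<epsilon>': "\<epsilon>' > 0" using \<epsilon> by (simp add: \<epsilon>'_def)
  have "\<forall>\<^sub>F x in nhds q. norm (D i x - D i q - (\<Sum>j\<in>UNIV. E i j q * (x - q) $ j)) \<le> \<epsilon>' * norm (x - q)" for i
  proof -
    obtain d where d: "d > 0" "\<And>y. norm (y - q) < d \<Longrightarrow> norm (D i y - D i q - (\<Sum>j\<in>UNIV. E i j q * (y - q) $ j)) \<le> \<epsilon>' * norm (y - q)"
      using C1_partialsD(1)[OF D U(2), of i] \<epsilon>' unfolding has_derivative_at_alt by metis
    show ?thesis unfolding eventually_nhds_metric
      by (rule exI[of _ d]) (use d in \<open>auto simp: dist_norm\<close>)
  qed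
  then have "\<forall>\<^sub>F x in nhds q. \<forall>i\<in>UNIV. norm (D i x - D i q - (\<Sum>j\<in>UNIV. E i j q * (x - q) $ j)) \<le> \<epsilon>' * norm (x - q)"
    by (intro eventually_ball_finite) auto
  moreover have "\<forall>\<^sub>F x in nhds q. x \<in> U" using U eventually_nhds by blast
  ultimately have "\<forall>\<^sub>F x in nhds q. x \<in> U \<and> (\<forall>i. norm (D i x - D i q - (\<Sum>j\<in>UNIV. E i j q * (x - q) $ j)) \<le> \<epsilon>' * norm (x - q))"
    by eventually_elim auto
  then obtain \<delta> where \<delta>: "\<delta> > 0" "\<And>x. dist x q < \<delta> \<Longrightarrow> x \<in> U"
    "\<And>x i. dist x q < \<delta> \<Longrightarrow> norm (D i x - D i q - (\<Sum>j\<in>UNIV. E i j q * (x - q) $ j)) \<le> \<epsilon>' * norm (x - q)"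
    unfolding eventually_nhds_metric by auto
  show ?thesis
  proof (rule that[OF \<delta>(1)])
    fix h :: "real^'n" assume h: "norm h < \<delta>"
    define \<rho> where "\<rho> t = u (q + t *\<^sub>R h) - t * (\<Sum>i\<in>UNIV. D i q * h $ i)
        - t\<^sup>2 / 2 * (\<Sum>i\<in>UNIV. \<Sum>j\<in>UNIV. E i j q * h $ i * h $ j)" for t
    define \<rho>' where "\<rho>' t = (\<Sum>i\<in>UNIV. D i (q + t *\<^sub>R h) * h $ i) - (\<Sum>i\<in>UNIV. D i q * h $ i)
        - t * (\<Sum>i\<in>UNIV. \<Sum>j\<in>UNIV. E i j q * h $ i * h $ j)" for t
    have near: "dist (q + t *\<^sub>R h) q < \<delta>" if "t \<in> {0..1}" for t
      using that h mult_right_mono[of t 1 "norm h"] by (simp add: dist_norm)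
    have der: "(\<rho> has_real_derivative \<rho>' t) (at t within {0..1})" if t: "t \<in> {0..1}" for t
    proof -
      have 1: "((\<lambda>t. q + t *\<^sub>R h) has_derivative (\<lambda>s. s *\<^sub>R h)) (at t)"
        by (auto intro!: derivative_eq_intros)
      have "((\<lambda>t. u (q + t *\<^sub>R h)) has_derivative (\<lambda>s. \<Sum>i\<in>UNIV. D i (q + t *\<^sub>R h) * (s *\<^sub>R h) $ i)) (at t)"
        by (rule has_derivative_compose[OF 1 C1_partialsD(1)[OF u \<delta>(2)[OF near[OF t]]]])
      moreover have "(\<lambda>s. \<Sum>i\<in>UNIV. D i (q + t *\<^sub>R h) * (s *\<^sub>R h) $ i) = (*) (\<Sum>i\<in>UNIV. D i (q + t *\<^sub>R h) * h $ i)"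
        by (simp add: fun_eq_iff sum_distrib_left algebra_simps)
      ultimately have "((\<lambda>t. u (q + t *\<^sub>R h)) has_real_derivative (\<Sum>i\<in>UNIV. D i (q + t *\<^sub>R h) * h $ i)) (at t)"
        by (simp add: has_field_derivative_def)
      then have "(\<rho> has_real_derivative \<rho>' t) (at t)"
        unfolding \<rho>_def \<rho>'_def by (auto intro!: derivative_eq_intros)
      then show ?thesis by (rule has_field_derivative_at_within)
    qed
    have bd: "norm (\<rho>' t) \<le> \<epsilon> * (norm h)\<^sup>2" if t: "t \<in> {0..1}" for t
    proof -
      let ?d = "\<lambda>i. D i (q + t *\<^sub>R h) - D i q - (\<Sum>j\<in>UNIV. E i j q * (t *\<^sub>R h) $ j)"
      have "\<rho>' t = (\<Sum>i\<in>UNIV. ?d i * h $ i)"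
        unfolding \<rho>'_def by (simp add: left_diff_distrib sum_subtractf sum.distrib sum_distrib_left sum_distrib_right algebra_simps)
      also have "norm \<dots> \<le> (\<Sum>i\<in>(UNIV::'n set). \<epsilon>' * norm h * norm h)"
      proof (rule sum_norm_le)
        fix i :: 'n
        have "norm (?d i) \<le> \<epsilon>' * norm (t *\<^sub>R h)" using \<delta>(3)[OF near[OF t], of i] by simp
        also have "\<dots> \<le> \<epsilon>' * norm h" using t \<epsilon>' mult_right_mono[of t 1 "norm h"] by simp
        finally show "norm (?d i * h $ i) \<le> \<epsilon>' * norm h * norm h"
          unfolding norm_mult using component_le_norm_cart[of h i] \<epsilon>' by (intro mult_mono) auto
      qed
      also have "\<dots> = \<epsilon> * (norm h)\<^sup>2" by (simp add: \<epsilon>'_def power2_eq_square)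
      finally show ?thesis .
    qed
    have "norm (\<rho> 1 - \<rho> 0) \<le> \<epsilon> * (norm h)\<^sup>2 * norm (1 - 0 :: real)"
      by (rule field_differentiable_bound[of "{0..1}" \<rho> \<rho>']) (use der bd in auto)
    then show "\<bar>u (q + h) - u q - (\<Sum>i\<in>UNIV. D i q * h $ i) - (\<Sum>i\<in>UNIV. \<Sum>j\<in>UNIV. E i j q * h $ i * h $ j) / 2\<bar> \<le> \<epsilon> * (norm h)\<^sup>2"
      by (simp add: \<rho>_def algebra_simps)
  qed
qed

text \<open>Since \<open>v\<close> kills the linear part, a displacement of order \<open>t^2\<close>
  along \<open>e\<close> contributes at the same order as the Hessian on \<open>v\<close>; the
  remaining quadratic terms carry an extra factor \<open>t\<close>.\<close>

lemma second_order_expansion: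
  fixes u :: "real ^ 'n::finite \<Rightarrow> real"
  assumes U: "open U" "q \<in> U" and u: "C1_partials U u D" and D: "\<And>i. C1_partials U (D i) (E i)"
    and q: "u q = 0" and v: "(\<Sum>i\<in>UNIV. D i q * v $ i) = 0" and R: "R > 0" "\<epsilon> > 0"
  shows "\<forall>\<^sub>F t in at_right (0::real). \<forall>\<theta>. \<bar>\<theta>\<bar> \<le> R \<longrightarrow>
          \<bar>u (q + t *\<^sub>R v + (t ^ 2 * \<theta>) *\<^sub>R e) - t ^ 2 * ((\<Sum>i\<in>UNIV. \<Sum>j\<in>UNIV. E i j q * v $ i * v $ j) / 2
            + (\<Sum>i\<in>UNIV. D i q * e $ i) * \<theta>)\<bar> \<le> \<epsilon> * t ^ 2"
proof -
  define L where "L h = (\<Sum>i\<in>UNIV. D i q * h $ i)" for h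
  define B where "B x y = (\<Sum>i\<in>UNIV. \<Sum>j\<in>UNIV. E i j q * x $ i * y $ j)" for x y
  have L: "L (s *\<^sub>R x + t *\<^sub>R y) = s * L x + t * L y" for s t x y
    by (simp add: L_def sum.distrib sum_distrib_left algebra_simps)
  have B1: "B (s *\<^sub>R x + t *\<^sub>R y) z = s * B x z + t * B y z" for s t x y z
    by (simp add: B_def sum.distrib sum_distrib_left algebra_simps)
  have B2: "B z (s *\<^sub>R x + t *\<^sub>R y) = s * B z x + t * B z y" for s t x y z
    by (simp add: B_def sum.distrib sum_distrib_left algebra_simps)
  define C where "C = norm v + R * norm e + 1"
  have C: "C > 0" using R by (simp add: C_def add_nonneg_pos)
  define K where "K = R * (\<bar>B v e\<bar> + \<bar>B e v\<bar>) + R\<^sup>2 * \<bar>B e e\<bar> + 1"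
  have K: "K > 0" using R by (simp add: K_def add_nonneg_pos)
  have \<epsilon>1: "\<epsilon> / (2 * C\<^sup>2) > 0" using R C by simp
  obtain \<delta> where \<delta>0: "\<delta> > 0" "\<And>h. norm h < \<delta> \<Longrightarrow>
     \<bar>u (q + h) - u q - (\<Sum>i\<in>UNIV. D i q * h $ i) - (\<Sum>i\<in>UNIV. \<Sum>j\<in>UNIV. E i j q * h $ i * h $ j) / 2\<bar>
       \<le> \<epsilon> / (2 * C\<^sup>2) * (norm h)\<^sup>2"
    by (rule taylor_peano_second_order[OF U u D \<epsilon>1]) (rule that)
  note \<delta> = \<delta>0(1) \<delta>0(2)[folded L_def B_def]
  \<comment> \<open>\<open>\<delta> / C\<close> keeps the displacement in the range of the Taylor
    estimate, \<open>\<epsilon> / K\<close> makes the mixed quadratic terms at most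
    \<open>\<epsilon> t^2\<close> before halving, and \<open>1\<close> allows
    \<open>t^2 \<le> t\<close>.\<close>
  define \<tau> where "\<tau> = min 1 (min (\<delta> / C) (\<epsilon> / K))"
  have \<tau>: "\<tau> > 0" using \<delta> C R K by (simp add: \<tau>_def)
  have "\<forall>\<^sub>F t in at_right (0::real). t < \<tau>"
    using \<tau> by (intro eventually_at_right_field[THEN iffD2] exI[of _ \<tau>]) auto
  moreover have "\<forall>\<^sub>F t in at_right (0::real). t > 0" by (simp add: eventually_at_right_less)
  ultimately show ?thesis
  proof eventually_elim
    case (elim t)
    then have t: "0 < t" "t < 1" "t < \<delta> / C" "t < \<epsilon> / K" by (auto simp: \<tau>_def)
    show ?case
    proof (intro allI impI)
      fix \<theta> assume \<theta>: "\<bar>\<theta>\<bar> \<le> R"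
      define h where "h = t *\<^sub>R v + (t ^ 2 * \<theta>) *\<^sub>R e"
      have "norm h \<le> t * norm v + t ^ 2 * \<bar>\<theta>\<bar> * norm e"
        unfolding h_def using norm_triangle_ineq[of "t *\<^sub>R v" "(t ^ 2 * \<theta>) *\<^sub>R e"] t by (simp add: abs_mult)
      also have "\<dots> \<le> t * norm v + t * R * norm e"
        using t \<theta> by (intro add_left_mono mult_right_mono mult_mono) (auto simp: power2_eq_square)
      also have "\<dots> \<le> t * C" using t by (simp add: C_def algebra_simps)
      finally have h: "norm h \<le> t * C" .
      then have "norm h < \<delta>" using t C by (simp add: field_simps)
      then have "\<bar>u (q + h) - u q - L h - B h h / 2\<bar> \<le> \<epsilon> / (2 * C\<^sup>2) * (norm h)\<^sup>2" by (rule \<delta>(2))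
      also have "\<dots> \<le> \<epsilon> / (2 * C\<^sup>2) * (t * C)\<^sup>2"
        using h \<epsilon>1 by (intro mult_left_mono power_mono) auto
      also have "\<dots> = \<epsilon> / 2 * t ^ 2" using C by (simp add: power_mult_distrib)
      finally have rem: "\<bar>u (q + h) - u q - L h - B h h / 2\<bar> \<le> \<epsilon> / 2 * t ^ 2" .
      have Lh: "L h = t ^ 2 * \<theta> * L e" using v by (simp add: h_def L L_def[symmetric])
      define k where "k = \<theta> * (B v e + B e v) + t * (\<theta>\<^sup>2 * B e e)"
      have Bh: "B h h = t ^ 2 * B v v + t ^ 2 * (t * k)"
        by (simp add: h_def B1 B2 k_def power2_eq_square algebra_simps)
      have "\<bar>k\<bar> \<le> \<bar>\<theta>\<bar> * (\<bar>B v e\<bar> + \<bar>B e v\<bar>) + t * (\<theta>\<^sup>2 * \<bar>B e e\<bar>)"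
        unfolding k_def using t
        by (intro order_trans[OF abs_triangle_ineq] add_mono) (auto simp: abs_mult intro!: mult_left_mono)
      also have "\<dots> \<le> R * (\<bar>B v e\<bar> + \<bar>B e v\<bar>) + 1 * (R\<^sup>2 * \<bar>B e e\<bar>)"
        using t \<theta> R by (intro add_mono mult_mono) (auto simp: abs_le_square_iff[symmetric])
      also have "\<dots> \<le> K" by (simp add: K_def)
      finally have "t * \<bar>k\<bar> \<le> \<epsilon>" using t K by (smt (verit) mult_left_mono pos_less_divide_eq)
      then have k: "t ^ 2 * (t * \<bar>k\<bar>) \<le> t ^ 2 * \<epsilon>" by (intro mult_left_mono) auto
      have "u (q + h) - t ^ 2 * (B v v / 2 + L e * \<theta>) = (u (q + h) - u q - L h - B h h / 2) + t ^ 2 * (t * k) / 2"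
        by (simp add: Lh Bh q algebra_simps add_divide_distrib)
      also have "\<bar>\<dots>\<bar> \<le> \<epsilon> / 2 * t ^ 2 + t ^ 2 * (t * \<bar>k\<bar>) / 2"
        using t by (intro order_trans[OF abs_triangle_ineq] add_mono rem) (simp add: abs_mult)
      also have "\<dots> \<le> \<epsilon> * t ^ 2" using k by (simp add: algebra_simps)
      finally show "\<bar>u (q + t *\<^sub>R v + (t ^ 2 * \<theta>) *\<^sub>R e) - t ^ 2 * ((\<Sum>i\<in>UNIV. \<Sum>j\<in>UNIV. E i j q * v $ i * v $ j) / 2
            + (\<Sum>i\<in>UNIV. D i q * e $ i) * \<theta>)\<bar> \<le> \<epsilon> * t ^ 2"
        by (simp add: h_def B_def L_def add.assoc)
    qed
  qed
qed

section \<open>Comparison of two C^2 defining functions\<close>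

abbreviation partial :: "(real ^ 'n \<Rightarrow> real) \<Rightarrow> 'n \<Rightarrow> real ^ 'n \<Rightarrow> real" where
  "partial f i x \<equiv> frechet_derivative f (at x) (axis i 1)"

lemma linear_eq_sum_axis:
  fixes f :: "real ^ 'n \<Rightarrow> real"
  assumes "linear f"
  shows "f h = (\<Sum>i\<in>UNIV. f (axis i 1) * h $ i)"
proof -
  have "h = (\<Sum>j\<in>UNIV. h $ j *\<^sub>R axis j 1)"
    by (simp add: vec_eq_iff axis_def if_distrib cong: if_cong)
  then have "f h = f (\<Sum>j\<in>UNIV. h $ j *\<^sub>R axis j 1)" by simp
  also have "\<dots> = (\<Sum>j\<in>UNIV. h $ j *\<^sub>R f (axis j 1))"
    by (simp add: linear_sum[OF assms] linear_scale[OF assms])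
  finally show ?thesis by (simp add: mult.commute)
qed

lemma frechet_eq_partials:
  assumes "f differentiable (at x)"
  shows "frechet_derivative f (at x) h = (\<Sum>i\<in>UNIV. partial f i x * h $ i)"
  by (rule linear_eq_sum_axis[OF linear_frechet_derivative[OF assms]])

lemma has_derivative_partials:
  assumes "f differentiable (at x)"
  shows "(f has_derivative (\<lambda>h. \<Sum>i\<in>UNIV. partial f i x * h $ i)) (at x)"
proof -
  have "(f has_derivative frechet_derivative f (at x)) (at x)"
    using assms frechet_derivative_works by blast
  then show ?thesis by (rule has_derivative_eq_rhs) (rule ext, rule frechet_eq_partials[OF assms])
qed

lemma Ck_on_2_partials:
  assumes "Ck_on 2 U u"
  shows "C1_partials U u (partial u)" "C1_partials U (partial u i) (partial (partial u i))"
proof -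
  have 1: "\<And>x. x \<in> U \<Longrightarrow> u differentiable (at x)"
    and 2: "\<And>i x. x \<in> U \<Longrightarrow> partial u i differentiable (at x)"
    and 3: "\<And>i j. continuous_on U (partial (partial u i) j)"
    using assms by (auto simp: numeral_2_eq_2)
  show "C1_partials U (partial u i) (partial (partial u i))"
    by (intro C1_partialsI has_derivative_partials 2 3)
  have "continuous_on U (partial u i)" for i
    by (intro continuous_at_imp_continuous_on ballI differentiable_imp_continuous_within 2)
  then show "C1_partials U u (partial u)"
    by (intro C1_partialsI has_derivative_partials 1)
qed

lemma local_defining_function_transfer:
  "local_defining_function S p U u \<Longrightarrow> q \<in> U \<Longrightarrow> local_defining_function S q U u"
  by (auto simp: local_defining_function_def)

lemma local_defining_functionD:
  assumes "local_defining_function S p U u"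
  shows "open U" "p \<in> U" "Ck_on 2 U u" "S \<inter> U = {q \<in> U. u q = 0}"
    "\<And>q. q \<in> U \<Longrightarrow> u differentiable (at q)"
    "\<And>q. q \<in> S \<Longrightarrow> q \<in> U \<Longrightarrow> \<exists>e. frechet_derivative u (at q) e = 1"
proof -
  show 1: "open U" "p \<in> U" "Ck_on 2 U u" "S \<inter> U = {q \<in> U. u q = 0}"
    using assms by (auto simp: local_defining_function_def)
  show d: "\<And>q. q \<in> U \<Longrightarrow> u differentiable (at q)"
    using 1(3) by (simp add: numeral_2_eq_2)
  show "\<exists>e. frechet_derivative u (at q) e = 1" if q: "q \<in> S" "q \<in> U" for q
  proof -
    have "frechet_derivative u (at q) \<noteq> (\<lambda>_. 0)"
      using assms q by (auto simp: local_defining_function_def)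
    then obtain e where "frechet_derivative u (at q) e \<noteq> 0" by auto
    then have "frechet_derivative u (at q) ((1 / frechet_derivative u (at q) e) *\<^sub>R e) = 1"
      by (simp add: linear_scale[OF linear_frechet_derivative[OF d[OF q(2)]]])
    then show ?thesis by blast
  qed
qed

text \<open>The scalar plays the role of the smooth factor \<open>u' / u\<close> at \<open>q\<close>.\<close>

lemma defining_functions_second_order:
  assumes q: "q \<in> S" and ldf: "local_defining_function S q U u" and ldf': "local_defining_function S q U' u'"
  obtains m where "m \<noteq> 0" "\<And>h. frechet_derivative u' (at q) h = m * frechet_derivative u (at q) h"
    "\<And>v. frechet_derivative u (at q) v = 0 \<Longrightarrow>
      (\<Sum>i\<in>UNIV. \<Sum>j\<in>UNIV. partial (partial u' i) j q * v $ i * v $ j)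
      = m * (\<Sum>i\<in>UNIV. \<Sum>j\<in>UNIV. partial (partial u i) j q * v $ i * v $ j)"
proof -
  note U = local_defining_functionD[OF ldf] and U' = local_defining_functionD[OF ldf']
  obtain e where e: "frechet_derivative u (at q) e = 1" using U(6)[OF q U(2)] by blast
  obtain e' where e': "frechet_derivative u' (at q) e' = 1" using U'(6)[OF q U'(2)] by blast
  define m where "m = frechet_derivative u' (at q) e"
  have N: "open (U \<inter> U')" "q \<in> U \<inter> U'" using U U' by auto
  have uq: "u q = 0" "u' q = 0" using U(2,4) U'(2,4) q by blast+
  have cont: "continuous_on (U \<inter> U') u"
    by (rule continuous_on_subset[OF C1_partials_continuous[OF Ck_on_2_partials(1)[OF U(3)]]]) simp
  have zero: "u' x = 0" if "x \<in> U \<inter> U'" "u x = 0" for x using U(4) U'(4) that by blast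
  have der: "(u has_derivative frechet_derivative u (at q)) (at q)" "(u' has_derivative frechet_derivative u' (at q)) (at q)"
    using U(5)[OF U(2)] U'(5)[OF U'(2)] frechet_derivative_works by blast+
  have ker: "frechet_derivative u' (at q) v = 0" if v: "frechet_derivative u (at q) v = 0" for v
  proof -
    have "frechet_derivative u' (at q) v = m * 0"
    proof (rule zero_set_expansion[OF N _ cont zero, where n=1 and v=v and e=e])
      show "\<forall>\<^sub>F t in at_right (0::real). \<forall>\<theta>. \<bar>\<theta>\<bar> \<le> R \<longrightarrow>
          \<bar>u (q + t *\<^sub>R v + (t ^ 1 * \<theta>) *\<^sub>R e) - t ^ 1 * (0 + \<theta>)\<bar> \<le> \<epsilon> * t ^ 1" if "R > 0" "\<epsilon> > 0" for R \<epsilon>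
        using first_order_expansion[OF der(1) uq(1) that, of v e] by (simp add: v e)
      show "\<forall>\<^sub>F t in at_right (0::real). \<forall>\<theta>. \<bar>\<theta>\<bar> \<le> R \<longrightarrow>
          \<bar>u' (q + t *\<^sub>R v + (t ^ 1 * \<theta>) *\<^sub>R e) - t ^ 1 * (frechet_derivative u' (at q) v + m * \<theta>)\<bar> \<le> \<epsilon> * t ^ 1" if "R > 0" "\<epsilon> > 0" for R \<epsilon>
        using first_order_expansion[OF der(2) uq(2) that, of v e] by (simp add: m_def)
    qed auto
    then show ?thesis by simp
  qed
  have lin: "linear (frechet_derivative u (at q))" "linear (frechet_derivative u' (at q))"
    using U(5)[OF U(2)] U'(5)[OF U'(2)] by (auto intro: linear_frechet_derivative)
  have mult: "frechet_derivative u' (at q) h = m * frechet_derivative u (at q) h" for h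
  proof -
    \<comment> \<open>The differential of \<open>u\<close> is 1 on \<open>e\<close>, so subtracting
      this multiple of \<open>e\<close> lands in its kernel, and the factor of proportionality is
      the value of the differential of \<open>u'\<close> on \<open>e\<close>.\<close>
    let ?v = "h - frechet_derivative u (at q) h *\<^sub>R e"
    have "frechet_derivative u (at q) ?v = 0" by (simp add: linear_diff[OF lin(1)] linear_scale[OF lin(1)] e)
    from ker[OF this] show ?thesis by (simp add: linear_diff[OF lin(2)] linear_scale[OF lin(2)] m_def)
  qed
  show ?thesis
  proof (rule that[OF _ mult])
    show "m \<noteq> 0"
    proof
      assume "m = 0"
      then have "frechet_derivative u' (at q) e' = 0" by (subst mult) simp
      then show False using e' by simp
    qed
    fix v assume v: "frechet_derivative u (at q) v = 0"
    note C1 = Ck_on_2_partials[OF U(3)] and C1' = Ck_on_2_partials[OF U'(3)]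
    let ?Q = "\<Sum>i\<in>UNIV. \<Sum>j\<in>UNIV. partial (partial u i) j q * v $ i * v $ j"
    let ?Q' = "\<Sum>i\<in>UNIV. \<Sum>j\<in>UNIV. partial (partial u' i) j q * v $ i * v $ j"
    have v0: "(\<Sum>i\<in>UNIV. partial u i q * v $ i) = 0" "(\<Sum>i\<in>UNIV. partial u' i q * v $ i) = 0"
      using v ker[OF v] by (simp_all only: frechet_eq_partials[OF U(5)[OF U(2)], of v] frechet_eq_partials[OF U'(5)[OF U'(2)], of v])
    have e0: "(\<Sum>i\<in>UNIV. partial u i q * e $ i) = 1" "(\<Sum>i\<in>UNIV. partial u' i q * e $ i) = m"
      using e m_def by (simp_all only: frechet_eq_partials[OF U(5)[OF U(2)], of e] frechet_eq_partials[OF U'(5)[OF U'(2)], of e])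
    \<comment> \<open>To stay on the zero set, a tangential displacement \<open>t v\<close> needs
      the correction \<open>-?Q/2 * t^2\<close> along \<open>e\<close> to leading order. As
      \<open>u'\<close> vanishes at the same points, its own second-order term must balance this
      correction.\<close>
    have "?Q' / 2 = m * (?Q / 2)"
    proof (rule zero_set_expansion[OF N _ cont zero, where n=2 and v=v and e=e])
      show "\<forall>\<^sub>F t in at_right (0::real). \<forall>\<theta>. \<bar>\<theta>\<bar> \<le> R \<longrightarrow>
          \<bar>u (q + t *\<^sub>R v + (t ^ 2 * \<theta>) *\<^sub>R e) - t ^ 2 * (?Q / 2 + \<theta>)\<bar> \<le> \<epsilon> * t ^ 2" if "R > 0" "\<epsilon> > 0" for R \<epsilon>
        using second_order_expansion[OF U(1,2) C1(1) C1(2) uq(1) v0(1) that, of e] by (simp only: e0 mult_1)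
      show "\<forall>\<^sub>F t in at_right (0::real). \<forall>\<theta>. \<bar>\<theta>\<bar> \<le> R \<longrightarrow>
          \<bar>u' (q + t *\<^sub>R v + (t ^ 2 * \<theta>) *\<^sub>R e) - t ^ 2 * (?Q' / 2 + m * \<theta>)\<bar> \<le> \<epsilon> * t ^ 2" if "R > 0" "\<epsilon> > 0" for R \<epsilon>
        using second_order_expansion[OF U'(1,2) C1'(1) C1'(2) uq(2) v0(2) that, of e] by (simp only: e0)
    qed auto
    then show "?Q' = m * ?Q" by simp
  qed
qed

section \<open>Horizontal derivatives and the unit normal\<close>

text \<open>The offset \<open>c\<close> is \<open>0\<close> for the function itself and a coordinate of \<open>p\<close> for its complexification,
  whose variables are centred at \<open>p\<close>.\<close>

definition X_of :: "'a::real_normed_field \<Rightarrow> (3 \<Rightarrow> 'a^3 \<Rightarrow> 'a) \<Rightarrow> 'a^3 \<Rightarrow> 'a" where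
  "X_of c D x = D 1 x - (c + x $ 2) / 2 * D 3 x"

definition Y_of :: "'a::real_normed_field \<Rightarrow> (3 \<Rightarrow> 'a^3 \<Rightarrow> 'a) \<Rightarrow> 'a^3 \<Rightarrow> 'a" where
  "Y_of c D x = D 2 x + (c + x $ 1) / 2 * D 3 x"

definition X_of_partial :: "'a::real_normed_field \<Rightarrow> (3 \<Rightarrow> 'a^3 \<Rightarrow> 'a) \<Rightarrow> (3 \<Rightarrow> 3 \<Rightarrow> 'a^3 \<Rightarrow> 'a) \<Rightarrow> 3 \<Rightarrow> 'a^3 \<Rightarrow> 'a" where
  "X_of_partial c D E j x = E 1 j x - (c + x $ 2) / 2 * E 3 j x - (if j = 2 then D 3 x / 2 else 0)"

definition Y_of_partial :: "'a::real_normed_field \<Rightarrow> (3 \<Rightarrow> 'a^3 \<Rightarrow> 'a) \<Rightarrow> (3 \<Rightarrow> 3 \<Rightarrow> 'a^3 \<Rightarrow> 'a) \<Rightarrow> 3 \<Rightarrow> 'a^3 \<Rightarrow> 'a" where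
  "Y_of_partial c D E j x = E 2 j x + (c + x $ 1) / 2 * E 3 j x + (if j = 1 then D 3 x / 2 else 0)"

lemma C1_partials_affine_coord:
  fixes a b :: "'a::real_normed_field" and k :: "'n::finite"
  shows "C1_partials U (\<lambda>x. a + b * x $ k) (\<lambda>j x. if j = k then b else 0)"
proof -
  have eq: "(\<lambda>j x. 0 + (0 * (x::'a^'n) $ k + b * (if j = k then 1 else 0))) = (\<lambda>j x. if j = k then b else 0)"
    by (intro ext) simp
  show ?thesis
    using C1_partials_add[OF C1_partials_const[of U a] C1_partials_mult[OF C1_partials_const[of U b] C1_partials_coord[of U k]]]
    by (simp only: eq)
qed

lemma C1_partials_X_of:
  assumes D: "\<And>i. C1_partials U (D i) (E i)"
  shows "C1_partials U (X_of c D) (X_of_partial c D E)"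
proof -
  have f: "X_of c D = (\<lambda>x. D 1 x + (- c / 2 + (- 1 / 2) * x $ 2) * D 3 x)"
    by (rule ext) (simp add: X_of_def field_simps)
  have f': "X_of_partial c D E = (\<lambda>j x. E 1 j x + ((if j = 2 then - 1 / 2 else 0) * D 3 x + (- c / 2 + (- 1 / 2) * x $ 2) * E 3 j x))"
    by (intro ext) (simp add: X_of_partial_def field_simps)
  show ?thesis unfolding f f'
    by (rule C1_partials_add[OF D C1_partials_mult[OF C1_partials_affine_coord D]])
qed

lemma C1_partials_Y_of:
  assumes D: "\<And>i. C1_partials U (D i) (E i)"
  shows "C1_partials U (Y_of c D) (Y_of_partial c D E)"
proof -
  have f: "Y_of c D = (\<lambda>x. D 2 x + (c / 2 + (1 / 2) * x $ 1) * D 3 x)"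
    by (rule ext) (simp add: Y_of_def field_simps)
  have f': "Y_of_partial c D E = (\<lambda>j x. E 2 j x + ((if j = 1 then 1 / 2 else 0) * D 3 x + (c / 2 + (1 / 2) * x $ 1) * E 3 j x))"
    by (intro ext) (simp add: Y_of_partial_def field_simps)
  show ?thesis unfolding f f'
    by (rule C1_partials_add[OF D C1_partials_mult[OF C1_partials_affine_coord D]])
qed

lemma complexifies_X_of:
  assumes "\<And>i. complexifies r p (d i) (D i)"
  shows "complexifies r p (X_of 0 d) (X_of (of_real (p $ 2)) D)"
  using assms by (simp add: complexifies_def X_of_def)

lemma complexifies_Y_of:
  assumes "\<And>i. complexifies r p (d i) (D i)"
  shows "complexifies r p (Y_of 0 d) (Y_of (of_real (p $ 1)) D)"
  using assms by (simp add: complexifies_def Y_of_def)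

lemma frechet_derivative_heis:
  assumes "u differentiable (at q)"
  shows "frechet_derivative u (at q) (heis_X q) = X_of 0 (partial u) q"
    "frechet_derivative u (at q) (heis_Y q) = Y_of 0 (partial u) q"
proof -
  have "heis_X q $ 1 = 1" "heis_X q $ 2 = 0" "heis_X q $ 3 = - (q $ 2) / 2"
    "heis_Y q $ 1 = 0" "heis_Y q $ 2 = 1" "heis_Y q $ 3 = q $ 1 / 2"
    by (simp_all add: heis_X_def heis_Y_def vector_3)
  then show "frechet_derivative u (at q) (heis_X q) = X_of 0 (partial u) q"
    "frechet_derivative u (at q) (heis_Y q) = Y_of 0 (partial u) q"
    unfolding frechet_eq_partials[OF assms, of "heis_X q"] frechet_eq_partials[OF assms, of "heis_Y q"]
    by (simp_all add: sum_3 X_of_def Y_of_def)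
qed

lemma horizontal_gradient_norm_eq:
  assumes "u differentiable (at q)"
  shows "horizontal_gradient_norm u q = sqrt ((X_of 0 (partial u) q)\<^sup>2 + (Y_of 0 (partial u) q)\<^sup>2)"
  unfolding horizontal_gradient_norm_def frechet_derivative_heis[OF assms] ..

lemma heis_distr_eq_span: "v \<in> heis_distr q \<Longrightarrow> v = (v $ 1) *\<^sub>R heis_X q + (v $ 2) *\<^sub>R heis_Y q"
  by (simp add: heis_distr_def vec_eq_iff forall_3 heis_X_def heis_Y_def vector_3 field_simps)

lemma heis_in_distr: "heis_X q \<in> heis_distr q" "heis_Y q \<in> heis_distr q"
  by (simp_all add: heis_distr_def heis_X_def heis_Y_def vector_3)

text \<open>All differentials at \<open>q\<close> are proportional, which collapses the intersection
  over every defining function to one kernel.\<close>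

lemma tangent_space_eq_kernel:
  assumes q: "q \<in> S" and ldf: "local_defining_function S q U u"
  shows "tangent_space S q = {v. frechet_derivative u (at q) v = 0}"
proof (intro subset_antisym subsetI)
  fix v assume v: "v \<in> {v. frechet_derivative u (at q) v = 0}"
  show "v \<in> tangent_space S q"
    unfolding tangent_space_def
  proof (intro CollectI allI impI)
    fix U' u' assume ldf': "local_defining_function S q U' u'"
    obtain m where "\<And>h. frechet_derivative u' (at q) h = m * frechet_derivative u (at q) h"
      by (rule defining_functions_second_order[OF q ldf ldf']) (rule that)
    from this[of v] show "frechet_derivative u' (at q) v = 0" using v by simp
  qed
qed (use ldf in \<open>auto simp: tangent_space_def\<close>)

lemma characteristic_points_iff:
  assumes q: "q \<in> S" and ldf: "local_defining_function S q U u"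
  shows "q \<in> characteristic_points S \<longleftrightarrow> X_of 0 (partial u) q = 0 \<and> Y_of 0 (partial u) q = 0"
proof -
  have d: "u differentiable (at q)" using local_defining_functionD(2,5)[OF ldf] by blast
  note lin = linear_frechet_derivative[OF d]
  have "frechet_derivative u (at q) v = 0"
    if "frechet_derivative u (at q) (heis_X q) = 0" "frechet_derivative u (at q) (heis_Y q) = 0" "v \<in> heis_distr q" for v
    by (subst heis_distr_eq_span[OF that(3)]) (simp add: linear_add[OF lin] linear_scale[OF lin] that)
  then have "heis_distr q \<subseteq> tangent_space S q \<longleftrightarrow>
      frechet_derivative u (at q) (heis_X q) = 0 \<and> frechet_derivative u (at q) (heis_Y q) = 0"
    unfolding tangent_space_eq_kernel[OF q ldf] using heis_in_distr[of q] by auto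
  then show ?thesis using q unfolding characteristic_points_def frechet_derivative_heis[OF d] by simp
qed

section \<open>Bounds for the induced density\<close>

text \<open>\<open>unit_normal\<close> is a Hilbert choice, so a witness must be exhibited: the
  normalised gradient of \<open>u\<close> with respect to \<open>G q\<close>. It exists because
  \<open>T\<close>, which encodes the functional \<open>G q v\<close>, is injective by positivity
  and hence surjective.\<close>

lemma unit_normal_normalized:
  assumes q: "q \<in> S" and ldf: "local_defining_function S q U u" and G: "riemannian_metric G"
  shows "G q (unit_normal G S q) (unit_normal G S q) = 1"
proof -
  have bil: "bilinear (G q)" and sym: "\<And>v w. G q v w = G q w v" and pos: "\<And>v. v \<noteq> 0 \<Longrightarrow> G q v v > 0"
    using G unfolding riemannian_metric_def by auto
  have linl: "linear (\<lambda>v. G q v w)" for w using bil by (simp add: bilinear_def)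
  have linr: "linear (G q v)" for v using bil by (simp add: bilinear_def)
  define T where "T v = (\<chi> i. G q v (axis i 1))" for v
  have "linear T"
    unfolding T_def by (rule linearI) (simp_all add: vec_eq_iff linear_add[OF linl] linear_scale[OF linl])
  moreover have "inj T"
    unfolding linear_injective_0[OF \<open>linear T\<close>]
  proof (intro allI impI)
    fix v assume "T v = 0"
    then have z: "G q v (axis i 1) = 0" for i by (simp add: T_def vec_eq_iff)
    have "G q v v = 0" by (simp add: linear_eq_sum_axis[OF linr, of v v] z)
    then show "v = 0" using pos[of v] by fastforce
  qed
  ultimately have "surj T" using linear_injective_imp_surjective by blast
  then obtain n where n: "T n = (\<chi> i. partial u i q)" by (metis surjD)
  have d: "u differentiable (at q)" using local_defining_functionD(2,5)[OF ldf] by blast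
  have Gn: "G q n v = frechet_derivative u (at q) v" for v
    using n by (simp add: linear_eq_sum_axis[OF linr, of n v] frechet_eq_partials[OF d, of v] T_def vec_eq_iff)
  obtain e where "frechet_derivative u (at q) e = 1" using local_defining_functionD(6)[OF ldf q] local_defining_functionD(2)[OF ldf] by blast
  then have "n \<noteq> 0" using Gn[of e] linear_0[OF linl, of e] by auto
  define s where "s = 1 / sqrt (G q n n)"
  have "G q (s *\<^sub>R n) (s *\<^sub>R n) = s * s * G q n n"
    by (simp add: linear_scale[OF linl] linear_scale[OF linr])
  also have "\<dots> = 1" using pos[OF \<open>n \<noteq> 0\<close>] by (simp add: s_def)
  finally have 1: "G q (s *\<^sub>R n) (s *\<^sub>R n) = 1" .
  have 2: "G q (s *\<^sub>R n) v = 0" if "v \<in> tangent_space S q" for v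
    using that unfolding tangent_space_eq_kernel[OF q ldf] by (simp add: linear_scale[OF linl] Gn)
  show ?thesis
    unfolding unit_normal_def
    using someI[of "\<lambda>n. G q n n = 1 \<and> (\<forall>v \<in> tangent_space S q. G q n v = 0)" "s *\<^sub>R n"] 1 2 by blast
qed

text \<open>By homogeneity it suffices to minimise over \<open>cball p 1\<close> times the unit
  sphere. Continuity of \<open>G\<close> is given for fixed vectors, so joint continuity comes from
  expanding the form in the coordinate basis.\<close>

lemma riemannian_metric_locally_coercive:
  assumes G: "riemannian_metric G"
  obtains m where "m > 0" "\<And>q v. q \<in> cball p 1 \<Longrightarrow> m * (norm v)\<^sup>2 \<le> G q v v"
proof -
  have bil: "bilinear (G q)" and pos: "v \<noteq> 0 \<Longrightarrow> G q v v > 0" for q v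
    using G unfolding riemannian_metric_def by auto
  have "Ck_on 0 UNIV (\<lambda>q. G q v w)" for v w using G unfolding riemannian_metric_def by blast
  then have cont: "continuous_on UNIV (\<lambda>q. G q v w)" for v w by simp
  have linl: "linear (\<lambda>v. G q v w)" and linr: "linear (G q v)" for q v w using bil by (auto simp: bilinear_def)
  have eq: "G q v v = (\<Sum>i\<in>UNIV. (\<Sum>j\<in>UNIV. G q (axis j 1) (axis i 1) * v $ j) * v $ i)" for q v
  proof -
    have "G q v v = (\<Sum>i\<in>UNIV. G q v (axis i 1) * v $ i)" by (rule linear_eq_sum_axis[OF linr])
    also have "\<dots> = (\<Sum>i\<in>UNIV. (\<Sum>j\<in>UNIV. G q (axis j 1) (axis i 1) * v $ j) * v $ i)"
      by (rule sum.cong[OF refl], rule arg_cong[where f="\<lambda>s. s * _"], rule linear_eq_sum_axis[OF linl])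
    finally show ?thesis .
  qed
  let ?K = "cball p 1 \<times> sphere (0::real^3) 1"
  have cfst: "continuous_on ?K (\<lambda>z. G (fst z) v w)" for v w
    by (rule continuous_on_compose2[OF cont continuous_on_fst[OF continuous_on_id]]) auto
  have "continuous_on ?K (\<lambda>z. G (fst z) (snd z) (snd z))"
    unfolding eq by (intro continuous_intros cfst)
  moreover have "compact ?K" by (intro compact_Times) auto
  moreover have "(p, axis 1 1) \<in> ?K" by (simp add: norm_axis_1)
  ultimately obtain z where z: "z \<in> ?K" "\<And>y. y \<in> ?K \<Longrightarrow> G (fst z) (snd z) (snd z) \<le> G (fst y) (snd y) (snd y)"
    using continuous_attains_inf[of ?K "\<lambda>z. G (fst z) (snd z) (snd z)"] by blast
  show ?thesis
  proof (rule that[of "G (fst z) (snd z) (snd z)"])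
    show "G (fst z) (snd z) (snd z) > 0" using z(1) by (intro pos) auto
    fix q v assume q: "q \<in> cball p 1"
    show "G (fst z) (snd z) (snd z) * (norm v)\<^sup>2 \<le> G q v v"
    proof (cases "v = 0")
      case True then show ?thesis by (simp add: linear_0[OF linr])
    next
      case False
      define w where "w = (1 / norm v) *\<^sub>R v"
      have w: "norm w = 1" "v = norm v *\<^sub>R w" using False by (auto simp: w_def)
      have "G q v v = (norm v)\<^sup>2 * G q w w"
        by (subst w(2), subst w(2)) (simp add: linear_scale[OF linl] linear_scale[OF linr] power2_eq_square)
      moreover have "G (fst z) (snd z) (snd z) \<le> G q w w" using z(2)[of "(q, w)"] q w by simp
      from mult_left_mono[OF this, of "(norm v)\<^sup>2"]
      have "G (fst z) (snd z) (snd z) * (norm v)\<^sup>2 \<le> (norm v)\<^sup>2 * G q w w" by (simp add: mult.commute)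
      ultimately show ?thesis by simp
    qed
  qed
qed

text \<open>A crude form of Hadamard's inequality; 6 counts the terms of the Leibniz
  formula.\<close>

lemma abs_det_le:
  fixes a b c :: "real ^ 3"
  shows "\<bar>det (vector [a, b, c] :: real^3^3)\<bar> \<le> 6 * (norm a * norm b * norm c)"
proof -
  have t: "\<bar>a $ i * b $ j * c $ k\<bar> \<le> norm a * norm b * norm c" for i j k
    unfolding abs_mult by (intro mult_mono component_le_norm_cart) auto
  have "det (vector [a, b, c] :: real^3^3) = a $ 1 * b $ 2 * c $ 3 + a $ 2 * b $ 3 * c $ 1 + a $ 3 * b $ 1 * c $ 2
     - a $ 1 * b $ 3 * c $ 2 - a $ 2 * b $ 1 * c $ 3 - a $ 3 * b $ 2 * c $ 1"
    by (simp add: det_3 vector_3)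
  then show ?thesis
    using t[of 1 2 3] t[of 2 3 1] t[of 3 1 2] t[of 1 3 2] t[of 2 1 3] t[of 3 2 1] by linarith
qed

text \<open>The unit normal has length 1 for \<open>G\<close>, hence Euclidean length at most
  \<open>1 / sqrt m\<close> by coercivity.\<close>

lemma induced_density_bounded:
  assumes G: "riemannian_metric G" and ldf: "local_defining_function S p U u"
  obtains C where "C \<ge> 0"
    "\<And>q v w M. q \<in> S \<Longrightarrow> q \<in> U \<Longrightarrow> q \<in> cball p 1 \<Longrightarrow> norm v \<le> M \<Longrightarrow> norm w \<le> M \<Longrightarrow> induced_density G S q v w \<le> C * M\<^sup>2"
proof -
  obtain m where m: "m > 0" "\<And>q v. q \<in> cball p 1 \<Longrightarrow> m * (norm v)\<^sup>2 \<le> G q v v"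
    using riemannian_metric_locally_coercive[OF G] by blast
  define C where "C = 1 / sqrt m"
  have nb: "norm (unit_normal G S q) \<le> C" if "q \<in> S" "q \<in> U" "q \<in> cball p 1" for q
  proof -
    have "m * (norm (unit_normal G S q))\<^sup>2 \<le> 1"
      using m(2)[OF that(3)] unit_normal_normalized[OF that(1) local_defining_function_transfer[OF ldf that(2)] G] by metis
    then have "(norm (unit_normal G S q))\<^sup>2 \<le> 1 / m" using m by (simp add: field_simps)
    then have "norm (unit_normal G S q) \<le> sqrt (1 / m)" by (rule real_le_rsqrt)
    then show ?thesis by (simp add: C_def real_sqrt_divide)
  qed
  have C: "C \<ge> 0" using m by (simp add: C_def)
  show ?thesis
  proof (rule that[of "6 * C"])
    fix q v w :: "real^3" and M assume q: "q \<in> S" "q \<in> U" "q \<in> cball p 1" and vw: "norm v \<le> M" "norm w \<le> (M::real)"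
    have M: "M \<ge> 0" using vw(1) norm_ge_zero order_trans by blast
    have "induced_density G S q v w \<le> 6 * (norm (unit_normal G S q) * norm v * norm w)"
      unfolding induced_density_def by (rule abs_det_le)
    also have "\<dots> \<le> 6 * (C * M * M)"
      using nb[OF q] vw C M by (intro mult_left_mono mult_mono) auto
    finally show "induced_density G S q v w \<le> 6 * C * M\<^sup>2" by (simp add: power2_eq_square mult.assoc)
  qed (use C in simp)
qed

section \<open>The horizontal mean curvature\<close>

definition hessian_form :: "(real^3 \<Rightarrow> real) \<Rightarrow> real^3 \<Rightarrow> real^3 \<Rightarrow> real" where
  "hessian_form u q v = (\<Sum>i\<in>UNIV. \<Sum>j\<in>UNIV. partial (partial u i) j q * v $ i * v $ j)"

text \<open>The horizontal gradient turned by a right angle in the frame \<open>X\<close>,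
  \<open>Y\<close>: it is tangent to the level set of \<open>u\<close> and has sub-Riemannian length
  \<open>W\<close>.\<close>

definition horizontal_tangent :: "(real^3 \<Rightarrow> real) \<Rightarrow> real^3 \<Rightarrow> real^3" where
  "horizontal_tangent u q = Y_of 0 (partial u) q *\<^sub>R heis_X q - X_of 0 (partial u) q *\<^sub>R heis_Y q"

lemma heis_nth [simp]:
  "heis_X q $ 1 = 1" "heis_X q $ 2 = 0" "heis_X q $ 3 = - (q $ 2) / 2"
  "heis_Y q $ 1 = 0" "heis_Y q $ 2 = 1" "heis_Y q $ 3 = q $ 1 / 2"
  by (simp_all add: heis_X_def heis_Y_def vector_3)

lemma has_derivative_inverse_norm:
  fixes f g :: "'a::real_normed_vector \<Rightarrow> real"
  assumes f: "(f has_derivative f') (at q)" and g: "(g has_derivative g') (at q)" and nz: "f q \<noteq> 0 \<or> g q \<noteq> 0"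
  shows "((\<lambda>x. inverse (sqrt ((f x)\<^sup>2 + (g x)\<^sup>2))) has_derivative
     (\<lambda>h. - (f q * f' h + g q * g' h) / (sqrt ((f q)\<^sup>2 + (g q)\<^sup>2)) ^ 3)) (at q)"
proof -
  let ?s = "(f q)\<^sup>2 + (g q)\<^sup>2"
  have s: "?s > 0" using nz by (simp add: sum_power2_gt_zero_iff)
  have "((\<lambda>t. inverse (sqrt t)) has_real_derivative - (1 / (2 * (sqrt ?s) ^ 3))) (at ?s)"
  proof -
    have "((\<lambda>t. inverse (sqrt t)) has_real_derivative - (inverse (sqrt ?s) * (inverse (sqrt ?s) / 2) * inverse (sqrt ?s))) (at ?s)"
      by (rule DERIV_inverse'[OF DERIV_real_sqrt]) (use s in auto)
    moreover have "inverse r * (inverse r / 2) * inverse r = 1 / (2 * r ^ 3)" for r :: real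
      by (simp add: power3_eq_cube field_simps)
    ultimately show ?thesis by (simp only:)
  qed
  moreover have "((\<lambda>x. (f x)\<^sup>2 + (g x)\<^sup>2) has_derivative (\<lambda>h. 2 * (f q * f' h) + 2 * (g q * g' h))) (at q)"
    by (rule has_derivative_eq_rhs[OF has_derivative_add[OF has_derivative_power[OF f, of 2] has_derivative_power[OF g, of 2]]])
       (simp add: fun_eq_iff)
  ultimately have "((\<lambda>x. inverse (sqrt ((f x)\<^sup>2 + (g x)\<^sup>2))) has_derivative
      (\<lambda>h. (2 * (f q * f' h) + 2 * (g q * g' h)) * - (1 / (2 * (sqrt ?s) ^ 3)))) (at q)"
    by (rule DERIV_compose_FDERIV)
  then show ?thesis by (rule has_derivative_eq_rhs) (simp add: fun_eq_iff add_divide_distrib diff_divide_distrib)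
qed

text \<open>In the frame, the divergence is
  \<open>(Xa + Yb)/w - (a^2 Xa + a b (Xb + Ya) + b^2 Yb)/w^3\<close>, which equals
  \<open>(b^2 Xa - a b (Xb + Ya) + a^2 Yb)/w^3\<close>. The first-order terms
  \<open>partial u 3 q / 2\<close> produced by the coefficients of \<open>X\<close> and
  \<open>Y\<close> occur only in \<open>Xb\<close> and \<open>Ya\<close>, with opposite signs, so
  they cancel and only the Hessian of \<open>u\<close> remains.\<close>

lemma divergence_normalized_gradient:
  assumes U: "open U" "q \<in> U" and u: "Ck_on 2 U u"
    and nz: "X_of 0 (partial u) q \<noteq> 0 \<or> Y_of 0 (partial u) q \<noteq> 0"
  shows "divergence (\<lambda>x. horizontal_gradient u x /\<^sub>R horizontal_gradient_norm u x) q
    = hessian_form u q (horizontal_tangent u q) / (horizontal_gradient_norm u q) ^ 3"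
proof -
  define a where "a = X_of 0 (partial u)"
  define b where "b = Y_of 0 (partial u)"
  define a' where "a' j = X_of_partial 0 (partial u) (\<lambda>i. partial (partial u i)) j q" for j
  define b' where "b' j = Y_of_partial 0 (partial u) (\<lambda>i. partial (partial u i)) j q" for j
  have diff: "u differentiable (at x)" if "x \<in> U" for x using u that by (simp add: numeral_2_eq_2)
  have da: "(a has_derivative (\<lambda>h. \<Sum>j\<in>UNIV. a' j * h $ j)) (at q)"
    unfolding a_def a'_def by (rule C1_partialsD(1)[OF C1_partials_X_of[OF Ck_on_2_partials(2)[OF u]] U(2)])
  have db: "(b has_derivative (\<lambda>h. \<Sum>j\<in>UNIV. b' j * h $ j)) (at q)"
    unfolding b_def b'_def by (rule C1_partialsD(1)[OF C1_partials_Y_of[OF Ck_on_2_partials(2)[OF u]] U(2)])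
  define w where "w = sqrt ((a q)\<^sup>2 + (b q)\<^sup>2)"
  have w2: "w ^ 2 = (a q)\<^sup>2 + (b q)\<^sup>2" by (simp add: w_def)
  have w: "w > 0" using nz by (simp add: w_def a_def b_def sum_power2_gt_zero_iff)
  define N where "N x = inverse (sqrt ((a x)\<^sup>2 + (b x)\<^sup>2))" for x
  define N' where "N' h = - (a q * (\<Sum>j\<in>UNIV. a' j * h $ j) + b q * (\<Sum>j\<in>UNIV. b' j * h $ j)) / w ^ 3" for h :: "real^3"
  have dN: "(N has_derivative N') (at q)"
    unfolding N_def N'_def w_def by (rule has_derivative_inverse_norm[OF da db]) (use nz in \<open>simp add: a_def b_def\<close>)
  define V where "V i x = (if i = 1 then a x * N x else if i = 2 then b x * N x else (x $ 1 / 2 * b x - x $ 2 / 2 * a x) * N x)" for i :: 3 and x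
  define A where "A h = (\<Sum>j\<in>UNIV. a' j * h $ j)" for h :: "real^3"
  define B where "B h = (\<Sum>j\<in>UNIV. b' j * h $ j)" for h :: "real^3"
  define V' where "V' i h = (if i = 1 then a q * N' h + A h * N q else if i = 2 then b q * N' h + B h * N q
     else (q $ 1 / 2 * b q - q $ 2 / 2 * a q) * N' h
       + (q $ 1 / 2 * B h + h $ 1 / 2 * b q - (q $ 2 / 2 * A h + h $ 2 / 2 * a q)) * N q)" for i :: 3 and h
  have coord: "((\<lambda>x. x $ k / 2) has_derivative (\<lambda>h. h $ k / 2)) (at q)" for k :: 3
    using bounded_linear_imp_has_derivative[OF bounded_linear_compose[OF bounded_linear_divide bounded_linear_vec_nth[of k]], of 2 "at q"]
    by simp
  have dV: "(V i has_derivative V' i) (at q)" for i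
  proof -
    have 1: "((\<lambda>x. a x * N x) has_derivative (\<lambda>h. a q * N' h + A h * N q)) (at q)"
      unfolding A_def by (rule has_derivative_mult[OF da dN])
    have 2: "((\<lambda>x. b x * N x) has_derivative (\<lambda>h. b q * N' h + B h * N q)) (at q)"
      unfolding B_def by (rule has_derivative_mult[OF db dN])
    have 3: "((\<lambda>x. (x $ 1 / 2 * b x - x $ 2 / 2 * a x) * N x) has_derivative
      (\<lambda>h. (q $ 1 / 2 * b q - q $ 2 / 2 * a q) * N' h
       + (q $ 1 / 2 * B h + h $ 1 / 2 * b q - (q $ 2 / 2 * A h + h $ 2 / 2 * a q)) * N q)) (at q)"
      unfolding A_def B_def
      by (rule has_derivative_mult[OF has_derivative_diff[OF has_derivative_mult[OF coord db] has_derivative_mult[OF coord da]] dN])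
    show ?thesis
    proof (cases "i = 1 \<or> i = 2")
      case True
      then show ?thesis unfolding V_def[abs_def] V'_def[abs_def] using 1 2 by auto
    next
      case False
      then show ?thesis unfolding V_def[abs_def] V'_def[abs_def] using 3 by simp
    qed
  qed
  have dVv: "((\<lambda>x. \<chi> i. V i x) has_derivative (\<lambda>h. \<chi> i. V' i h)) (at q)"
    by (rule has_derivative_vec_lambda[OF dV])
  have eqV: "(\<chi> i. V i x) = horizontal_gradient u x /\<^sub>R horizontal_gradient_norm u x" if "x \<in> U" for x
    unfolding horizontal_gradient_def frechet_derivative_heis[OF diff[OF that]] horizontal_gradient_norm_eq[OF diff[OF that]]
    by (simp add: vec_eq_iff forall_3 V_def N_def a_def b_def algebra_simps)
  have dgrad: "((\<lambda>x. horizontal_gradient u x /\<^sub>R horizontal_gradient_norm u x) has_derivative (\<lambda>h. \<chi> i. V' i h)) (at q)"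
    by (rule has_derivative_transform_within_open[OF dVv U]) (rule eqV)
  have "divergence (\<lambda>x. horizontal_gradient u x /\<^sub>R horizontal_gradient_norm u x) q = V' 1 (axis 1 1) + V' 2 (axis 2 1) + V' 3 (axis 3 1)"
    unfolding divergence_def frechet_derivative_at[OF dgrad, symmetric] by (simp add: sum_3)
  also have "\<dots> = (a' 1 - q $ 2 / 2 * a' 3 + b' 2 + q $ 1 / 2 * b' 3) / w
      - (a q * (a q * (a' 1 - q $ 2 / 2 * a' 3) + b q * (b' 1 - q $ 2 / 2 * b' 3))
        + b q * (a q * (a' 2 + q $ 1 / 2 * a' 3) + b q * (b' 2 + q $ 1 / 2 * b' 3))) / w ^ 3"
  proof -
    have ax: "A (axis k 1) = a' k" "B (axis k 1) = b' k" for k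
      by (simp_all add: A_def B_def axis_def if_distrib cong: if_cong)
    have N'ax: "N' (axis k 1) = - (a q * a' k + b q * b' k) / w ^ 3" for k
      using ax[of k] by (simp add: N'_def A_def B_def)
    have Nq: "N q = 1 / w" by (simp add: N_def w_def inverse_eq_divide)
    have ax3: "(axis 3 1 :: real^3) $ 1 = 0" "(axis 3 1 :: real^3) $ 2 = 0" by (simp_all add: axis_def)
    show ?thesis
      unfolding V'_def by (simp add: ax N'ax Nq ax3) (simp add: diff_divide_distrib add_divide_distrib algebra_simps)
  qed
  also have "\<dots> = ((a' 1 - q $ 2 / 2 * a' 3 + b' 2 + q $ 1 / 2 * b' 3) * w ^ 2
      - (a q * (a q * (a' 1 - q $ 2 / 2 * a' 3) + b q * (b' 1 - q $ 2 / 2 * b' 3))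
        + b q * (a q * (a' 2 + q $ 1 / 2 * a' 3) + b q * (b' 2 + q $ 1 / 2 * b' 3)))) / w ^ 3"
    using w by (simp add: diff_divide_distrib power2_eq_square power3_eq_cube)
  also have "\<dots> = hessian_form u q (horizontal_tangent u q) / w ^ 3"
    unfolding w2 hessian_form_def horizontal_tangent_def a_def[symmetric] b_def[symmetric]
    by (simp add: sum_3 a'_def b'_def X_of_partial_def Y_of_partial_def power2_eq_square add_divide_distrib diff_divide_distrib algebra_simps)
  also have "w = horizontal_gradient_norm u q"
    unfolding horizontal_gradient_norm_eq[OF diff[OF U(2)]] w_def a_def b_def ..
  finally show ?thesis .
qed

text \<open>Passing from \<open>u\<close> to \<open>u'\<close> multiplies the differential by
  \<open>m\<close>, hence the Hessian on the rotated gradient by \<open>m^3\<close> and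
  \<open>W^3\<close> by \<open>|m|^3\<close>. So \<open>|H|\<close> can be computed with one fixed
  \<open>u\<close>, whichever function the predicate provides at \<open>q\<close>.\<close>

lemma abs_horizontal_mean_curvature:
  assumes H: "is_horizontal_mean_curvature S H" and q: "q \<in> S" and ldf: "local_defining_function S q U u"
    and nc: "q \<notin> characteristic_points S"
  shows "\<bar>H q\<bar> = \<bar>hessian_form u q (horizontal_tangent u q)\<bar> / (horizontal_gradient_norm u q) ^ 3"
proof -
  obtain U' u' where ldf': "local_defining_function S q U' u'"
    and Hq: "H q = - divergence (\<lambda>x. horizontal_gradient u' x /\<^sub>R horizontal_gradient_norm u' x) q"
    using H q nc unfolding is_horizontal_mean_curvature_def by blast
  note L = local_defining_functionD[OF ldf] and L' = local_defining_functionD[OF ldf']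
  have d: "u differentiable (at q)" "u' differentiable (at q)" using L(2,5) L'(2,5) by blast+
  obtain m where m: "m \<noteq> 0" and m1: "\<And>h. frechet_derivative u' (at q) h = m * frechet_derivative u (at q) h"
    and m2: "\<And>v. frechet_derivative u (at q) v = 0 \<Longrightarrow>
      (\<Sum>i\<in>UNIV. \<Sum>j\<in>UNIV. partial (partial u' i) j q * v $ i * v $ j)
      = m * (\<Sum>i\<in>UNIV. \<Sum>j\<in>UNIV. partial (partial u i) j q * v $ i * v $ j)"
    by (rule defining_functions_second_order[OF q ldf ldf']) (rule that)
  let ?a = "X_of 0 (partial u) q" and ?b = "Y_of 0 (partial u) q"
  have ab: "X_of 0 (partial u') q = m * ?a" "Y_of 0 (partial u') q = m * ?b"
    using m1[of "heis_X q"] m1[of "heis_Y q"] unfolding frechet_derivative_heis[OF d(1)] frechet_derivative_heis[OF d(2)] .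
  have nz': "X_of 0 (partial u') q \<noteq> 0 \<or> Y_of 0 (partial u') q \<noteq> 0"
    using nc unfolding characteristic_points_iff[OF q ldf'] by blast
  define v where "v = horizontal_tangent u q"
  have "frechet_derivative u (at q) v = ?b * frechet_derivative u (at q) (heis_X q) - ?a * frechet_derivative u (at q) (heis_Y q)"
    using linear_frechet_derivative[OF d(1)] by (simp add: v_def horizontal_tangent_def linear_diff linear_scale)
  also have "\<dots> = 0" unfolding frechet_derivative_heis[OF d(1)] by simp
  finally have h: "hessian_form u' q v = m * hessian_form u q v"
    unfolding hessian_form_def by (rule m2)
  have "horizontal_tangent u' q = m *\<^sub>R v"
    by (simp add: v_def horizontal_tangent_def ab scaleR_diff_right)
  then have "hessian_form u' q (horizontal_tangent u' q) = m\<^sup>2 * hessian_form u' q v"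
    by (simp add: hessian_form_def sum_3 power2_eq_square algebra_simps)
  then have 1: "hessian_form u' q (horizontal_tangent u' q) = m ^ 3 * hessian_form u q v"
    by (simp add: h power2_eq_square power3_eq_cube)
  have "(m * ?a)\<^sup>2 + (m * ?b)\<^sup>2 = m\<^sup>2 * (?a\<^sup>2 + ?b\<^sup>2)" by (simp add: power_mult_distrib distrib_left)
  then have 2: "horizontal_gradient_norm u' q = \<bar>m\<bar> * horizontal_gradient_norm u q"
    unfolding horizontal_gradient_norm_eq[OF d(1)] horizontal_gradient_norm_eq[OF d(2)] ab by (simp add: real_sqrt_mult)
  have w: "horizontal_gradient_norm u q \<ge> 0" by (simp add: horizontal_gradient_norm_def)
  have "\<bar>H q\<bar> = \<bar>m ^ 3 * hessian_form u q v / (\<bar>m\<bar> * horizontal_gradient_norm u q) ^ 3\<bar>"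
    unfolding Hq divergence_normalized_gradient[OF L'(1-3) nz'] 1 2 by simp
  also have "\<dots> = \<bar>hessian_form u q v\<bar> / (horizontal_gradient_norm u q) ^ 3"
    using m w by (simp add: abs_mult power_mult_distrib power_abs)
  finally show ?thesis by (simp add: v_def)
qed

section \<open>Local integrability\<close>

lemma transversal_majorant:
  fixes l :: 3 and \<alpha> \<beta> u w :: "real ^ 3 \<Rightarrow> real" and S :: "(real ^ 3) set"
  assumes U: "open U" "p \<in> U"
    and C1: "C1_partials U u du" "C1_partials U \<alpha> d\<alpha>" "C1_partials U \<beta> d\<beta>"
    and z: "u p = 0" "\<alpha> p = 0" "\<beta> p = 0"
    and r: "r > 0"
    and cx: "complexifies r p u Fu" "complexifies r p \<alpha> F\<alpha>" "complexifies r p \<beta> F\<beta>"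
    and C1c: "C1_partials (ball 0 r) Fu Du" "C1_partials (ball 0 r) F\<alpha> D\<alpha>" "C1_partials (ball 0 r) F\<beta> D\<beta>"
    and rU: "ball p r \<subseteq> U"
    and inj: "\<And>h. h $ l = 0 \<Longrightarrow> (\<Sum>i\<in>UNIV. d\<alpha> i p * h $ i) = 0 \<Longrightarrow> (\<Sum>i\<in>UNIV. du i p * h $ i) = 0 \<Longrightarrow> h = 0"
    and S: "S \<inter> U = {q \<in> U. u q = 0}"
    and iso: "\<And>q. q \<in> S \<Longrightarrow> q \<in> ball p r \<Longrightarrow> q \<noteq> p \<Longrightarrow> \<alpha> q \<noteq> 0 \<or> \<beta> q \<noteq> 0"
    and w: "\<And>x. x \<in> ball p r \<Longrightarrow> \<bar>\<alpha> x\<bar> + \<bar>\<beta> x\<bar> \<le> 2 * w x"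
  obtains W V \<phi> K M where "open W" "W \<subseteq> ball p r" "p \<in> W" "\<phi> ` V = S \<inter> W" "local_parametrization S V \<phi>"
    "K \<in> borel_measurable borel" "(\<integral>\<^sup>+x. K x \<partial>lborel) < \<infinity>"
    "\<And>x. x \<in> V \<Longrightarrow> 1 / ennreal (w (\<phi> x)) \<le> K x"
    "\<And>x i. x \<in> V \<Longrightarrow> norm (frechet_derivative \<phi> (at x) (axis i 1)) \<le> M"
proof -
  obtain W V \<phi> k c M \<delta> where P: "open W" "W \<subseteq> ball p r" "p \<in> W" "\<phi> ` V = S \<inter> W" "local_parametrization S V \<phi>"
    "\<delta> > 0" "V = ball (axis 1 (p $ l)) \<delta>" "\<phi> (axis 1 (p $ l)) = p" "c > 0" "(k::nat) > 0"
    and low: "\<And>x. x \<in> V \<Longrightarrow> c * (\<bar>x $ 2\<bar> + \<bar>x $ 1 - p $ l\<bar> ^ k) \<le> \<bar>\<alpha> (\<phi> x)\<bar> + \<bar>\<beta> (\<phi> x)\<bar>"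
    and M: "\<And>x i. x \<in> V \<Longrightarrow> norm (frechet_derivative \<phi> (at x) (axis i 1)) \<le> M"
    by (rule adapted_parametrization[OF U C1 z r cx C1c rU inj S iso])
       (assumption, assumption, assumption, assumption, assumption, assumption, rule that)
  \<comment> \<open>Half of \<open>c\<close> makes up for the factor 2 in
    \<open>|\<alpha>| + |\<beta>| \<le> 2 w\<close>.\<close>
  have c2: "c / 2 > 0" using P(9) by simp
  obtain K :: "real^2 \<Rightarrow> ennreal" where K: "K \<in> borel_measurable borel" "(\<integral>\<^sup>+x. K x \<partial>lborel) < \<infinity>"
    "\<And>x w. x \<in> ball (axis 1 (p $ l)) \<delta> \<Longrightarrow> c / 2 * (\<bar>x $ 2\<bar> + \<bar>x $ 1 - p $ l\<bar> ^ k) \<le> w \<Longrightarrow> 1 / ennreal w \<le> K x"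
    by (rule planar_majorant[OF P(10) c2 P(6), of "p $ l"]) (rule that)
  have "1 / ennreal (w (\<phi> x)) \<le> K x" if x: "x \<in> V" for x
  proof (rule K(3))
    show "x \<in> ball (axis 1 (p $ l)) \<delta>" using x P(7) by simp
    have "\<phi> x \<in> ball p r" using x P(2,4) by blast
    from w[OF this] low[OF x] show "c / 2 * (\<bar>x $ 2\<bar> + \<bar>x $ 1 - p $ l\<bar> ^ k) \<le> w (\<phi> x)" by simp
  qed
  from P(1-5) K(1,2) this M show ?thesis by (rule that)
qed

lemma heis_commutator:
  assumes sym: "\<And>i j. E i j p = E j i p"
  shows "(Y_of_partial 0 D E 1 p - p $ 2 / 2 * Y_of_partial 0 D E 3 p)
    - (X_of_partial 0 D E 2 p + p $ 1 / 2 * X_of_partial 0 D E 3 p) = D 3 (p::real^3)"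
  using sym[of 1 2] sym[of 1 3] sym[of 2 3] by (simp add: X_of_partial_def Y_of_partial_def algebra_simps)

lemma borel_measurable_restrict_induced:
  assumes ind: "is_riemannian_induced_measure G S \<sigma>" and A: "A \<subseteq> S"
    and f: "f \<in> borel_measurable (restrict_space borel A)"
  shows "f \<in> borel_measurable (restrict_space \<sigma> A)"
proof -
  have "sets \<sigma> = sets (restrict_space borel S)"
    using ind unfolding is_riemannian_induced_measure_def by blast
  then have "sets (restrict_space \<sigma> A) = sets (restrict_space (restrict_space borel S) A)"
    by (rule sets_restrict_space_cong)
  also have "\<dots> = sets (restrict_space borel A)"
    using A by (simp add: sets_restrict_restrict_space Int_absorb1)
  finally show ?thesis using f measurable_cong_sets[OF _ refl] by blast
qed

theorem theorem4p7:
  fixes S :: "(real^3) set" and p :: "real^3"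
    and u :: "real^3 \<Rightarrow> real" and U\<^sub>0 :: "(real^3) set"
    and G :: "real^3 \<Rightarrow> real^3 \<Rightarrow> real^3 \<Rightarrow> real" and \<sigma> :: "(real^3) measure"
  assumes "real_analytic_surface S"
    and "p isolated_in characteristic_points S"
    and "local_defining_function S p U\<^sub>0 u" and "real_analytic_on U\<^sub>0 u"
    and "riemannian_metric G" and "extends_heis_metric G"
    and "is_riemannian_induced_measure G S \<sigma>"
  shows "(\<exists>U. open U \<and> p \<in> U \<and> U \<subseteq> U\<^sub>0 \<and>
            finite_nn_integral_on \<sigma> (S \<inter> U) (\<lambda>q. 1 / ennreal (horizontal_gradient_norm u q))) \<and>
         (\<forall>H. is_horizontal_mean_curvature S H \<longrightarrow>
            (\<exists>U. open U \<and> p \<in> U \<and> finite_nn_integral_on \<sigma> (S \<inter> U) (\<lambda>q. ennreal \<bar>H q\<bar>)))"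
proof -
  note ldf = assms(3) and ind = assms(7)
  note L = local_defining_functionD[OF ldf]
  note C1u = Ck_on_2_partials(1)[OF L(3)] and C1P = Ck_on_2_partials(2)[OF L(3)]
  define P where "P = partial u"
  define Q where "Q i = partial (partial u i)" for i
  define a where "a = X_of 0 P"
  define b where "b = Y_of 0 P"
  define w where "w = horizontal_gradient_norm u"
  have C1a: "C1_partials U\<^sub>0 a (X_of_partial 0 P Q)" and C1b: "C1_partials U\<^sub>0 b (Y_of_partial 0 P Q)"
    unfolding a_def b_def P_def Q_def by (rule C1_partials_X_of[OF C1P] C1_partials_Y_of[OF C1P])+
  have pS: "p \<in> S" and pc: "p \<in> characteristic_points S"
    using assms(2) by (auto simp: isolated_in_def characteristic_points_def)
  have up: "u p = 0" using L(2,4) pS by blast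
  have char: "q \<in> characteristic_points S \<longleftrightarrow> a q = 0 \<and> b q = 0" if "q \<in> S" "q \<in> U\<^sub>0" for q
    unfolding a_def b_def P_def
    by (rule characteristic_points_iff[OF that(1) local_defining_function_transfer[OF ldf that(2)]])
  have abp: "a p = 0" "b p = 0" using char[OF pS L(2)] pc by blast+
  have weq: "w q = sqrt ((a q)\<^sup>2 + (b q)\<^sup>2)" if "q \<in> U\<^sub>0" for q
    unfolding w_def a_def b_def P_def by (rule horizontal_gradient_norm_eq[OF L(5)[OF that]])
  obtain T where T: "open T" "T \<inter> characteristic_points S = {p}"
    using assms(2) by (auto simp: isolated_in_def)

  obtain r0 F D E where r0: "r0 > 0" and cF: "complexifies r0 p u F" and CF: "C1_partials (ball 0 r0) F D"
    and CD: "\<And>i. C1_partials (ball 0 r0) (D i) (E i)" and symE: "\<And>i j. E i j = E j i"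
    by (rule real_analytic_on_imp_complexification[OF assms(4) L(2)]) (rule that)
  have "open (U\<^sub>0 \<inter> T)" "p \<in> U\<^sub>0 \<inter> T" using L(1,2) T by auto
  then obtain r1 where r1: "r1 > 0" "cball p r1 \<subseteq> U\<^sub>0 \<inter> T" using open_contains_cball by blast
  \<comment> \<open>\<open>r1\<close> keeps the ball in the domain of \<open>u\<close> and away from
    other characteristic points, \<open>r0\<close> is the radius of the complexification, and
    \<open>1\<close> is the radius on which the density bound holds.\<close>
  define r where "r = min 1 (min r0 r1)"
  have r: "r > 0" and rr: "r \<le> 1" "r \<le> r0" "r \<le> r1" using r0 r1 by (auto simp: r_def)
  have crU: "cball p r \<subseteq> U\<^sub>0" "cball p r \<subseteq> T" using r1 rr by auto
  then have rU: "ball p r \<subseteq> U\<^sub>0" using ball_subset_cball by blast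
  have sub: "ball (0::complex^3) r \<subseteq> ball 0 r0" using rr by auto
  have CF': "C1_partials (ball 0 r) F D" by (rule C1_partials_subset[OF CF sub])
  have CD': "C1_partials (ball 0 r) (D i) (E i)" for i by (rule C1_partials_subset[OF CD sub])
  have cF': "complexifies r p u F" using cF rr by (auto simp: complexifies_def)
  have cD: "complexifies r p (P i) (D i)" for i
    unfolding P_def by (rule complexifies_partials[OF cF' CF' C1_partials_subset[OF C1u rU]])
  have cE: "complexifies r p (Q i j) (E i j)" for i j
    unfolding Q_def by (rule complexifies_partials[OF cD[unfolded P_def] CD' C1_partials_subset[OF C1P rU]])
  have symQ: "Q i j p = Q j i p" for i j
    using cE[of i j] cE[of j i] symE[of i j] r unfolding complexifies_def by (metis centre_in_ball of_real_eq_iff)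
  have ca: "complexifies r p a (X_of (of_real (p $ 2)) D)" and cb: "complexifies r p b (Y_of (of_real (p $ 1)) D)"
    unfolding a_def b_def by (rule complexifies_X_of[OF cD] complexifies_Y_of[OF cD])+
  note Ca = C1_partials_X_of[OF CD', of "of_real (p $ 2)"] and Cb = C1_partials_Y_of[OF CD', of "of_real (p $ 1)"]
  have iso: "a q \<noteq> 0 \<or> b q \<noteq> 0" if "q \<in> S" "q \<in> ball p r" "q \<noteq> p" for q
  proof -
    have "q \<in> T" "q \<in> U\<^sub>0" using that(2) crU by auto
    then show ?thesis using char[of q] T(2) that by blast
  qed
  \<comment> \<open>At \<open>p\<close> the equations \<open>X u = Y u = 0\<close> express the first
    two partials through the third, so a nonzero differential forces
    \<open>P 3 p \<noteq> 0\<close>.\<close>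
  have P12: "P 1 p = p $ 2 / 2 * P 3 p" "P 2 p = - (p $ 1 / 2) * P 3 p"
    using abp by (simp_all add: a_def b_def X_of_def Y_of_def)
  have P3: "P 3 p \<noteq> 0"
  proof
    assume "P 3 p = 0"
    then have "P i p = 0" for i using P12 exhaust_3[of i] by auto
    then have "partial u i p = 0" for i unfolding P_def .
    then have "frechet_derivative u (at p) e = 0" for e
      unfolding frechet_eq_partials[OF L(5)[OF L(2)], of e] by simp
    then show False using L(6)[OF pS L(2)] by simp
  qed
  \<comment> \<open>The tangent plane at \<open>p\<close> is the horizontal plane, whose vectors are
    determined by their first two coordinates.\<close>
  have kerP: "h $ 3 = p $ 1 / 2 * h $ 2 - p $ 2 / 2 * h $ 1" if "(\<Sum>i\<in>UNIV. P i p * h $ i) = 0" for h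
  proof -
    have "P 3 p * (h $ 3 - (p $ 1 / 2 * h $ 2 - p $ 2 / 2 * h $ 1)) = 0"
      using that by (simp add: sum_3 P12 algebra_simps)
    then show ?thesis using P3 by simp
  qed
  let ?Ya = "X_of_partial 0 P Q 2 p + p $ 1 / 2 * X_of_partial 0 P Q 3 p"
  let ?Xb = "Y_of_partial 0 P Q 1 p - p $ 2 / 2 * Y_of_partial 0 P Q 3 p"
  have wab: "\<bar>a x\<bar> + \<bar>b x\<bar> \<le> 2 * w x" if "x \<in> ball p r" for x
  proof -
    have "x \<in> U\<^sub>0" using that rU by blast
    then show ?thesis
      using add_mono[OF real_sqrt_ge_abs1[of "a x" "b x"] real_sqrt_ge_abs2[of "b x" "a x"]] by (simp add: weq)
  qed
  have "\<exists>W V \<phi> K M. open W \<and> W \<subseteq> ball p r \<and> p \<in> W \<and> \<phi> ` V = S \<inter> W \<and> local_parametrization S V \<phi> \<and>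
    K \<in> borel_measurable borel \<and> (\<integral>\<^sup>+x. K x \<partial>lborel) < \<infinity> \<and>
    (\<forall>x\<in>V. 1 / ennreal (w (\<phi> x)) \<le> K x) \<and>
    (\<forall>x\<in>V. \<forall>i. norm (frechet_derivative \<phi> (at x) (axis i 1)) \<le> M)"
  proof (cases "?Ya = 0")
    case False
    \<comment> \<open>A tangent vector with \<open>h $ 1 = 0\<close> is \<open>h $ 2\<close> times
      \<open>heis_Y p\<close>, on which the differential of \<open>a\<close> takes the value
      \<open>h $ 2 * ?Ya\<close>.\<close>
    have inj: "h = 0" if h: "h $ 1 = 0" "(\<Sum>i\<in>UNIV. X_of_partial 0 P Q i p * h $ i) = 0" "(\<Sum>i\<in>UNIV. P i p * h $ i) = 0" for h
    proof -
      have "h $ 2 * ?Ya = 0" using h(1,2) kerP[OF h(3)] by (simp add: sum_3 algebra_simps)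
      then have "h $ 2 = 0" using False by simp
      then show ?thesis using h(1) kerP[OF h(3)] by (simp add: vec_eq_iff forall_3)
    qed
    obtain W V \<phi> K M where X: "open W" "W \<subseteq> ball p r" "p \<in> W" "\<phi> ` V = S \<inter> W" "local_parametrization S V \<phi>"
      "K \<in> borel_measurable borel" "(\<integral>\<^sup>+x. K x \<partial>lborel) < \<infinity>"
      "\<And>x. x \<in> V \<Longrightarrow> 1 / ennreal (w (\<phi> x)) \<le> K x"
      "\<And>x i. x \<in> V \<Longrightarrow> norm (frechet_derivative \<phi> (at x) (axis i 1)) \<le> M"
      by (rule transversal_majorant[OF L(1,2) C1u[folded P_def] C1a C1b up abp r cF' ca cb CF' Ca Cb rU inj L(4) iso wab])
         (assumption, assumption, assumption, assumption, assumption, assumption, assumption, rule that)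
    show ?thesis
      by (intro exI conjI ballI allI)
         (rule X(1), rule X(2), rule X(3), rule X(4), rule X(5), rule X(6), rule X(7), erule X(8), erule X(9))
  next
    case True
    then have Xb: "?Xb \<noteq> 0" using heis_commutator[of Q p P, OF symQ] P3 by simp
    have inj: "h = 0" if h: "h $ 2 = 0" "(\<Sum>i\<in>UNIV. Y_of_partial 0 P Q i p * h $ i) = 0" "(\<Sum>i\<in>UNIV. P i p * h $ i) = 0" for h
    proof -
      have "h $ 1 * ?Xb = 0" using h(1,2) kerP[OF h(3)] by (simp add: sum_3 algebra_simps)
      then have "h $ 1 = 0" using Xb by simp
      then show ?thesis using h(1) kerP[OF h(3)] by (simp add: vec_eq_iff forall_3)
    qed
    have iso': "b q \<noteq> 0 \<or> a q \<noteq> 0" if "q \<in> S" "q \<in> ball p r" "q \<noteq> p" for q using iso[OF that] by blast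
    have wba: "\<bar>b x\<bar> + \<bar>a x\<bar> \<le> 2 * w x" if "x \<in> ball p r" for x using wab[OF that] by simp
    obtain W V \<phi> K M where X: "open W" "W \<subseteq> ball p r" "p \<in> W" "\<phi> ` V = S \<inter> W" "local_parametrization S V \<phi>"
      "K \<in> borel_measurable borel" "(\<integral>\<^sup>+x. K x \<partial>lborel) < \<infinity>"
      "\<And>x. x \<in> V \<Longrightarrow> 1 / ennreal (w (\<phi> x)) \<le> K x"
      "\<And>x i. x \<in> V \<Longrightarrow> norm (frechet_derivative \<phi> (at x) (axis i 1)) \<le> M"
      by (rule transversal_majorant[OF L(1,2) C1u[folded P_def] C1b C1a up abp(2,1) r cF' cb ca CF' Cb Ca rU inj L(4) iso' wba])
         (assumption, assumption, assumption, assumption, assumption, assumption, assumption, rule that)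
    show ?thesis
      by (intro exI conjI ballI allI)
         (rule X(1), rule X(2), rule X(3), rule X(4), rule X(5), rule X(6), rule X(7), erule X(8), erule X(9))
  qed
  then obtain W V \<phi> K M where W: "open W" "W \<subseteq> ball p r" "p \<in> W" and img: "\<phi> ` V = S \<inter> W" and lp: "local_parametrization S V \<phi>"
    and K: "K \<in> borel_measurable borel" "(\<integral>\<^sup>+x. K x \<partial>lborel) < \<infinity>"
    and Kw: "\<forall>x\<in>V. 1 / ennreal (w (\<phi> x)) \<le> K x"
    and M: "\<forall>x\<in>V. \<forall>i. norm (frechet_derivative \<phi> (at x) (axis i 1)) \<le> M"
    by (elim exE conjE) (rule that)
  have WU: "W \<subseteq> U\<^sub>0" using W(2) rU by blast
  obtain C where C: "C \<ge> 0"
    "\<And>q v w M. q \<in> S \<Longrightarrow> q \<in> U\<^sub>0 \<Longrightarrow> q \<in> cball p 1 \<Longrightarrow> norm v \<le> M \<Longrightarrow> norm w \<le> M \<Longrightarrow> induced_density G S q v w \<le> C * M\<^sup>2"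
    by (rule induced_density_bounded[OF assms(5) ldf]) (rule that)
  have dens: "induced_density G S (\<phi> x) (frechet_derivative \<phi> (at x) (axis 1 1)) (frechet_derivative \<phi> (at x) (axis 2 1)) \<le> C * M\<^sup>2"
    if x: "x \<in> V" for x
  proof -
    have "\<phi> x \<in> S \<inter> W" using img x by blast
    moreover from this have "\<phi> x \<in> cball p 1" using W(2) rr by fastforce
    ultimately show ?thesis using C(2) M x WU by blast
  qed
  \<comment> \<open>Stated for any \<open>h\<close> dominated by a multiple of \<open>1/w\<close>,
    so that it applies both to \<open>1/w\<close> and to the curvature.\<close>
  have finite: "(\<integral>\<^sup>+q\<in>S \<inter> W. h q \<partial>\<sigma>) < \<infinity>"
    if h: "\<And>q. q \<in> S \<inter> W \<Longrightarrow> h q \<le> ennreal c * (1 / ennreal (w q))" for h c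
  proof -
    have "h (\<phi> x) \<le> ennreal c * K x" if x: "x \<in> V" for x
    proof -
      have "h (\<phi> x) \<le> ennreal c * (1 / ennreal (w (\<phi> x)))" using h img x by blast
      also have "\<dots> \<le> ennreal c * K x" using Kw x by (intro mult_left_mono) auto
      finally show ?thesis .
    qed
    then have "(\<integral>\<^sup>+q\<in>\<phi> ` V. h q \<partial>\<sigma>) \<le> ennreal (C * M\<^sup>2) * (\<integral>\<^sup>+x. ennreal c * K x \<partial>lborel)"
      by (intro nn_integral_induced_measure_le[OF ind lp dens]) (use K in auto)
    also have "(\<integral>\<^sup>+x. ennreal c * K x \<partial>lborel) = ennreal c * (\<integral>\<^sup>+x. K x \<partial>lborel)"
      by (rule nn_integral_cmult) (use K in simp)
    also have "ennreal (C * M\<^sup>2) * \<dots> < \<infinity>" using K(2) by (simp add: ennreal_mult_less_top)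
    finally show ?thesis unfolding img .
  qed
  have contab: "continuous_on U\<^sub>0 a" "continuous_on U\<^sub>0 b"
    by (rule C1_partials_continuous[OF C1a] C1_partials_continuous[OF C1b])+
  have "continuous_on U\<^sub>0 w"
  proof (rule continuous_on_eq)
    show "continuous_on U\<^sub>0 (\<lambda>q. sqrt ((a q)\<^sup>2 + (b q)\<^sup>2))" by (intro continuous_intros contab)
  qed (simp add: weq)
  then have mw: "w \<in> borel_measurable (restrict_space borel (S \<inter> W))"
    by (intro borel_measurable_continuous_on_restrict) (rule continuous_on_subset, use WU in auto)
  have "finite_nn_integral_on \<sigma> (S \<inter> W) (\<lambda>q. 1 / ennreal (w q))"
    unfolding finite_nn_integral_on_def
  proof
    show "(\<lambda>q. 1 / ennreal (w q)) \<in> borel_measurable (restrict_space \<sigma> (S \<inter> W))"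
    proof (rule borel_measurable_restrict_induced[OF ind])
      note mw[measurable]
      show "(\<lambda>q. 1 / ennreal (w q)) \<in> borel_measurable (restrict_space borel (S \<inter> W))" by measurable
    qed simp
    show "(\<integral>\<^sup>+q\<in>S \<inter> W. 1 / ennreal (w q) \<partial>\<sigma>) < \<infinity>" by (rule finite[of _ 1]) simp
  qed
  moreover have "finite_nn_integral_on \<sigma> (S \<inter> W) (\<lambda>q. ennreal \<bar>H q\<bar>)" if H: "is_horizontal_mean_curvature S H" for H
  proof -
    define g where "g q = hessian_form u q (horizontal_tangent u q)" for q
    have nch: "q \<notin> characteristic_points S" and wpos: "w q > 0" if "q \<in> S \<inter> W" "q \<noteq> p" for q
    proof -
      have q: "q \<in> ball p r" "q \<in> U\<^sub>0" "q \<in> S" using that W(2) rU by auto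
      show "q \<notin> characteristic_points S" using char[OF q(3,2)] iso[OF q(3,1) that(2)] by blast
      show "w q > 0" using iso[OF q(3,1) that(2)] by (simp add: weq[OF q(2)] sum_power2_gt_zero_iff)
    qed
    have Hq: "\<bar>H q\<bar> = \<bar>g q\<bar> / w q ^ 3" if "q \<in> S \<inter> W" "q \<noteq> p" for q
      unfolding g_def w_def
      by (rule abs_horizontal_mean_curvature[OF H _ local_defining_function_transfer[OF ldf] nch[OF that]])
         (use that WU in auto)
    have contQ: "continuous_on U\<^sub>0 (Q i j)" for i j unfolding Q_def by (rule C1_partialsD(2)[OF C1P])
    have contX: "continuous_on U\<^sub>0 heis_X" "continuous_on U\<^sub>0 heis_Y"
    proof -
      have eq: "heis_X = (\<lambda>q. \<chi> i. if i = 1 then 1 else if i = 2 then 0 else - (q $ 2) / 2)"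
        "heis_Y = (\<lambda>q. \<chi> i. if i = 1 then 0 else if i = 2 then 1 else q $ 1 / 2)"
        by (rule ext; simp add: vec_eq_iff forall_3)+
      have 1: "continuous_on U\<^sub>0 (\<lambda>q::real^3. if i = 1 then 1 else if i = 2 then 0 else - (q $ 2) / 2)" for i :: 3
        by (cases "i = 1"; cases "i = 2") (auto intro!: continuous_intros)
      have 2: "continuous_on U\<^sub>0 (\<lambda>q::real^3. if i = 1 then 0 else if i = 2 then 1 else q $ 1 / 2)" for i :: 3
        by (cases "i = 1"; cases "i = 2") (auto intro!: continuous_intros)
      show "continuous_on U\<^sub>0 heis_X" unfolding eq(1) by (rule continuous_on_vec_lambda[OF 1])
      show "continuous_on U\<^sub>0 heis_Y" unfolding eq(2) by (rule continuous_on_vec_lambda[OF 2])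
    qed
    have tan: "horizontal_tangent u q = b q *\<^sub>R heis_X q - a q *\<^sub>R heis_Y q" for q
      by (simp add: horizontal_tangent_def a_def b_def P_def)
    have hess: "hessian_form u q v = (\<Sum>i\<in>UNIV. \<Sum>j\<in>UNIV. Q i j q * v $ i * v $ j)" for q v
      by (simp add: hessian_form_def Q_def)
    have contg: "continuous_on U\<^sub>0 g"
      unfolding g_def hess tan by (intro continuous_intros contQ contab contX)
    have "continuous_on (cball p r) (\<lambda>q. (\<Sum>i\<in>UNIV. \<Sum>j\<in>UNIV. \<bar>Q i j q\<bar>) * (norm (heis_X q) + norm (heis_Y q))\<^sup>2)"
      by (rule continuous_on_subset[OF _ crU(1)]) (intro continuous_intros contQ contX)
    then obtain c0 where c0: "c0 \<ge> 0"
      "\<And>q. q \<in> cball p r \<Longrightarrow> (\<Sum>i\<in>UNIV. \<Sum>j\<in>UNIV. \<bar>Q i j q\<bar>) * (norm (heis_X q) + norm (heis_Y q))\<^sup>2 \<le> c0"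
      by (rule bounded_above_on_compact[OF compact_cball]) (rule that)
    \<comment> \<open>\<open>g\<close> is quadratic in the rotated gradient, whose coefficients
      \<open>a\<close> and \<open>b\<close> are at most \<open>w\<close> in absolute value;
      compactness bounds the Hessian and the frame.\<close>
    have gb: "\<bar>g q\<bar> \<le> c0 * (w q)\<^sup>2" if q: "q \<in> W" for q
    proof -
      let ?v = "horizontal_tangent u q"
      have qr: "q \<in> cball p r" "q \<in> U\<^sub>0" using q W(2) WU by auto
      have ab: "\<bar>a q\<bar> \<le> w q" "\<bar>b q\<bar> \<le> w q" unfolding weq[OF qr(2)] by auto
      have "norm ?v \<le> \<bar>b q\<bar> * norm (heis_X q) + \<bar>a q\<bar> * norm (heis_Y q)"
        unfolding tan using norm_triangle_ineq4[of "b q *\<^sub>R heis_X q" "a q *\<^sub>R heis_Y q"] by simp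
      also have "\<dots> \<le> w q * (norm (heis_X q) + norm (heis_Y q))"
        unfolding distrib_left by (intro add_mono mult_right_mono ab) auto
      finally have "(norm ?v)\<^sup>2 \<le> (w q * (norm (heis_X q) + norm (heis_Y q)))\<^sup>2" by (rule power_mono) simp
      then have nv: "(norm ?v)\<^sup>2 \<le> (norm (heis_X q) + norm (heis_Y q))\<^sup>2 * (w q)\<^sup>2" by (simp add: power_mult_distrib mult.commute)
      have "\<bar>g q\<bar> \<le> (\<Sum>i\<in>UNIV. \<Sum>j\<in>UNIV. \<bar>Q i j q\<bar> * (norm ?v)\<^sup>2)"
        unfolding g_def hess
      proof (intro order_trans[OF sum_abs] sum_mono)
        fix i j :: 3
        have "\<bar>Q i j q * ?v $ i * ?v $ j\<bar> \<le> \<bar>Q i j q\<bar> * norm ?v * norm ?v"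
          unfolding abs_mult by (intro mult_mono component_le_norm_cart) auto
        then show "\<bar>Q i j q * ?v $ i * ?v $ j\<bar> \<le> \<bar>Q i j q\<bar> * (norm ?v)\<^sup>2" by (simp add: power2_eq_square mult.assoc)
      qed
      also have "\<dots> = (\<Sum>i\<in>UNIV. \<Sum>j\<in>UNIV. \<bar>Q i j q\<bar>) * (norm ?v)\<^sup>2" by (simp add: sum_distrib_right)
      also have "\<dots> \<le> (\<Sum>i\<in>UNIV. \<Sum>j\<in>UNIV. \<bar>Q i j q\<bar>) * ((norm (heis_X q) + norm (heis_Y q))\<^sup>2 * (w q)\<^sup>2)"
        by (intro mult_left_mono nv sum_nonneg) auto
      also have "\<dots> \<le> c0 * (w q)\<^sup>2"
        unfolding mult.assoc[symmetric] by (intro mult_right_mono c0(2)[OF qr(1)]) auto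
      finally show ?thesis .
    qed
    have Hle: "ennreal \<bar>H q\<bar> \<le> ennreal (c0 + 1) * (1 / ennreal (w q))" if q: "q \<in> S \<inter> W" for q
    proof (cases "q = p")
      case True
      \<comment> \<open>The value of \<open>H\<close> at \<open>p\<close> is arbitrary, but the
        right side is infinite there: \<open>1 / ennreal 0\<close> is \<open>top\<close>, and the
        factor \<open>c0 + 1\<close> is positive, whereas \<open>c0 = 0\<close> would give
        \<open>0 * top = 0\<close>.\<close>
      have "w p = 0" using weq[OF L(2)] abp by simp
      then have "ennreal (c0 + 1) * (1 / ennreal (w q)) = top" using True c0(1) by (simp add: ennreal_mult_top)
      then show ?thesis by simp
    next
      case False
      note wp = wpos[OF q False]
      have "\<bar>H q\<bar> \<le> c0 * (w q)\<^sup>2 / w q ^ 3"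
        unfolding Hq[OF q False] using gb[of q] q wp by (intro divide_right_mono) auto
      also have "\<dots> = c0 / w q" using wp by (simp add: power2_eq_square power3_eq_cube)
      also have "\<dots> \<le> (c0 + 1) * (1 / w q)" using wp c0 by (simp add: field_simps)
      finally have "ennreal \<bar>H q\<bar> \<le> ennreal ((c0 + 1) * (1 / w q))" by (rule ennreal_leI)
      also have "\<dots> = ennreal (c0 + 1) * (1 / ennreal (w q))"
      proof -
        have "ennreal (1 / w q) = 1 / ennreal (w q)" using divide_ennreal[of 1 "w q"] wp by simp
        moreover have "ennreal ((c0 + 1) * (1 / w q)) = ennreal (c0 + 1) * ennreal (1 / w q)"
          using c0(1) wp by (intro ennreal_mult) auto
        ultimately show ?thesis by (simp only:)
      qed
      finally show ?thesis .
    qed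
    show ?thesis
      unfolding finite_nn_integral_on_def
    proof
      show "(\<lambda>q. ennreal \<bar>H q\<bar>) \<in> borel_measurable (restrict_space \<sigma> (S \<inter> W))"
      proof (rule borel_measurable_restrict_induced[OF ind])
        have mg: "g \<in> borel_measurable (restrict_space borel (S \<inter> W))"
          by (rule borel_measurable_continuous_on_restrict, rule continuous_on_subset[OF contg]) (use WU in auto)
        note mg[measurable] mw[measurable]
        have mid: "(\<lambda>q. q) \<in> borel_measurable (restrict_space borel (S \<inter> W))"
          by (rule measurable_restrict_space1) simp
        have "{q \<in> space (restrict_space borel (S \<inter> W)). q = p} \<in> sets (restrict_space borel (S \<inter> W))"
          using measurable_sets[OF mid, of "{p}"] by (simp add: vimage_def Int_def conj_commute)
        then have [measurable]: "Measurable.pred (restrict_space borel (S \<inter> W)) (\<lambda>q. q = p)" by (simp add: pred_def)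
        \<comment> \<open>The sign of \<open>H\<close> may vary from point to point without any
          regularity, so measurability is obtained for \<open>|H|\<close> from its formula off
          \<open>p\<close>, with the single point \<open>p\<close> split off.\<close>
        have "(\<lambda>q. if q = p then ennreal \<bar>H p\<bar> else ennreal (\<bar>g q\<bar> / w q ^ 3)) \<in> borel_measurable (restrict_space borel (S \<inter> W))"
          by measurable
        then show "(\<lambda>q. ennreal \<bar>H q\<bar>) \<in> borel_measurable (restrict_space borel (S \<inter> W))"
          by (rule measurable_cong[THEN iffD1, rotated]) (auto simp: space_restrict_space Hq)
      qed simp
      show "(\<integral>\<^sup>+q\<in>S \<inter> W. ennreal \<bar>H q\<bar> \<partial>\<sigma>) < \<infinity>" by (rule finite[of _ "c0 + 1"]) (rule Hle)
    qed
  qed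
  ultimately show ?thesis using W WU unfolding w_def by blast
qed

end
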